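(* Let $n\ge 1$, $\underline{\lambda}=(\lambda_1,\dots,\lambda_n)\in\mathbb{C}^n$, $\mu\in\mathbb{C}$, $k\in\frac12\mathbb{N}$, and put $\delta=\mu-|\underline{\lambda}|$ where $|\underline{\lambda}|=\lambda_1+\dots+\lambda_n$. Suppose $\delta$ is non-resonant, i.e. $\delta\notin\{\frac12,1,\frac32,2,\dots,k\}$. Then $\mathfrak{D}^k_{\underline{\lambda},\mu}$ and $\mathcal{S}^k_\delta$ are isomorphic as $\mathfrak{osp}(1|2)$-modules through the family of $\mathfrak{osp}(1|2)$-equivariant symbol maps $\sigma^{\varpi}_{\underline{\lambda},\mu}$ defined by $$\sigma^{\varpi}_{\underline{\lambda},\mu}(A)=\alpha^\delta\sum_{p=0}^{2k}\sum_{|\underline{i}|=p}\sum_{\ell=p}^{2k}\sum_{|\underline{s}|=\ell}\varpi^{\underline{s}}_{\underline{i}}\,D^{\ell-p}(a_{\underline{s}})\,\alpha^{-\frac{|\underline{i}|}{2}},$$ for $A=\sum_{p=0}^{2k}\sum_{|\underline{i}|=p}a_{\underline{i}}\,\overline{D}^{i_1}\otimes\cdots\otimes\overline{D}^{i_n}\in\mathfrak{D}^k_{\underline{\lambda},\mu}$, where the $\varpi^{\underline{s}}_{\underline{i}}$ are constants satisfying, for all multi-indices $\underline{i},\underline{s}$ with $p=|\underline{i}|$, $\ell=|\underline{s}|$, the induction formula $$(-1)^{\ell-p}\Big([\tfrac{\ell-p}{2}]+(1-(-1)^{\ell-p})(\delta-\tfrac{\ell}{2})\Big)\varpi^{\underline{s}}_{\underline{i}}-\Big([\tfrac{s_1}{2}]+(1-(-1)^{s_1})\lambda_1\Big)\varpi^{\underline{s}-\mathbf{1}_1}_{\underline{i}}-\sum_{j=2}^n(-1)^{s_1+\dots+s_{j-1}}\Big([\tfrac{s_j}{2}]+(1-(-1)^{s_j})\lambda_j\Big)\varpi^{\underline{s}-\mathbf{1}_j}_{\underline{i}}=0,$$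 the top-order constants $(\varpi^{\underline{s}}_{\underline{i}})_{|\underline{s}|=|\underline{i}|=2k}$ forming a non-singular matrix $\varpi$ (the principal symbol). If $\varpi$ is the identity, one obtains the normalized symbol map $$\sigma^{Id}_{\underline{\lambda},\mu}(A)=\alpha^\delta\sum_{p=0}^{2k}\sum_{|\underline{i}|=p}\sum_{\ell=p}^{2k}\sum_{\substack{|\underline{s}|=\ell\\ s_1\ge i_1,\dots,s_n\ge i_n}}\gamma^{\underline{s}}_{\underline{i}}\,D^{\ell-p}(a_{\underline{s}})\,\alpha^{-\frac{|\underline{i}|}{2}},$$ with $$\gamma^{\underline{s}}_{\underline{i}}=(-1)^{[\frac{\ell-p+1}{2}]}\prod_{t=2}^n\frac{(-1)^{\psi(t)}\left(\varphi(t)\atop s_t-i_t\right)_s\Xi_{s_t,i_t}(\lambda_t)}{\left([\frac{\varphi(t)}{2}]\atop[\frac{s_t-i_t}{2}]\right)\left([\frac{\varphi(t)+1}{2}]\atop[\frac{s_t-i_t+1}{2}]\right)\left(2\delta-p-1\atop[\frac{\ell-p+1}{2}]\right)}\;\Xi_{s_1,i_1}(\lambda_1),$$ where $\ell=|\underline{s}|$, $p=|\underline{i}|$, $\varphi(t)=\sum_{j=1}^t(s_j-i_j)$, $\psi(t)=\sum_{j=1}^{t-1}s_j(s_{j+1}-i_{j+1})$, and $\Xi_{s,i}(\lambda)=\left([\frac{s}{2}]\atop[\frac{i}{2}]\right)\left(2\lambda+[\frac{s-1}{2}]\atop[\frac{2(s-i)+1+(-1)^i}{4}]\right)$. Moreover,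 once the principal symbol is fixed, the symbol map $\sigma^{\varpi}_{\underline{\lambda},\mu}$ is unique.
   Context: The supercircle $S^{1|1}$ has function algebra $C^\infty_{\mathbb{C}}(S^{1|1})$ of elements $F=f_0(x)+\theta f_1(x)$, with $x$ even, $\theta$ odd ($\theta^2=0$), $f_0,f_1$ smooth complex functions on $S^1$; $F'=f_0'+\theta f_1'$ and $|F|$ denotes parity. Set $D=\partial_\theta+\theta\partial_x$, $\overline{D}=\partial_\theta-\theta\partial_x$ (so $\overline{D}^2=-\partial_x$), and $\alpha=dx+\theta d\theta$. The Lie superalgebra $\mathcal{K}(1)$ of contact vector fields consists of $X_f=-f\overline{D}^2+\frac12 D(f)\overline{D}$, $f\in C^\infty_{\mathbb{C}}(S^{1|1})$. The orthosymplectic superalgebra $\mathfrak{osp}(1|2)\subset\mathcal{K}(1)$ is spanned by $X_1=\partial_x$, $X_x=x\partial_x+\frac12\theta\partial_\theta$, $X_{x^2}=x^2\partial_x+x\theta\partial_\theta$, $X_\theta=\frac12 D$, $X_{x\theta}=\frac12 xD$. For $\lambda\in\mathbb{C}$, $\mathfrak{F}_\lambda=\{G\alpha^\lambda: G\in C^\infty_{\mathbb{C}}(S^{1|1})\}$ with $\mathcal{K}(1)$-action $\mathfrak{L}^\lambda_{X_F}(G\alpha^\lambda)=(X_F(G)+\lambda F'G)\alpha^\lambda$. The tensor product $\mathfrak{F}_{\lambda_1}\otimes\cdots\otimes\mathfrak{F}_{\lambda_n}$ carries the action $\mathfrak{L}^{\underline\lambda}_{X_F}(\Phi_1\otimes\cdots\otimes\Phi_n)=\sum_{p=1}^n(-1)^{|F|(|\Phi_1|+\dots+|\Phi_{p-1}|)}\Phi_1\otimes\cdots\otimes\mathfrak{L}^{\lambda_p}_{X_F}(\Phi_p)\otimes\cdots\otimes\Phi_n$.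 $\mathfrak{D}_{\underline\lambda,\mu}$ is the space of $n$-ary differential operators $\mathfrak{F}_{\lambda_1}\otimes\cdots\otimes\mathfrak{F}_{\lambda_n}\to\mathfrak{F}_\mu$, each of the form $A=\sum_{\underline{i}}a_{\underline{i}}\overline{D}^{i_1}\otimes\cdots\otimes\overline{D}^{i_n}$ with $a_{\underline{i}}\in C^\infty_{\mathbb{C}}(S^{1|1})$, acting by $A(f_1\alpha^{\lambda_1}\otimes\cdots\otimes f_n\alpha^{\lambda_n})=\big(\sum_{\underline{i}}a_{\underline{i}}(-1)^{\sum_{p=1}^{n-1}|f_p|\sum_{s=p+1}^n i_s}\overline{D}^{i_1}(f_1)\cdots\overline{D}^{i_n}(f_n)\big)\alpha^\mu$; $\mathfrak{D}^k_{\underline\lambda,\mu}$ ($k\in\frac12\mathbb{N}$) consists of those with $|\underline{i}|=i_1+\dots+i_n\le 2k$. $\mathcal{K}(1)$ acts on $\mathfrak{D}_{\underline\lambda,\mu}$ by $\mathfrak{L}^{\underline\lambda,\mu}_{X_F}(A)=\mathfrak{L}^\mu_{X_F}\circ A-(-1)^{|A||F|}A\circ\mathfrak{L}^{\underline\lambda}_{X_F}$. The space of symbols $\mathcal{S}^k_\delta$ is the graded module associated with the filtration $\mathfrak{D}^0\subset\mathfrak{D}^{1/2}\subset\cdots\subset\mathfrak{D}^k$; its elements are written uniquely as $\alpha^\delta\sum_{\ell=0}^{2k}\sum_{|\underline{i}|=\ell}\bar a_{\underline{i}}\alpha^{-|\underline{i}|/2}$ with $\bar a_{\underline{i}}\in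 C^\infty_{\mathbb{C}}(S^{1|1})$, the component indexed by $\underline{i}$ being a copy of $\mathfrak{F}_{\delta-|\underline{i}|/2}$ with its density action. A principal symbol map multiplies the top components (those with $|\underline{i}|=2k$) by a non-singular matrix $\varpi$; a symbol map is a linear bijection $\mathfrak{D}_{\underline\lambda,\mu}\to\mathcal{S}_\delta$ whose highest-order term coincides with the principal symbol. Notation: $\mathbf{1}_j$ is the multi-index with $1$ in position $j$ and $0$ elsewhere; $[x]$ is the integer part; $\left(\nu\atop q\right)=\frac{\nu(\nu-1)\cdots(\nu-q+1)}{q!}$; the super binomial is $\left(j\atop i\right)_s=\left([j/2]\atop[i/2]\right)$ if $i$ is even or $j$ is odd, and $0$ otherwise.
   Formalization: S^{1|1} is replaced by the line R^{1|1}, where x is globally defined; the principal symbol is a non-singular block at every order p ≤ 2k, not only the top; in γ the binomial in 2δ−p−1 occurs once, outside the product, and ψ(t)=Σ_{j<t} s_j(s_t−i_t). *)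

theory Defs
  imports "HOL-Analysis.Analysis"
begin

text \<open>F = f0(x) + theta f1(x) is represented by the pair (f0, f1).\<close>
type_synonym sfun = "(real \<Rightarrow> complex) \<times> (real \<Rightarrow> complex)"

definition vderiv :: "(real \<Rightarrow> complex) \<Rightarrow> real \<Rightarrow> complex" where
  "vderiv f = (\<lambda>x. vector_derivative f (at x))"

definition smooth_fun :: "(real \<Rightarrow> complex) \<Rightarrow> bool" where
  "smooth_fun f \<longleftrightarrow> (\<forall>m x. ((vderiv ^^ m) f) differentiable (at x))"

definition smooth_sf :: "sfun \<Rightarrow> bool" where
  "smooth_sf F \<longleftrightarrow> smooth_fun (fst F) \<and> smooth_fun (snd F)"

definition szero :: sfun where "szero = (\<lambda>_. 0, \<lambda>_. 0)"
definition sone :: sfun where "sone = (\<lambda>_. 1, \<lambda>_. 0)"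

definition sadd :: "sfun \<Rightarrow> sfun \<Rightarrow> sfun" where
  "sadd F G = (\<lambda>x. fst F x + fst G x, \<lambda>x. snd F x + snd G x)"

definition sscale :: "complex \<Rightarrow> sfun \<Rightarrow> sfun" where
  "sscale c F = (\<lambda>x. c * fst F x, \<lambda>x. c * snd F x)"

text \<open>(f0 + theta f1)(g0 + theta g1) = f0 g0 + theta (f0 g1 + f1 g0), since theta^2 = 0.\<close>
definition smul :: "sfun \<Rightarrow> sfun \<Rightarrow> sfun" where
  "smul F G = (\<lambda>x. fst F x * fst G x, \<lambda>x. fst F x * snd G x + snd F x * fst G x)"

definition ssum :: "('i \<Rightarrow> sfun) \<Rightarrow> 'i set \<Rightarrow> sfun" where
  "ssum f A = (\<lambda>x. \<Sum>a\<in>A. fst (f a) x, \<lambda>x. \<Sum>a\<in>A. snd (f a) x)"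

definition sprod_list :: "sfun list \<Rightarrow> sfun" where
  "sprod_list Fs = foldr smul Fs sone"

definition sdx :: "sfun \<Rightarrow> sfun" where
  "sdx F = (vderiv (fst F), vderiv (snd F))"

text \<open>D = d/dtheta + theta d/dx,  Dbar = d/dtheta - theta d/dx\<close>
definition sD :: "sfun \<Rightarrow> sfun" where
  "sD F = (snd F, vderiv (fst F))"

definition sDbar :: "sfun \<Rightarrow> sfun" where
  "sDbar F = (snd F, \<lambda>x. - vderiv (fst F) x)"

definition homog :: "sfun \<Rightarrow> bool" where
  "homog F \<longleftrightarrow> snd F = (\<lambda>_. 0) \<or> fst F = (\<lambda>_. 0)"

definition spar :: "sfun \<Rightarrow> nat" where
  "spar F = (if snd F = (\<lambda>_. 0) then 0 else 1)"

text \<open>X_F(G) = -F Dbar^2 G + 1/2 D(F) Dbar G\<close>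
definition Xact :: "sfun \<Rightarrow> sfun \<Rightarrow> sfun" where
  "Xact F G = sadd (smul F (sdx G)) (sscale (1/2) (smul (sD F) (sDbar G)))"

definition Lden :: "complex \<Rightarrow> sfun \<Rightarrow> sfun \<Rightarrow> sfun" where
  "Lden l F G = sadd (Xact F G) (sscale l (smul (sdx F) G))"

definition osp_gens :: "sfun set" where
  "osp_gens = {(\<lambda>_. 1, \<lambda>_. 0), (\<lambda>x. complex_of_real x, \<lambda>_. 0),
               (\<lambda>x. (complex_of_real x)^2, \<lambda>_. 0),
               (\<lambda>_. 0, \<lambda>_. 1), (\<lambda>_. 0, \<lambda>x. complex_of_real x)}"

text \<open>Multi-indices are lists of length n (positions 0..n-1); K = 2k.\<close>
definition mi :: "nat \<Rightarrow> nat \<Rightarrow> nat list set" where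
  "mi n K = {i. length i = n \<and> sum_list i \<le> K}"

definition lvl :: "nat \<Rightarrow> nat \<Rightarrow> nat list set" where
  "lvl n p = {i. length i = n \<and> sum_list i = p}"

text \<open>Coefficient families of operators in D^k (equally: elements of S^k_delta).\<close>
definition Dk :: "nat \<Rightarrow> nat \<Rightarrow> (nat list \<Rightarrow> sfun) set" where
  "Dk n K = {a. (\<forall>i. smooth_sf (a i)) \<and> (\<forall>i. i \<notin> mi n K \<longrightarrow> a i = szero)}"

definition Sk :: "nat \<Rightarrow> nat \<Rightarrow> (nat list \<Rightarrow> sfun) set" where
  "Sk n K = {b. (\<forall>i. smooth_sf (b i)) \<and> (\<forall>i. i \<notin> mi n K \<longrightarrow> b i = szero)}"

definition fadd :: "(nat list \<Rightarrow> sfun) \<Rightarrow> (nat list \<Rightarrow> sfun) \<Rightarrow> nat list \<Rightarrow> sfun" where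
  "fadd a b = (\<lambda>i. sadd (a i) (b i))"

definition fscale :: "complex \<Rightarrow> (nat list \<Rightarrow> sfun) \<Rightarrow> nat list \<Rightarrow> sfun" where
  "fscale c a = (\<lambda>i. sscale c (a i))"

text \<open>Application of A = sum a_i Dbar^{i_1} (x) ... (x) Dbar^{i_n} to f_1 (x) ... (x) f_n
  (homogeneous f_p), with the sign (-1)^(sum_p |f_p| (i_{p+1}+...+i_n)).\<close>
definition opmap :: "nat \<Rightarrow> nat \<Rightarrow> (nat list \<Rightarrow> sfun) \<Rightarrow> sfun list \<Rightarrow> sfun" where
  "opmap n K a fs = ssum (\<lambda>i. sscale ((-1) ^ (\<Sum>p<n. spar (fs ! p) * (\<Sum>q\<in>{p<..<n}. i ! q)))
        (smul (a i) (sprod_list (map2 (\<lambda>k f. (sDbar ^^ k) f) i fs)))) (mi n K)"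

text \<open>Even (q = 0) / odd (q = 1) part of an operator: the term a_i Dbar^i has parity
  |a_i| + |i|.\<close>
definition opart :: "nat \<Rightarrow> (nat list \<Rightarrow> sfun) \<Rightarrow> nat list \<Rightarrow> sfun" where
  "opart q a = (\<lambda>i. if sum_list i mod 2 = q then (fst (a i), \<lambda>_. 0) else (\<lambda>_. 0, snd (a i)))"

text \<open>A o L^lambda_{X_F} on a homogeneous tensor f_1 (x) ... (x) f_n (F homogeneous).\<close>
definition op_after_act :: "complex list \<Rightarrow> nat \<Rightarrow> sfun \<Rightarrow> (nat list \<Rightarrow> sfun) \<Rightarrow> sfun list \<Rightarrow> sfun" where
  "op_after_act lam K F a fs = ssum (\<lambda>p. sscale ((-1) ^ (spar F * (\<Sum>r<p. spar (fs ! r))))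
        (opmap (length lam) K a (fs[p := Lden (lam ! p) F (fs ! p)]))) {..<length lam}"

text \<open>L^{lambda,mu}_{X_F}(A) = L^mu_{X_F} o A - (-1)^{|A||F|} A o L^lambda_{X_F},
  extended to non-homogeneous A by linearity.\<close>
definition Lop :: "complex list \<Rightarrow> complex \<Rightarrow> nat \<Rightarrow> sfun \<Rightarrow> (nat list \<Rightarrow> sfun) \<Rightarrow> sfun list \<Rightarrow> sfun" where
  "Lop lam mu K F a fs = sadd (Lden mu F (opmap (length lam) K a fs))
      (sscale (-1) (ssum (\<lambda>q. sscale ((-1) ^ (q * spar F)) (op_after_act lam K F (opart q a) fs)) {0, 1}))"

text \<open>Action on symbols: component i lies in F_{delta - |i|/2}.\<close>
definition LS :: "complex \<Rightarrow> sfun \<Rightarrow> (nat list \<Rightarrow> sfun) \<Rightarrow> nat list \<Rightarrow> sfun" where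
  "LS \<delta> F b = (\<lambda>i. Lden (\<delta> - of_nat (sum_list i) / 2) F (b i))"

definition op_represents :: "nat \<Rightarrow> nat \<Rightarrow> (nat list \<Rightarrow> sfun) \<Rightarrow> (sfun list \<Rightarrow> sfun) \<Rightarrow> bool" where
  "op_represents n K b T \<longleftrightarrow>
     (\<forall>fs. length fs = n \<and> (\<forall>f\<in>set fs. smooth_sf f \<and> homog f) \<longrightarrow> opmap n K b fs = T fs)"

definition osp_equivariant :: "complex list \<Rightarrow> complex \<Rightarrow> nat \<Rightarrow>
    ((nat list \<Rightarrow> sfun) \<Rightarrow> (nat list \<Rightarrow> sfun)) \<Rightarrow> bool" where
  "osp_equivariant lam mu K \<sigma> \<longleftrightarrow>
     (\<forall>F\<in>osp_gens. \<forall>a\<in>Dk (length lam) K.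
        (\<exists>b\<in>Dk (length lam) K. op_represents (length lam) K b (Lop lam mu K F a)) \<and>
        (\<forall>b\<in>Dk (length lam) K. op_represents (length lam) K b (Lop lam mu K F a) \<longrightarrow>
            \<sigma> b = LS (mu - sum_list lam) F (\<sigma> a)))"

text \<open>Symbol map with principal symbol P (the constants P s i for |s| = |i| = p,
  one square block per order p \<le> 2k): a linear bijection D^k -> S^k whose highest-order
  term on every operator of order p/2 is given by the block P at level p.\<close>
definition is_symbol_map :: "nat \<Rightarrow> nat \<Rightarrow> (nat list \<Rightarrow> nat list \<Rightarrow> complex) \<Rightarrow>
    ((nat list \<Rightarrow> sfun) \<Rightarrow> (nat list \<Rightarrow> sfun)) \<Rightarrow> bool" where
  "is_symbol_map n K P \<sigma> \<longleftrightarrow>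
     (\<forall>a\<in>Dk n K. \<forall>b\<in>Dk n K. \<sigma> (fadd a b) = fadd (\<sigma> a) (\<sigma> b)) \<and>
     (\<forall>c. \<forall>a\<in>Dk n K. \<sigma> (fscale c a) = fscale c (\<sigma> a)) \<and>
     bij_betw \<sigma> (Dk n K) (Sk n K) \<and>
     (\<forall>p\<le>K. \<forall>a\<in>Dk n K. (\<forall>s. p < sum_list s \<longrightarrow> a s = szero) \<longrightarrow>
        (\<forall>i\<in>mi n K. p < sum_list i \<longrightarrow> \<sigma> a i = szero) \<and>
        (\<forall>i\<in>lvl n p. \<sigma> a i = ssum (\<lambda>s. sscale (P s i) (a s)) (lvl n p)))"

definition diag_nonsingular :: "nat \<Rightarrow> nat \<Rightarrow> (nat list \<Rightarrow> nat list \<Rightarrow> complex) \<Rightarrow> bool" where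
  "diag_nonsingular n K w \<longleftrightarrow> (\<forall>p\<le>K. \<exists>v :: nat list \<Rightarrow> nat list \<Rightarrow> complex.
      (\<forall>i\<in>lvl n p. \<forall>i'\<in>lvl n p. (\<Sum>s\<in>lvl n p. w s i * v s i') = (if i = i' then 1 else 0)) \<and>
      (\<forall>s\<in>lvl n p. \<forall>s'\<in>lvl n p. (\<Sum>i\<in>lvl n p. v s i * w s' i) = (if s = s' then 1 else 0)))"

definition sigma_w :: "nat \<Rightarrow> nat \<Rightarrow> (nat list \<Rightarrow> nat list \<Rightarrow> complex) \<Rightarrow>
    (nat list \<Rightarrow> sfun) \<Rightarrow> nat list \<Rightarrow> sfun" where
  "sigma_w n K w a = (\<lambda>i. if i \<in> mi n K then
      ssum (\<lambda>s. sscale (w s i) ((sD ^^ (sum_list s - sum_list i)) (a s)))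
           {s \<in> mi n K. sum_list i \<le> sum_list s}
     else szero)"

text \<open>The induction formula, for multi-indices with p = |i| < l = |s| \<le> 2k
  (for l \<le> p it only involves constants that never enter sigma^varpi).\<close>
definition induction_formula :: "complex list \<Rightarrow> complex \<Rightarrow> nat \<Rightarrow>
    (nat list \<Rightarrow> nat list \<Rightarrow> complex) \<Rightarrow> bool" where
  "induction_formula lam \<delta> K w \<longleftrightarrow>
    (\<forall>i\<in>mi (length lam) K. \<forall>s\<in>mi (length lam) K. sum_list i < sum_list s \<longrightarrow>
      (let l = sum_list s; p = sum_list i; d = l - p in
        (-1) ^ d * (of_nat (d div 2) + (1 - (-1) ^ d) * (\<delta> - of_nat l / 2)) * w s i
        - (\<Sum>j<length lam. (-1) ^ (\<Sum>r<j. s ! r) *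
             (of_nat ((s ! j) div 2) + (1 - (-1) ^ (s ! j)) * lam ! j) *
             (if s ! j = 0 then 0 else w (s[j := s ! j - 1]) i)) = 0))"

definition Xi :: "nat \<Rightarrow> nat \<Rightarrow> complex \<Rightarrow> complex" where
  "Xi s i l = of_nat ((s div 2) choose (i div 2)) *
     ((2 * l + of_int ((int s - 1) div 2)) gchoose nat ((2 * (int s - int i) + 1 + (-1) ^ i) div 4))"

definition sbinom :: "nat \<Rightarrow> nat \<Rightarrow> nat" where
  "sbinom j i = (if even i \<or> odd j then (j div 2) choose (i div 2) else 0)"

text \<open>gamma^s_i (0-based positions; t ranges over the positions 2..n of the paper).\<close>
definition gamma_c :: "complex list \<Rightarrow> complex \<Rightarrow> nat list \<Rightarrow> nat list \<Rightarrow> complex" where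
  "gamma_c lam \<delta> s i =
    (let n = length lam; l = sum_list s; p = sum_list i; q = (l - p + 1) div 2;
         phi = (\<lambda>t. \<Sum>j\<le>t. s ! j - i ! j);
         psi = (\<lambda>t. (\<Sum>j<t. s ! j) * (s ! t - i ! t)) in
     if length s = n \<and> length i = n \<and> (\<forall>t<n. i ! t \<le> s ! t) then
       (-1) ^ q * Xi (s ! 0) (i ! 0) (lam ! 0) / ((2 * \<delta> - of_nat p - 1) gchoose q) *
       (\<Prod>t\<in>{1..<n}. (-1) ^ psi t * of_nat (sbinom (phi t) (s ! t - i ! t)) * Xi (s ! t) (i ! t) (lam ! t)
            / (of_nat ((phi t div 2) choose ((s ! t - i ! t) div 2)) *
               of_nat (((phi t + 1) div 2) choose ((s ! t - i ! t + 1) div 2))))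
     else 0)"

end

theory Submission
  imports Defs
begin

text \<open>
  Smooth superfunctions form a commutative ring, because \<theta> squares to zero, and D and Dbar
  are twisted derivations of it.  The odd generators \<theta> and x\<theta> generate osp(1|2): the even
  generators are their anticommutators, so all equivariance statements reduce to these two.

  Commuting Dbar past the Lie derivative along \<theta> or x\<theta> shows that the Lie derivative of an
  operator acts on its coefficients as the density action plus a term that lowers one index by
  one.  Test functions \<theta>^e x^r show that the coefficients are determined by the operator.
  Commuting powers of D past the density action turns equivariance of the symbol map into the
  induction formula.  At non-resonant \<delta> the formula can be solved order by order, and the
  explicit solution is a product of one-variable solutions with a q-multinomial coefficient at
  q = -1, since the shifts in the different indices anticommute.

  Uniqueness: by induction on the order, the difference of two equivariant symbol maps with the
  same principal symbol gives linear (not necessarily local) maps T intertwining density modules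
  of weights a and a + m/2 with m > 0.  The Euler field and non-resonance force T to vanish on
  polynomials.  For each point, every function is a polynomial plus the image of the field
  vanishing there to second order (solve a singular first-order equation after splitting off a
  Taylor polynomial), and images of that field vanish at the point, hence T = 0.
\<close>

subsection \<open>Smooth functions\<close>

text \<open>All signs are carried by the parity involution \<open>eps\<close> instead of by parities
  of arguments. The identities then hold in a commutative ring for arbitrary elements, and
  homogeneous arguments occur only where the definitions are translated. A single function
  \<open>kap\<close> accounts for the coefficients. It arises when Dbar^s passes the density action
  on an argument and again when D^d passes the action on a symbol; balancing the two contributions
  is the induction formula. Its solution with identity top blocks is a sum over lattice paths from i
  to s of products of \<open>kap s_j \<lambda>_j\<close>, divided by the product of the factors
  containing \<delta>. The products do not depend on the path, only the sign does, which leaves a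
  signed count of paths. The obstacle to uniqueness is that a symbol map is only linear, so its
  values on polynomials say nothing by themselves about other smooth functions. The way out is to
  evaluate at one point at a time: the unknown image of the remainder enters only through terms with
  a factor vanishing at that point, whatever the image is.\<close>

lemma smooth_fun_unfold:
  "smooth_fun f \<longleftrightarrow> (\<forall>x. f differentiable (at x)) \<and> smooth_fun (vderiv f)"
proof -
  have "smooth_fun f \<longleftrightarrow> (\<forall>m x. ((vderiv ^^ m) f) differentiable (at x))"
    by (simp add: smooth_fun_def)
  also have "\<dots> \<longleftrightarrow> (\<forall>x. f differentiable (at x)) \<and> (\<forall>m x. ((vderiv ^^ m) (vderiv f)) differentiable (at x))"
    by (metis (no_types, lifting) funpow_0 funpow_Suc_right not0_implies_Suc o_apply)
  finally show ?thesis by (simp add: smooth_fun_def)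
qed

text \<open>Closure under products needs an induction on the order of differentiability, since the
  derivative of a product is a sum of products of the same shape. Level 0 already asks for one
  derivative.\<close>

fun kdiff :: "nat \<Rightarrow> (real \<Rightarrow> complex) \<Rightarrow> bool" where
  "kdiff 0 f \<longleftrightarrow> (\<forall>x. f differentiable (at x))"
| "kdiff (Suc m) f \<longleftrightarrow> (\<forall>x. f differentiable (at x)) \<and> kdiff m (vderiv f)"

lemma kdiff_Suc: "kdiff (Suc m) f \<Longrightarrow> kdiff m f"
  by (induction m arbitrary: f) auto

lemma smooth_fun_iff_kdiff: "smooth_fun f \<longleftrightarrow> (\<forall>m. kdiff m f)"
proof
  assume "smooth_fun f"
  moreover have "smooth_fun f \<Longrightarrow> kdiff m f" for m f
    by (induction m arbitrary: f) (simp_all add: smooth_fun_unfold[of f] | metis smooth_fun_unfold)+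
  ultimately show "\<forall>m. kdiff m f" by blast
next
  assume *: "\<forall>m. kdiff m f"
  have "kdiff m f \<Longrightarrow> ((vderiv ^^ m) f) differentiable (at x)" for m f x
    by (induction m arbitrary: f) (simp_all add: funpow_Suc_right del: funpow.simps(2))
  then show "smooth_fun f" using * by (simp add: smooth_fun_def)
qed

text \<open>A coinduction principle, suited to families such as weighted averages whose derivatives
  belong to the same family.\<close>

lemma smooth_funI:
  assumes "P f" "\<And>f x. P f \<Longrightarrow> f differentiable (at x)" "\<And>f. P f \<Longrightarrow> P (vderiv f)"
  shows "smooth_fun f"
proof -
  have "P f \<Longrightarrow> kdiff m f" for m f
    by (induction m arbitrary: f) (use assms in auto)
  then show ?thesis using assms(1) by (simp add: smooth_fun_iff_kdiff)
qed

lemma has_vderiv: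
  "f differentiable (at x) \<Longrightarrow> (f has_vector_derivative vderiv f x) (at x)"
  by (simp add: vderiv_def vector_derivative_works)

lemma vderivI:
  "(\<And>x. (f has_vector_derivative f' x) (at x)) \<Longrightarrow> vderiv f = f'"
  by (auto simp: vderiv_def vector_derivative_at)

lemma differentiableI_vd:
  "(f has_vector_derivative f') (at x) \<Longrightarrow> f differentiable (at x)"
  by (rule differentiableI_vector)

lemma smooth_fun_diff: "smooth_fun f \<Longrightarrow> f differentiable (at x)"
  by (metis smooth_fun_unfold)

lemma smooth_has_vderiv:
  "smooth_fun f \<Longrightarrow> (f has_vector_derivative vderiv f x) (at x)"
  by (simp add: has_vderiv smooth_fun_diff)

lemma smooth_vderiv: "smooth_fun f \<Longrightarrow> smooth_fun (vderiv f)"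
  by (metis smooth_fun_unfold)

lemma smooth_continuous: "smooth_fun f \<Longrightarrow> continuous_on A f"
  by (meson continuous_at_imp_continuous_on differentiable_imp_continuous_within smooth_fun_diff)

lemma vderiv_const: "vderiv (\<lambda>_. c) = (\<lambda>_. 0)"
  by (rule vderivI) (auto intro: derivative_eq_intros)

lemma smooth_const: "smooth_fun (\<lambda>_. c)"
  by (rule smooth_funI[where P = "\<lambda>f. \<exists>c. f = (\<lambda>_. c)"]) (auto simp: vderiv_const)

lemma vderiv_add_kd:
  assumes "\<And>x. f differentiable (at x)" "\<And>x. g differentiable (at x)"
  shows "vderiv (\<lambda>x. f x + g x) = (\<lambda>x. vderiv f x + vderiv g x)"
  by (rule vderivI) (intro has_vector_derivative_add has_vderiv assms)

lemma vderiv_mult_kd: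
  assumes "\<And>x. f differentiable (at x)" "\<And>x. g differentiable (at x)"
  shows "vderiv (\<lambda>x. f x * g x) = (\<lambda>x. f x * vderiv g x + vderiv f x * g x)"
  by (rule vderivI) (intro has_vector_derivative_mult has_vderiv assms)

lemma kdiff_add: "kdiff m f \<Longrightarrow> kdiff m g \<Longrightarrow> kdiff m (\<lambda>x. f x + g x)"
  by (induction m arbitrary: f g) (auto simp: vderiv_add_kd)

lemma kdiff_mult: "kdiff m f \<Longrightarrow> kdiff m g \<Longrightarrow> kdiff m (\<lambda>x. f x * g x)"
proof (induction m arbitrary: f g)
  case (Suc m)
  then show ?case
    by (auto simp: vderiv_mult_kd intro!: kdiff_add Suc.IH intro: kdiff_Suc)
qed auto

lemma smooth_add: "smooth_fun f \<Longrightarrow> smooth_fun g \<Longrightarrow> smooth_fun (\<lambda>x. f x + g x)"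
  by (simp add: smooth_fun_iff_kdiff kdiff_add)

lemma smooth_mult: "smooth_fun f \<Longrightarrow> smooth_fun g \<Longrightarrow> smooth_fun (\<lambda>x. f x * g x)"
  by (simp add: smooth_fun_iff_kdiff kdiff_mult)

lemma smooth_cmult: "smooth_fun f \<Longrightarrow> smooth_fun (\<lambda>x. c * f x)"
  by (intro smooth_mult smooth_const)

lemma smooth_uminus: "smooth_fun f \<Longrightarrow> smooth_fun (\<lambda>x. - f x)"
  using smooth_cmult[of f "-1"] by simp

lemma smooth_diff: "smooth_fun f \<Longrightarrow> smooth_fun g \<Longrightarrow> smooth_fun (\<lambda>x. f x - g x)"
  using smooth_add[of f "\<lambda>x. - g x"] smooth_uminus by simp

lemma vderiv_add:
  "smooth_fun f \<Longrightarrow> smooth_fun g \<Longrightarrow> vderiv (\<lambda>x. f x + g x) = (\<lambda>x. vderiv f x + vderiv g x)"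
  by (simp add: vderiv_add_kd smooth_fun_diff)

lemma vderiv_mult:
  "smooth_fun f \<Longrightarrow> smooth_fun g \<Longrightarrow>
    vderiv (\<lambda>x. f x * g x) = (\<lambda>x. f x * vderiv g x + vderiv f x * g x)"
  by (simp add: vderiv_mult_kd smooth_fun_diff)

lemma vderiv_cmult: "smooth_fun f \<Longrightarrow> vderiv (\<lambda>x. c * f x) = (\<lambda>x. c * vderiv f x)"
  using vderiv_mult[of "\<lambda>_. c" f] by (simp add: smooth_const vderiv_const)

lemma vderiv_uminus: "smooth_fun f \<Longrightarrow> vderiv (\<lambda>x. - f x) = (\<lambda>x. - vderiv f x)"
  using vderiv_cmult[of f "-1"] by simp

lemma has_vderiv_of_real: "(complex_of_real has_vector_derivative 1) (at x)"
  using has_vector_derivative_of_real[OF DERIV_ident] by simp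

lemma vderiv_of_real: "vderiv complex_of_real = (\<lambda>_. 1)"
  by (rule vderivI) (rule has_vderiv_of_real)

lemma smooth_of_real: "smooth_fun complex_of_real"
  by (subst smooth_fun_unfold)
    (auto simp: vderiv_of_real smooth_const intro: differentiableI_vd[OF has_vderiv_of_real])

lemma smooth_power: "smooth_fun f \<Longrightarrow> smooth_fun (\<lambda>x. f x ^ n)"
  by (induction n) (auto intro: smooth_const smooth_mult)

subsection \<open>The ring of smooth superfunctions\<close>

typedef sring = "{F. smooth_sf F}"
  by (rule exI[of _ szero]) (simp add: smooth_sf_def szero_def smooth_const)

setup_lifting type_definition_sring

instantiation sring :: comm_ring_1
begin
lift_definition zero_sring :: sring is szero
  by (simp add: smooth_sf_def szero_def smooth_const)
lift_definition one_sring :: sring is sone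
  by (simp add: smooth_sf_def sone_def smooth_const)
lift_definition plus_sring :: "sring \<Rightarrow> sring \<Rightarrow> sring" is sadd
  by (simp add: smooth_sf_def sadd_def smooth_add)
lift_definition uminus_sring :: "sring \<Rightarrow> sring" is "\<lambda>F. (\<lambda>x. - fst F x, \<lambda>x. - snd F x)"
  by (simp add: smooth_sf_def smooth_uminus)
lift_definition minus_sring :: "sring \<Rightarrow> sring \<Rightarrow> sring"
  is "\<lambda>F G. (\<lambda>x. fst F x - fst G x, \<lambda>x. snd F x - snd G x)"
  by (simp add: smooth_sf_def smooth_diff)
lift_definition times_sring :: "sring \<Rightarrow> sring \<Rightarrow> sring" is smul
  by (simp add: smooth_sf_def smul_def smooth_add smooth_mult)
instance
proof
  show "(0::sring) \<noteq> 1"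
    by transfer (auto simp: szero_def sone_def fun_eq_iff)
qed (transfer, auto simp: sadd_def smul_def szero_def sone_def fun_eq_iff algebra_simps)+
end

lift_definition cst :: "complex \<Rightarrow> sring" is "\<lambda>c. (\<lambda>_. c, \<lambda>_. 0)"
  by (simp add: smooth_sf_def smooth_const)
lift_definition th :: sring is "(\<lambda>_. 0, \<lambda>_. 1)"
  by (simp add: smooth_sf_def smooth_const)
lift_definition xx :: sring is "(complex_of_real, \<lambda>_. 0)"
  by (simp add: smooth_sf_def smooth_const smooth_of_real)
text \<open>The parity involution. It supplies the sign (-1)^|F| of the graded Leibniz rules
  linearly in F, so that no splitting into homogeneous parts is needed.\<close>

lift_definition eps :: "sring \<Rightarrow> sring" is "\<lambda>F. (fst F, \<lambda>x. - snd F x)"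
  by (simp add: smooth_sf_def smooth_uminus)
lift_definition db :: "sring \<Rightarrow> sring" is sDbar
  by (simp add: smooth_sf_def sDbar_def smooth_uminus smooth_vderiv)
lift_definition dd :: "sring \<Rightarrow> sring" is sD
  by (simp add: smooth_sf_def sD_def smooth_vderiv)
lift_definition body :: "sring \<Rightarrow> real \<Rightarrow> complex" is fst .
lift_definition soul :: "sring \<Rightarrow> real \<Rightarrow> complex" is snd .

lemma sring_eqI: "(\<And>x. body F x = body G x) \<Longrightarrow> (\<And>x. soul F x = soul G x) \<Longrightarrow> F = G"
  by transfer (auto simp: prod_eq_iff)

lemma smooth_body: "smooth_fun (body F)" and smooth_soul: "smooth_fun (soul F)"
  by (transfer, simp add: smooth_sf_def)+

lemma body_simps [simp]:
  "body 0 = (\<lambda>x. 0)" "body 1 = (\<lambda>x. 1)" "body (F + G) = (\<lambda>x. body F x + body G x)"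
  "body (- F) = (\<lambda>x. - body F x)" "body (F - G) = (\<lambda>x. body F x - body G x)"
  "body (F * G) = (\<lambda>x. body F x * body G x)" "body (cst c) = (\<lambda>x. c)"
  "body th = (\<lambda>x. 0)" "body xx = complex_of_real" "body (eps F) = body F"
  "body (db F) = soul F" "body (dd F) = soul F"
  by (transfer, simp add: szero_def sone_def sadd_def smul_def sDbar_def sD_def)+

lemma soul_simps [simp]:
  "soul 0 = (\<lambda>x. 0)" "soul 1 = (\<lambda>x. 0)" "soul (F + G) = (\<lambda>x. soul F x + soul G x)"
  "soul (- F) = (\<lambda>x. - soul F x)" "soul (F - G) = (\<lambda>x. soul F x - soul G x)"
  "soul (F * G) = (\<lambda>x. body F x * soul G x + soul F x * body G x)" "soul (cst c) = (\<lambda>x. 0)"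
  "soul th = (\<lambda>x. 1)" "soul xx = (\<lambda>x. 0)" "soul (eps F) = (\<lambda>x. - soul F x)"
  "soul (db F) = (\<lambda>x. - vderiv (body F) x)" "soul (dd F) = vderiv (body F)"
  by (transfer, simp add: szero_def sone_def sadd_def smul_def sDbar_def sD_def)+

lemma cst_simps [simp]: "cst 0 = 0" "cst 1 = 1"
  by (auto intro: sring_eqI)

lemma cst_add: "cst (a + b) = cst a + cst b"
  and cst_mult: "cst (a * b) = cst a * cst b"
  and cst_minus: "cst (- a) = - cst a"
  and cst_diff: "cst (a - b) = cst a - cst b"
  by (auto intro: sring_eqI)

lemma cst_of_nat: "cst (of_nat k) = of_nat k"
  by (induction k) (simp_all add: cst_add)

lemma cst_numeral: "cst (numeral k) = numeral k"
  using cst_of_nat[of "numeral k"] by simp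

lemma cst_power: "cst (a ^ k) = cst a ^ k"
  by (induction k) (simp_all add: cst_mult)

lemma cst_sum: "cst (sum f A) = (\<Sum>i\<in>A. cst (f i))"
  by (induction A rule: infinite_finite_induct) (simp_all add: cst_add)

lemma cst_eq_0_iff [simp]: "cst a = 0 \<longleftrightarrow> a = 0"
  by (metis body_simps(1,7) cst_simps(1))

lemma cst_mult_cancel: "a \<noteq> 0 \<Longrightarrow> cst a * F = cst a * G \<Longrightarrow> F = G"
  by (metis cst_mult cst_simps(2) left_inverse mult.assoc mult_1)

lemma eps_simps [simp]:
  "eps 0 = 0" "eps 1 = 1" "eps (F + G) = eps F + eps G" "eps (- F) = - eps F"
  "eps (F - G) = eps F - eps G" "eps (F * G) = eps F * eps G" "eps (cst c) = cst c"
  "eps th = - th" "eps xx = xx" "eps (eps F) = F"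
  by (auto intro: sring_eqI)

lemma db_simps [simp]:
  "db 0 = 0" "db 1 = 0" "db (F + G) = db F + db G" "db (- F) = - db F"
  "db (F - G) = db F - db G" "db (cst c) = 0" "db th = 1" "db xx = - th"
  by (auto intro!: sring_eqI simp: smooth_body vderiv_add vderiv_const vderiv_uminus vderiv_of_real
     vderiv_add[of _ "\<lambda>x. - body G x", simplified] smooth_uminus)

lemma dd_simps [simp]:
  "dd 0 = 0" "dd 1 = 0" "dd (F + G) = dd F + dd G" "dd (- F) = - dd F"
  "dd (F - G) = dd F - dd G" "dd (cst c) = 0" "dd th = 1" "dd xx = th"
  by (auto intro!: sring_eqI simp: smooth_body vderiv_add vderiv_const vderiv_uminus vderiv_of_real
     vderiv_add[of _ "\<lambda>x. - body G x", simplified] smooth_uminus)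

lemma db_mult: "db (F * G) = db F * G + eps F * db G"
  by (rule sring_eqI) (simp_all add: vderiv_mult smooth_body algebra_simps)

lemma dd_mult: "dd (F * G) = dd F * G + eps F * dd G"
  by (rule sring_eqI) (simp_all add: vderiv_mult smooth_body algebra_simps)

lemma db_cmult [simp]: "db (cst c * F) = cst c * db F"
  and dd_cmult [simp]: "dd (cst c * F) = cst c * dd F"
  by (simp_all add: db_mult dd_mult)

lemma db_eps: "db (eps F) = - eps (db F)" and dd_eps: "dd (eps F) = - eps (dd F)"
  by (auto intro!: sring_eqI simp: smooth_soul vderiv_uminus)

lemma dd_eq: "dd F = eps (db F)"
  by (auto intro!: sring_eqI)

lemma th_th [simp]: "th * th = 0" and th_th' [simp]: "th * (th * F) = 0"
  by (auto intro!: sring_eqI)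

lemma th_nonzero: "th \<noteq> 0" "xx * th \<noteq> 0"
proof -
  have "soul th 1 \<noteq> soul 0 1" "soul (xx * th) 1 \<noteq> soul 0 1" by simp_all
  then show "th \<noteq> 0" "xx * th \<noteq> 0" by metis+
qed

lemma th_eps [simp]: "th * eps F = th * F"
  by (auto intro!: sring_eqI)

lemma eps_sum: "eps (sum f A) = (\<Sum>i\<in>A. eps (f i))"
  by (induction A rule: infinite_finite_induct) simp_all

lemma eps_prod: "eps (prod f A) = (\<Prod>i\<in>A. eps (f i))"
  by (induction A rule: infinite_finite_induct) simp_all

subsection \<open>The odd generators\<close>

text \<open>The density action along X_F for F = (h x + c) \<theta>, so F = \<theta> is (h, c) = (0, 1) and
  F = x \<theta> is (1, 0).\<close>

definition Lo :: "complex \<Rightarrow> complex \<Rightarrow> complex \<Rightarrow> sring \<Rightarrow> sring" where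
  "Lo h c \<nu> F = cst (1/2) * (cst h * xx + cst c) * dd F + cst (h * \<nu>) * th * F"

lemma Lo_add [simp]: "Lo h c \<nu> (F + G) = Lo h c \<nu> F + Lo h c \<nu> G"
  and Lo_minus [simp]: "Lo h c \<nu> (- F) = - Lo h c \<nu> F"
  and Lo_diff [simp]: "Lo h c \<nu> (F - G) = Lo h c \<nu> F - Lo h c \<nu> G"
  and Lo_zero [simp]: "Lo h c \<nu> 0 = 0"
  by (simp_all add: Lo_def algebra_simps)

lemma Lo_cmult [simp]: "Lo h c \<nu> (cst k * F) = cst k * Lo h c \<nu> F"
  unfolding Lo_def dd_cmult by (simp add: algebra_simps)

lemma th_eps' [simp]: "th * (eps a * b) = th * (a * b)"
  by (simp flip: mult.assoc)

lemma Lo_sum: "Lo h c \<nu> (sum f A) = (\<Sum>i\<in>A. Lo h c \<nu> (f i))"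
  by (induction A rule: infinite_finite_induct) simp_all

text \<open>Weights add under multiplication, and an odd field passing the first factor costs the
  involution.\<close>

lemma Lo_mult: "Lo h c (\<nu>1 + \<nu>2) (a * b) = Lo h c \<nu>1 a * b + eps a * Lo h c \<nu>2 b"
  by (rule sring_eqI) (simp_all add: Lo_def vderiv_mult smooth_body algebra_simps)

lemma eps_Lo: "eps (Lo h c \<nu> F) = - Lo h c \<nu> (eps F)"
  by (simp add: Lo_def dd_eps algebra_simps)

text \<open>The field anticommutes with Dbar up to a multiple of \<theta> Dbar, which is absorbed by
  raising the weight by 1/2. The remaining term is Dbar applied to the factor h \<nu>
  \<theta>.\<close>

lemma db_Lo: "db (Lo h c \<nu> F) = - Lo h c (\<nu> + 1/2) (db F) + cst (h * \<nu>) * F"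
  unfolding Lo_def mult.assoc db_simps db_cmult
  by (rule sring_eqI)
    (simp_all add: Lo_def vderiv_add vderiv_mult vderiv_const vderiv_of_real smooth_body smooth_soul
      smooth_const smooth_of_real smooth_add smooth_mult algebra_simps)

lemma dd_Lo: "dd (Lo h c \<nu> F) = Lo h c (\<nu> + 1/2) (dd F) + cst (h * \<nu>) * eps F"
  unfolding Lo_def mult.assoc dd_simps dd_cmult
  by (rule sring_eqI)
    (simp_all add: Lo_def vderiv_add vderiv_mult vderiv_const vderiv_of_real smooth_body smooth_soul
      smooth_const smooth_of_real smooth_add smooth_mult algebra_simps)

text \<open>The factor of the induction formula; it also governs the commutators of powers of D and
  of Dbar with the density action.\<close>

definition kap :: "nat \<Rightarrow> complex \<Rightarrow> complex" where
  "kap s l = of_nat (s div 2) + (1 - (-1) ^ s) * l"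

lemma kap_0 [simp]: "kap 0 l = 0"
  by (simp add: kap_def)

text \<open>Moving one more D or Dbar past the action reverses the sign of what was collected
  before, so the sum of two consecutive values is the simple quantity, not their difference.\<close>

lemma kap_rec: "kap (Suc s) l = of_nat s + 2 * l - kap s l"
  by (cases "even s") (auto simp: kap_def field_simps elim!: evenE oddE)

text \<open>Iterating \<open>db_Lo\<close> collects the corrections at the weights \<nu>, \<nu> +
  1/2, ... with alternating signs; by \<open>kap_rec\<close> they add up to \<open>kap\<close>. The
  truncated exponent \<open>i - 1\<close> at i = 0 is harmless because \<open>kap 0\<close>
  vanishes.\<close>

lemma db_pow_Lo:
  "(db ^^ i) (Lo h c \<nu> F) = (-1) ^ i * Lo h c (\<nu> + of_nat i / 2) ((db ^^ i) F)
     - cst ((-1) ^ i * h * kap i \<nu> / 2) * (db ^^ (i - 1)) F"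
proof (induction i)
  case (Suc i)
  have *: "cst ((-1) ^ i * h * kap i \<nu> / 2) * db ((db ^^ (i - Suc 0)) F)
      = cst ((-1) ^ i * h * kap i \<nu> / 2) * (db ^^ i) F"
    by (cases i) simp_all
  have m: "db ((-1) ^ i * G) = (-1) ^ i * db G" for G
    by (cases "even i") auto
  have "(db ^^ Suc i) (Lo h c \<nu> F) = (-1) ^ i * (- Lo h c (\<nu> + of_nat i / 2 + 1/2) ((db ^^ Suc i) F)
      + cst (h * (\<nu> + of_nat i / 2)) * (db ^^ i) F) - cst ((-1) ^ i * h * kap i \<nu> / 2) * (db ^^ i) F"
    by (simp add: Suc m * db_Lo)
  also have "\<dots> = (-1) ^ Suc i * Lo h c (\<nu> + of_nat (Suc i) / 2) ((db ^^ Suc i) F)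
      + cst ((-1) ^ i * (h * (\<nu> + of_nat i / 2)) - (-1) ^ i * h * kap i \<nu> / 2) * (db ^^ i) F"
    unfolding cst_diff cst_mult[of "(-1) ^ i" "h * (\<nu> + of_nat i / 2)"]
    by (simp add: cst_power cst_minus add_divide_distrib right_diff_distrib left_diff_distrib add.assoc
        distrib_left mult.assoc del: cst_mult) (simp add: add.commute)
  also have "(-1) ^ i * (h * (\<nu> + of_nat i / 2)) - (-1) ^ i * h * kap i \<nu> / 2
      = - ((-1) ^ Suc i * h * kap (Suc i) \<nu> / 2)"
    by (simp add: kap_rec field_simps)
  finally show ?case by (simp add: cst_minus)
qed simp

lemma dd_pow_Lo:
  "(dd ^^ d) (Lo h c \<nu> F) = Lo h c (\<nu> + of_nat d / 2) ((dd ^^ d) F)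
     + cst (h * kap d \<nu> / 2) * eps ((dd ^^ (d - 1)) F)"
proof (induction d)
  case (Suc d)
  have *: "cst (h * kap d \<nu> / 2) * dd (eps ((dd ^^ (d - Suc 0)) F))
      = - cst (h * kap d \<nu> / 2) * eps ((dd ^^ d) F)"
    by (cases d) (simp_all add: dd_eps)
  have "(dd ^^ Suc d) (Lo h c \<nu> F) = Lo h c (\<nu> + of_nat d / 2 + 1/2) ((dd ^^ Suc d) F)
      + cst (h * (\<nu> + of_nat d / 2)) * eps ((dd ^^ d) F) - cst (h * kap d \<nu> / 2) * eps ((dd ^^ d) F)"
    by (simp add: Suc * dd_Lo)
  also have "\<dots> = Lo h c (\<nu> + of_nat (Suc d) / 2) ((dd ^^ Suc d) F)
      + cst (h * (\<nu> + of_nat d / 2) - h * kap d \<nu> / 2) * eps ((dd ^^ d) F)"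
    by (simp add: cst_diff algebra_simps add_divide_distrib)
  also have "h * (\<nu> + of_nat d / 2) - h * kap d \<nu> / 2 = h * kap (Suc d) \<nu> / 2"
    by (simp add: kap_rec field_simps)
  finally show ?case by simp
qed simp

lemma Lo_prod:
  fixes G :: "nat \<Rightarrow> sring"
  shows "Lo h c (\<Sum>p<n. \<nu> p) (\<Prod>r<n. G r) =
    (\<Sum>p<n. \<Prod>r<n. if r < p then eps (G r) else if r = p then Lo h c (\<nu> p) (G p) else G r)"
proof (induction n)
  case 0
  then show ?case by (simp add: Lo_def)
next
  case (Suc n)
  let ?t = "\<lambda>p r. if r < p then eps (G r) else if r = p then Lo h c (\<nu> p) (G p) else G r"
  have "(\<Sum>p<Suc n. \<Prod>r<Suc n. ?t p r) = (\<Sum>p<n. (\<Prod>r<n. ?t p r) * G n) + (\<Prod>r<n. eps (G r)) * Lo h c (\<nu> n) (G n)"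
    by simp
  also have "\<dots> = Lo h c (\<Sum>p<Suc n. \<nu> p) (\<Prod>r<Suc n. G r)"
    by (simp add: Lo_mult Suc eps_prod flip: sum_distrib_right)
  finally show ?case by simp
qed

subsection \<open>Multidifferential operators\<close>

lemma finite_mi [simp]: "finite (mi n K)"
proof (rule finite_subset)
  show "mi n K \<subseteq> {xs. set xs \<subseteq> {..K} \<and> length xs = n}"
    using member_le_sum_list by (fastforce simp: mi_def)
  show "finite {xs. set xs \<subseteq> {..K} \<and> length xs = n}"
    by (rule finite_lists_length_eq) simp
qed

lemma eps_funpow: "(eps ^^ m) F = (if even m then F else eps F)"
  by (induction m) auto

lemma db_pow_minus [simp]: "(db ^^ i) (- F) = - (db ^^ i) F"
  by (induction i) auto

lemma db_pow_add [simp]: "(db ^^ i) (F + G) = (db ^^ i) F + (db ^^ i) G"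
  by (induction i) auto

lemma db_pow_zero [simp]: "(db ^^ i) 0 = 0"
  by (induction i) auto

lemma db_pow_eps: "(db ^^ i) (eps F) = (-1) ^ i * eps ((db ^^ i) F)"
  by (induction i) (auto simp: db_eps uminus_power_if)

text \<open>The sign rule for moving the powers of Dbar past the arguments is expressed by the parity
  involution eps, which makes the expression multilinear also in non-homogeneous arguments.\<close>

definition tens :: "nat \<Rightarrow> nat list \<Rightarrow> (nat \<Rightarrow> sring) \<Rightarrow> sring" where
  "tens n i f = (\<Prod>p<n. (db ^^ (i ! p)) ((eps ^^ (\<Sum>q\<in>{p<..<n}. i ! q)) (f p)))"

definition opm :: "nat \<Rightarrow> nat \<Rightarrow> (nat list \<Rightarrow> sring) \<Rightarrow> (nat \<Rightarrow> sring) \<Rightarrow> sring" where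
  "opm n K a f = (\<Sum>i\<in>mi n K. a i * tens n i f)"

text \<open>The term at i has parity |a_i| + |i|, so this is the sign (-1)^|A| made linear in the
  operator A.\<close>

definition tw :: "(nat list \<Rightarrow> sring) \<Rightarrow> nat list \<Rightarrow> sring" where
  "tw a i = (-1) ^ sum_list i * eps (a i)"

text \<open>An odd field reaches argument p after passing the earlier arguments, each of which
  contributes its parity sign.\<close>

definition twf :: "(sring \<Rightarrow> sring) \<Rightarrow> nat \<Rightarrow> (nat \<Rightarrow> sring) \<Rightarrow> nat \<Rightarrow> sring" where
  "twf L p f = (\<lambda>r. if r < p then eps (f r) else if r = p then L (f p) else f r)"

text \<open>The Lie derivative along F = (h x + c) \<theta>, in terms of the coefficients of the operator.\<close>

definition La :: "complex \<Rightarrow> complex \<Rightarrow> complex list \<Rightarrow> complex \<Rightarrow> (nat list \<Rightarrow> sring) \<Rightarrow> nat list \<Rightarrow> sring" where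
  "La h c lam \<delta> a i = Lo h c (\<delta> - of_nat (sum_list i) / 2) (a i) +
     cst (h / 2) * (\<Sum>p<length lam. cst ((-1) ^ (\<Sum>r<p. i ! r) * kap (Suc (i ! p)) (lam ! p)) *
        eps (a (i[p := Suc (i ! p)])))"

lemma lessThan_split3: "p < n \<Longrightarrow> {..<n} = insert p ({..<p} \<union> {p<..<n})" for p n :: nat
  by auto

lemma prod_split3:
  fixes g :: "nat \<Rightarrow> 'a::comm_monoid_mult"
  assumes "p < n"
  shows "(\<Prod>r<n. g r) = (\<Prod>r<p. g r) * g p * (\<Prod>r\<in>{p<..<n}. g r)"
proof -
  have "(\<Prod>r<n. g r) = g p * (\<Prod>r\<in>{..<p} \<union> {p<..<n}. g r)"
    unfolding lessThan_split3[OF assms] by (subst prod.insert) auto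
  then show ?thesis
    by (subst (asm) prod.union_disjoint) (auto simp: ac_simps)
qed

lemma sum_split3:
  fixes g :: "nat \<Rightarrow> 'a::comm_monoid_add"
  assumes "p < n"
  shows "(\<Sum>r<n. g r) = (\<Sum>r<p. g r) + g p + (\<Sum>r\<in>{p<..<n}. g r)"
proof -
  have "(\<Sum>r<n. g r) = g p + (\<Sum>r\<in>{..<p} \<union> {p<..<n}. g r)"
    unfolding lessThan_split3[OF assms] by (subst sum.insert) auto
  then show ?thesis
    by (subst (asm) sum.union_disjoint) (auto simp: ac_simps)
qed

lemma prod_if3:
  fixes u :: "nat \<Rightarrow> 'a::comm_monoid_mult"
  assumes "p < n"
  shows "(\<Prod>r<n. if r < p then u r else if r = p then v else w r) =
    (\<Prod>r<p. u r) * v * (\<Prod>r\<in>{p<..<n}. w r)"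
  using assms by (simp add: prod_split3[OF assms])

lemma sum_list_eq_sum: "length i = n \<Longrightarrow> sum_list i = (\<Sum>r<n. i ! r)"
  by (simp add: sum_list_sum_nth atLeast0LessThan)

text \<open>The product on the right is the p-th term of the Leibniz rule \<open>Lo_prod\<close> for
  \<open>tens n i f\<close>. Summed over p it cancels against the action on the value of the
  operator, so that only the terms with a lowered index survive.\<close>

lemma tens_twf:
  fixes f :: "nat \<Rightarrow> sring"
  assumes p: "p < n" and len: "length i = n"
  defines "T \<equiv> \<lambda>r. (db ^^ (i ! r)) ((eps ^^ (\<Sum>q\<in>{r<..<n}. i ! q)) (f r))"
  shows "(-1) ^ sum_list i * tens n i (twf (Lo h c l) p f) =
    (\<Prod>r<n. if r < p then eps (T r) else if r = p then Lo h c (l + of_nat (i ! p) / 2) (T p) else T r)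
    - cst (h * kap (i ! p) l / 2) * ((-1) ^ (\<Sum>r<p. i ! r) * tens n (i[p := i ! p - 1]) f)"
proof -
  let ?e = "\<lambda>r. \<Sum>q\<in>{r<..<n}. i ! q"
  let ?j = "i[p := i ! p - 1]"
  let ?S = "(\<Sum>r<p. i ! r)"
  define W where "W = (\<Prod>r\<in>{p<..<n}. T r)"
  define U where "U = (\<Prod>r<p. eps (T r))"
  define V where "V = (db ^^ (i ! p - 1)) ((eps ^^ ?e p) (f p))"
  have eps_c: "(eps ^^ m) (eps F) = eps ((eps ^^ m) F)" for m F
    by (simp add: eps_funpow)
  have eps_Lo': "(eps ^^ m) (Lo h c l F) = (-1) ^ m * Lo h c l ((eps ^^ m) F)" for m F
    by (simp add: eps_funpow eps_Lo)
  have db_m: "(db ^^ k) ((-1) ^ m * F) = (-1) ^ m * (db ^^ k) F" for k m F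
    by (cases "even m") auto
  have sg: "cst ((-1) ^ m * (h * k) / 2) = (-1) ^ m * cst (h * k / 2)" for m k
    using cst_mult[of "(-1) ^ m" "h * k / 2"] by (simp add: cst_power cst_minus)
  have sgn: "sum_list i = ?S + i ! p + ?e p"
    using sum_split3[OF p] by (simp add: sum_list_eq_sum[OF len])
  have U': "(\<Prod>r<p. (-1) ^ (i ! r) * eps (T r)) = (-1) ^ ?S * U"
    by (simp add: prod.distrib U_def power_sum)
  have "tens n i (twf (Lo h c l) p f) = (\<Prod>r<n. if r < p then (-1) ^ (i ! r) * eps (T r)
      else if r = p then (-1) ^ ?e p * (db ^^ (i ! p)) (Lo h c l ((eps ^^ ?e p) (f p))) else T r)"
    unfolding tens_def by (rule prod.cong) (auto simp: twf_def T_def eps_c db_pow_eps eps_Lo' db_m)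
  also have "\<dots> = (-1) ^ ?S * U * ((-1) ^ ?e p * (db ^^ (i ! p)) (Lo h c l ((eps ^^ ?e p) (f p)))) * W"
    by (simp add: prod_if3[OF p] U' W_def)
  also have "(db ^^ (i ! p)) (Lo h c l ((eps ^^ ?e p) (f p))) = (-1) ^ (i ! p) *
      (Lo h c (l + of_nat (i ! p) / 2) (T p) - cst (h * kap (i ! p) l / 2) * V)"
    by (simp add: db_pow_Lo T_def V_def sg right_diff_distrib mult.assoc)
  finally have 1: "(-1) ^ sum_list i * tens n i (twf (Lo h c l) p f) =
     ((-1) ^ sum_list i * ((-1) ^ ?S * (-1) ^ ?e p * (-1) ^ (i ! p))) *
     (U * (Lo h c (l + of_nat (i ! p) / 2) (T p) - cst (h * kap (i ! p) l / 2) * V) * W)"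
    by (simp only: ac_simps)
  have 2: "(-1) ^ sum_list i * ((-1) ^ ?S * (-1) ^ ?e p * (-1) ^ (i ! p)) = (1::sring)"
    by (simp add: sgn minus_one_power_iff flip: power_add)
  have 3: "(\<Prod>r<n. if r < p then eps (T r) else if r = p then Lo h c (l + of_nat (i ! p) / 2) (T p) else T r)
     = U * Lo h c (l + of_nat (i ! p) / 2) (T p) * W"
    by (simp add: prod_if3[OF p] U_def W_def)
  have 4: "(-1) ^ ?S * tens n ?j f = U * V * W" if pos: "i ! p > 0"
  proof -
    \<comment> \<open>Lowering the index at p removes one involution from each argument before p;
      this is where the factors \<open>eps (T r)\<close> come from.\<close>
    have ej: "(\<Sum>q\<in>{r<..<n}. i ! q) = Suc (\<Sum>q\<in>{r<..<n}. ?j ! q)" if "r < p" for r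
    proof -
      have "(\<Sum>q\<in>{r<..<n}. i ! q) = i ! p + (\<Sum>q\<in>{r<..<n} - {p}. i ! q)"
        using that p by (subst sum.remove[of _ p]) auto
      moreover have "(\<Sum>q\<in>{r<..<n}. ?j ! q) = ?j ! p + (\<Sum>q\<in>{r<..<n} - {p}. ?j ! q)"
        using that p by (subst sum.remove[of _ p]) auto
      moreover have "(\<Sum>q\<in>{r<..<n} - {p}. ?j ! q) = (\<Sum>q\<in>{r<..<n} - {p}. i ! q)"
        by (rule sum.cong) auto
      ultimately show ?thesis using pos p len by simp
    qed
    have e1: "(db ^^ (?j ! r)) ((eps ^^ (\<Sum>q\<in>{r<..<n}. ?j ! q)) (f r)) = (-1) ^ (i ! r) * eps (T r)" if "r < p" for r
    proof -
      have 1: "(eps ^^ (\<Sum>q\<in>{r<..<n}. ?j ! q)) (f r) = eps ((eps ^^ (\<Sum>q\<in>{r<..<n}. i ! q)) (f r))"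
        unfolding ej[OF that] by simp
      have "?j ! r = i ! r" using that by simp
      then show ?thesis unfolding 1 T_def db_pow_eps by simp
    qed
    have e2: "(\<Sum>q\<in>{r<..<n}. ?j ! q) = (\<Sum>q\<in>{r<..<n}. i ! q)" if "r \<ge> p" for r
      using that by (intro sum.cong) auto
    have "tens n ?j f = (\<Prod>r<n. if r < p then (-1) ^ (i ! r) * eps (T r) else if r = p then V else T r)"
      unfolding tens_def
    proof (rule prod.cong[OF refl], goal_cases)
      case (1 r)
      consider "r < p" | "r = p" | "r > p" by linarith
      then show ?case
      proof cases
        case 1
        then show ?thesis unfolding e1[OF 1] by simp
      next
        case 2
        then show ?thesis using p len unfolding e2[OF eq_refl[OF 2[symmetric]]] by (simp add: V_def)
      next
        case 3
        then show ?thesis using e2[of r] unfolding e2[OF less_imp_le[OF 3]] by (simp add: T_def)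
      qed
    qed
    also have "\<dots> = (-1) ^ ?S * U * V * W"
      by (simp add: prod_if3[OF p] U' W_def)
    finally show ?thesis by (simp add: mult.assoc flip: power_add)
  qed
  \<comment> \<open>With a zero index at p nothing is lowered, but then the coefficient
    \<open>kap 0\<close> vanishes.\<close>
  have 5: "cst (h * kap (i ! p) l / 2) * ((-1) ^ ?S * tens n ?j f) = cst (h * kap (i ! p) l / 2) * (U * V * W)"
    using 4 by (cases "i ! p > 0") auto
  show ?thesis
    unfolding 1 2 3 5 by (simp add: algebra_simps)
qed

text \<open>An index shift without boundary terms: F vanishes at the lower end by the first part of
  the assumption and above order K by the second. It trades a lowered index of \<open>tens\<close>
  for a raised index of the coefficient, and back.\<close>

lemma sum_mi_shift:
  fixes F :: "nat list \<Rightarrow> 'a::comm_monoid_add"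
  assumes p: "p < n"
    and 0: "\<And>i. i \<in> mi n K \<Longrightarrow> i ! p = 0 \<Longrightarrow> F i = 0" "\<And>i. i \<notin> mi n K \<Longrightarrow> F i = 0"
  shows "(\<Sum>i\<in>mi n K. F i) = (\<Sum>i\<in>mi n K. F (i[p := Suc (i ! p)]))"
proof -
  have up: "sum_list (i[p := Suc (i ! p)]) = Suc (sum_list i)" if "length i = n" for i
    using that p by (simp add: sum_list_update)
  have down: "Suc (sum_list (i[p := i ! p - 1])) = sum_list i" if "length i = n" "i ! p > 0" for i
    using that p member_le_sum_list[of "i ! p" i] by (auto simp: sum_list_update)
  have "(\<Sum>i\<in>mi n K. F i) = (\<Sum>i\<in>{i\<in>mi n K. i ! p > 0}. F i)"
    using 0 by (intro sum.mono_neutral_right) auto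
  also have "\<dots> = (\<Sum>i\<in>{i\<in>mi n K. i[p := Suc (i ! p)] \<in> mi n K}. F (i[p := Suc (i ! p)]))"
  proof (rule sum.reindex_bij_witness[where j = "\<lambda>i. i[p := i ! p - 1]" and i = "\<lambda>i. i[p := Suc (i ! p)]"], goal_cases)
    case (2 i)
    then have "Suc (sum_list (i[p := i ! p - 1])) = sum_list i" using down by (simp add: mi_def)
    then show ?case using 2 p by (auto simp: mi_def)
  next
    case (4 i)
    then show ?case using p by (auto simp: mi_def)
  qed (use p in \<open>auto simp: mi_def\<close>)
  also have "\<dots> = (\<Sum>i\<in>mi n K. F (i[p := Suc (i ! p)]))"
    using 0 by (intro sum.mono_neutral_left) auto
  finally show ?thesis .
qed

text \<open>After the Leibniz terms cancel, the terms with lowered index are reindexed to have the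
  common factor \<open>tens n i f\<close>. This is why \<open>La\<close> reads the coefficients of
  the operator at raised indices.\<close>

lemma opm_twisted_commutator:
  fixes lam :: "complex list" and f :: "nat \<Rightarrow> sring"
  assumes a: "\<And>i. i \<notin> mi n K \<Longrightarrow> a i = 0" and n: "n = length lam"
  shows "Lo h c mu (opm n K a f) - (\<Sum>p<n. opm n K (tw a) (twf (Lo h c (lam ! p)) p f))
    = opm n K (La h c lam (mu - sum_list lam) a) f"
proof -
  let ?\<delta> = "mu - sum_list lam"
  define F where "F p i = cst (h / 2) * cst ((-1) ^ (\<Sum>r<p. i ! r) * kap (i ! p) (lam ! p)) * eps (a i)
    * tens n (i[p := i ! p - 1]) f" for p i
  have 1: "Lo h c mu (a i * tens n i f) - (\<Sum>p<n. tw a i * tens n i (twf (Lo h c (lam ! p)) p f))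
     = Lo h c (?\<delta> - of_nat (sum_list i) / 2) (a i) * tens n i f + (\<Sum>p<n. F p i)"
    if i: "i \<in> mi n K" for i
  proof -
    have len: "length i = n" using i by (simp add: mi_def)
    define T where "T r = (db ^^ (i ! r)) ((eps ^^ (\<Sum>q\<in>{r<..<n}. i ! q)) (f r))" for r
    define B where "B p = (\<Prod>r<n. if r < p then eps (T r) else if r = p then Lo h c (lam ! p + of_nat (i ! p) / 2) (T p) else T r)" for p
    \<comment> \<open>\<mu> splits into the weight of the coefficient and the weights of the factors
      Dbar^(i_p) f_p, as the Leibniz rules require.\<close>
    have mu: "mu = (?\<delta> - of_nat (sum_list i) / 2) + (\<Sum>p<n. lam ! p + of_nat (i ! p) / 2)"
      by (simp add: sum.distrib sum_list_eq_sum[OF len] sum_list_sum_nth[of lam] n atLeast0LessThan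
          flip: sum_divide_distrib)
    have "Lo h c mu (a i * tens n i f) = Lo h c (?\<delta> - of_nat (sum_list i) / 2) (a i) * tens n i f
        + eps (a i) * Lo h c (\<Sum>p<n. lam ! p + of_nat (i ! p) / 2) (tens n i f)"
      by (subst mu, subst Lo_mult) simp
    also have "Lo h c (\<Sum>p<n. lam ! p + of_nat (i ! p) / 2) (tens n i f) = (\<Sum>p<n. B p)"
      unfolding tens_def Lo_prod B_def T_def by simp
    finally have L: "Lo h c mu (a i * tens n i f) = Lo h c (?\<delta> - of_nat (sum_list i) / 2) (a i) * tens n i f
        + (\<Sum>p<n. eps (a i) * B p)" by (simp add: sum_distrib_left)
    have R: "tw a i * tens n i (twf (Lo h c (lam ! p)) p f) = eps (a i) * B p - F p i" if "p < n" for p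
    proof -
      have "tw a i * tens n i (twf (Lo h c (lam ! p)) p f)
         = eps (a i) * ((-1) ^ sum_list i * tens n i (twf (Lo h c (lam ! p)) p f))"
        by (simp add: tw_def ac_simps)
      also have "\<dots> = eps (a i) * (B p - cst (h * kap (i ! p) (lam ! p) / 2) *
           ((-1) ^ (\<Sum>r<p. i ! r) * tens n (i[p := i ! p - 1]) f))"
        unfolding tens_twf[OF that len] B_def T_def by simp
      also have "cst (h * kap (i ! p) (lam ! p) / 2) = cst (h/2) * cst (kap (i ! p) (lam ! p))"
        by (simp flip: cst_mult)
      finally show ?thesis
        by (simp add: F_def cst_mult cst_power cst_minus algebra_simps)
    qed
    show ?thesis by (simp add: L R sum_subtractf)
  qed
  have 2: "(\<Sum>i\<in>mi n K. F p i) = (\<Sum>i\<in>mi n K. F p (i[p := Suc (i ! p)]))" if "p < n" for p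
    by (rule sum_mi_shift[OF that]) (auto simp: F_def a)
  have 3: "F p (i[p := Suc (i ! p)]) = cst (h / 2) * (cst ((-1) ^ (\<Sum>r<p. i ! r) * kap (Suc (i ! p)) (lam ! p)) *
        eps (a (i[p := Suc (i ! p)]))) * tens n i f" if "p < n" "i \<in> mi n K" for p i
    using that by (simp add: F_def mi_def mult.assoc)
  have "Lo h c mu (opm n K a f) - (\<Sum>p<n. opm n K (tw a) (twf (Lo h c (lam ! p)) p f))
     = (\<Sum>i\<in>mi n K. Lo h c mu (a i * tens n i f) - (\<Sum>p<n. tw a i * tens n i (twf (Lo h c (lam ! p)) p f)))"
    unfolding opm_def by (simp add: Lo_sum sum_subtractf sum.swap[of _ "{..<n}"])
  also have "\<dots> = (\<Sum>i\<in>mi n K. Lo h c (?\<delta> - of_nat (sum_list i) / 2) (a i) * tens n i f)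
      + (\<Sum>p<n. \<Sum>i\<in>mi n K. F p i)"
    by (simp add: 1 sum.distrib sum.swap[of _ "{..<n}"])
  also have "(\<Sum>p<n. \<Sum>i\<in>mi n K. F p i) = (\<Sum>i\<in>mi n K. (cst (h / 2) * (\<Sum>p<n. cst ((-1) ^ (\<Sum>r<p. i ! r) * kap (Suc (i ! p)) (lam ! p)) *
        eps (a (i[p := Suc (i ! p)])))) * tens n i f)"
    by (simp add: 2 3 sum_distrib_left sum_distrib_right sum.swap[of _ "{..<n}"])
  finally show ?thesis
    by (simp add: opm_def La_def n distrib_right sum.distrib)
qed

section \<open>Multilinearity of operators and anticommutators of odd Lie derivatives\<close>

lemma tens_upd:
  assumes "p < n"
  shows "tens n i (f(p := u)) = (db ^^ (i ! p)) ((eps ^^ (\<Sum>q\<in>{p<..<n}. i ! q)) u) *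
    (\<Prod>r\<in>{..<n} - {p}. (db ^^ (i ! r)) ((eps ^^ (\<Sum>q\<in>{r<..<n}. i ! q)) (f r)))"
  using assms by (simp add: tens_def prod.remove[of "{..<n}" p])

lemma tens_upd_add:
  "p < n \<Longrightarrow> tens n i (f(p := u + v)) = tens n i (f(p := u)) + tens n i (f(p := v))"
  by (simp add: tens_upd eps_funpow distrib_right)

lemma tens_upd_minus: "p < n \<Longrightarrow> tens n i (f(p := - u)) = - tens n i (f(p := u))"
  by (simp add: tens_upd eps_funpow)

lemma opm_upd_add:
  "p < n \<Longrightarrow> opm n K a (f(p := u + v)) = opm n K a (f(p := u)) + opm n K a (f(p := v))"
  by (simp add: opm_def tens_upd_add distrib_left sum.distrib)

lemma opm_upd_minus: "p < n \<Longrightarrow> opm n K a (f(p := - u)) = - opm n K a (f(p := u))"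
  by (simp add: opm_def tens_upd_minus sum_negf)

lemma tens_cong: "(\<And>p. p < n \<Longrightarrow> f p = g p) \<Longrightarrow> tens n i f = tens n i g"
  by (simp add: tens_def)

lemma tens_sign:
  "tens n i (\<lambda>r. (-1) ^ k r * f r) = (-1) ^ (\<Sum>r<n. k r) * tens n i f"
proof -
  have db_m: "(db ^^ j) ((-1) ^ m * F) = (-1) ^ m * (db ^^ j) F" for j m F
    by (cases "even m") auto
  have "(eps ^^ e) ((-1) ^ m * F) = (-1) ^ m * (eps ^^ e) F" for e m F
    by (cases "even m") (auto simp: eps_funpow)
  then show ?thesis
    by (simp add: tens_def db_m prod.distrib power_sum)
qed

lemma tens_eps:
  assumes "length i = n"
  shows "tens n i (\<lambda>r. eps (f r)) = (-1) ^ sum_list i * eps (tens n i f)"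
proof -
  have "(eps ^^ m) (eps F) = eps ((eps ^^ m) F)" for m F
    by (simp add: eps_funpow)
  then show ?thesis
    by (simp add: tens_def db_pow_eps prod.distrib sum_list_eq_sum[OF assms] eps_prod power_sum)
qed

text \<open>Twisting is conjugation by the parity involution on arguments and value. In this form
  the formula for the Lie derivative can be applied twice in a row.\<close>

lemma opm_tw: "opm n K (tw a) f = eps (opm n K a (\<lambda>r. eps (f r)))"
  unfolding opm_def eps_sum
  by (rule sum.cong) (auto simp: tw_def mi_def tens_eps uminus_power_if)

lemma La_supported:
  assumes "\<And>i. i \<notin> mi (length lam) K \<Longrightarrow> a i = 0" "i \<notin> mi (length lam) K"
  shows "La h c lam \<delta> a i = 0"
proof -
  have "a (i[p := Suc (i ! p)]) = 0" if "p < length lam" for p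
    using assms that by (auto simp: mi_def sum_list_update intro!: assms(1))
  then show ?thesis using assms by (simp add: La_def)
qed

lemma opm_La:
  assumes "\<And>i. i \<notin> mi n K \<Longrightarrow> a i = 0" "n = length lam"
  shows "opm n K (La h c lam (mu - sum_list lam) a) f =
    Lo h c mu (opm n K a f) - (\<Sum>p<n. eps (opm n K a (\<lambda>r. eps (twf (Lo h c (lam ! p)) p f r))))"
  using opm_twisted_commutator[OF assms] by (simp add: opm_tw)

text \<open>In the right one of the two slots, one order of application puts the involution before
  the odd field and the other puts it after, which costs one sign; all other slots agree.\<close>

lemma twf_anticommute:
  assumes "p < n" "q < n" "p \<noteq> q"
    and A: "\<And>p F. eps (A p F) = - A p (eps F)" and B: "\<And>p F. eps (B p F) = - B p (eps F)"
  shows "opm n K a (\<lambda>r. eps (twf (B q) q (\<lambda>r. eps (twf (A p) p f r)) r)) =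
    - opm n K a (\<lambda>r. eps (twf (A p) p (\<lambda>r. eps (twf (B q) q f r)) r))"
proof (cases "p < q")
  case True
  define g where "g = (\<lambda>r. eps (twf (A p) p (\<lambda>r. eps (twf (B q) q f r)) r))"
  have "(\<lambda>r. eps (twf (B q) q (\<lambda>r. eps (twf (A p) p f r)) r)) = g(q := - g q)"
    using True by (auto simp: g_def twf_def fun_eq_iff B)
  then show ?thesis
    by (simp add: opm_upd_minus assms flip: g_def)
next
  case False
  then have "q < p" using assms by simp
  define g where "g = (\<lambda>r. eps (twf (A p) p (\<lambda>r. eps (twf (B q) q f r)) r))"
  have "(\<lambda>r. eps (twf (B q) q (\<lambda>r. eps (twf (A p) p f r)) r)) = g(p := - g p)"
    using \<open>q < p\<close> by (auto simp: g_def twf_def fun_eq_iff A)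
  then show ?thesis
    by (simp add: opm_upd_minus assms flip: g_def)
qed

text \<open>Provides the even generators. In the double sum over slots the off-diagonal terms cancel
  because odd fields in different slots anticommute; the diagonal leaves the anticommutator in a
  single slot, with no sign from the other arguments.\<close>

lemma opm_anticommutator:
  fixes lam :: "complex list" and h c h' c' mu :: complex
  assumes a: "\<And>i. i \<notin> mi n K \<Longrightarrow> a i = 0" and n: "n = length lam"
  defines "A \<equiv> Lo h c" and "B \<equiv> Lo h' c'" and "\<delta> \<equiv> mu - sum_list lam"
  shows "opm n K (\<lambda>i. La h c lam \<delta> (La h' c' lam \<delta> a) i + La h' c' lam \<delta> (La h c lam \<delta> a) i) f =
    A mu (B mu (opm n K a f)) + B mu (A mu (opm n K a f)) -
    (\<Sum>p<n. opm n K a (f(p := A (lam ! p) (B (lam ! p) (f p)) + B (lam ! p) (A (lam ! p) (f p)))))"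
proof -
  let ?M = "opm n K a"
  let ?X = "\<lambda>L p f r. eps (twf (L (lam ! p)) p f r)"
  have epsA: "eps (A \<nu> F) = - A \<nu> (eps F)" and epsB: "eps (B \<nu> F) = - B \<nu> (eps F)" for \<nu> F
    by (simp_all add: A_def B_def eps_Lo)
  have sup: "La h c lam \<delta> a i = 0" if "i \<notin> mi n K" for h c i
    using La_supported[of lam K a i] a that n by auto
  have sup': "opm n K (La h c lam \<delta> (La h' c' lam \<delta> a)) f = Lo h c mu (opm n K (La h' c' lam \<delta> a) f)
      - (\<Sum>p<n. eps (opm n K (La h' c' lam \<delta> a) (\<lambda>r. eps (twf (Lo h c (lam ! p)) p f r))))" for h c h' c' f
    unfolding \<delta>_def by (rule opm_La) (use sup[of _ h' c'] n in \<open>auto simp: \<delta>_def\<close>)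
  have a': "opm n K (La h c lam \<delta> a) f = Lo h c mu (opm n K a f)
      - (\<Sum>p<n. eps (opm n K a (\<lambda>r. eps (twf (Lo h c (lam ! p)) p f r))))" for h c f
    unfolding \<delta>_def by (rule opm_La) (use a n in auto)
  \<comment> \<open>The two middle sums change sign when (h, c) and (h', c') are exchanged, so they
    drop out of the anticommutator.\<close>
  have 1: "opm n K (La h c lam \<delta> (La h' c' lam \<delta> a)) f =
      Lo h c mu (Lo h' c' mu (?M f)) - (\<Sum>q<n. Lo h c mu (eps (?M (?X (Lo h' c') q f))))
      + (\<Sum>p<n. Lo h' c' mu (eps (?M (?X (Lo h c) p f))))
      + (\<Sum>p<n. \<Sum>q<n. ?M (?X (Lo h' c') q (?X (Lo h c) p f)))" for h c h' c'
    unfolding sup' a'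
    by (simp add: Lo_sum eps_sum eps_Lo sum_subtractf sum_negf)
  let ?Z = "\<lambda>p q. ?M (?X B q (?X A p f)) + ?M (?X A p (?X B q f))"
  have "opm n K (\<lambda>i. La h c lam \<delta> (La h' c' lam \<delta> a) i + La h' c' lam \<delta> (La h c lam \<delta> a) i) f =
     opm n K (La h c lam \<delta> (La h' c' lam \<delta> a)) f + opm n K (La h' c' lam \<delta> (La h c lam \<delta> a)) f"
    by (simp add: opm_def distrib_right sum.distrib)
  also have "\<dots> = A mu (B mu (?M f)) + B mu (A mu (?M f))
      + ((\<Sum>p<n. \<Sum>q<n. ?M (?X B q (?X A p f))) + (\<Sum>q<n. \<Sum>p<n. ?M (?X A p (?X B q f))))"
    unfolding 1 A_def[symmetric] B_def[symmetric] by (simp add: algebra_simps)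
  also have "(\<Sum>q<n. \<Sum>p<n. ?M (?X A p (?X B q f))) = (\<Sum>p<n. \<Sum>q<n. ?M (?X A p (?X B q f)))"
    by (rule sum.swap)
  also have "(\<Sum>p<n. \<Sum>q<n. ?M (?X B q (?X A p f))) + \<dots> = (\<Sum>p<n. \<Sum>q<n. ?Z p q)"
    by (simp add: sum.distrib)
  also have "\<dots> = (\<Sum>p<n. ?Z p p)"
  proof (rule sum.cong[OF refl])
    fix p assume "p \<in> {..<n}"
    then have p: "p < n" by simp
    have "(\<Sum>q<n. ?Z p q) = (\<Sum>q\<in>{p}. ?Z p q)"
      using p twf_anticommute[of p n _ "\<lambda>p. A (lam ! p)" "\<lambda>p. B (lam ! p)" K a f] epsA epsB
      by (intro sum.mono_neutral_right) auto
    then show "(\<Sum>q<n. ?Z p q) = ?Z p p" by simp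
  qed
  also have "\<dots> = (\<Sum>p<n. - ?M (f(p := A (lam ! p) (B (lam ! p) (f p)) + B (lam ! p) (A (lam ! p) (f p)))))"
  proof (rule sum.cong[OF refl])
    fix p assume "p \<in> {..<n}"
    then have p: "p < n" by simp
    have "?X B p (?X A p f) = f(p := - B (lam ! p) (A (lam ! p) (f p)))"
         "?X A p (?X B p f) = f(p := - A (lam ! p) (B (lam ! p) (f p)))"
      by (auto simp: twf_def epsA epsB fun_eq_iff)
    then show "?Z p p = - ?M (f(p := A (lam ! p) (B (lam ! p) (f p)) + B (lam ! p) (A (lam ! p) (f p))))"
      using p by (simp add: opm_upd_add opm_upd_minus)
  qed
  finally show ?thesis by (simp add: sum_negf)
qed

subsection \<open>Translation of the definitions to the ring\<close>

definition lden :: "complex \<Rightarrow> sring \<Rightarrow> sring \<Rightarrow> sring" where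
  "lden l F G = F * dd (dd G) + cst (1/2) * (dd F * db G) + cst l * (dd (dd F) * G)"

lemma body_numeral [simp]: "body (numeral k) = (\<lambda>x. numeral k)"
  and soul_numeral [simp]: "soul (numeral k) = (\<lambda>x. 0)"
  by (simp_all flip: cst_numeral)

lemma Rep_simps:
  "sadd (Rep_sring F) (Rep_sring G) = Rep_sring (F + G)"
  "smul (Rep_sring F) (Rep_sring G) = Rep_sring (F * G)"
  "sD (Rep_sring F) = Rep_sring (dd F)"
  "sDbar (Rep_sring F) = Rep_sring (db F)"
  "szero = Rep_sring 0"
  "sone = Rep_sring 1"
  by (simp_all add: plus_sring.rep_eq times_sring.rep_eq dd.rep_eq db.rep_eq zero_sring.rep_eq one_sring.rep_eq)

lemma Rep_scale: "sscale c (Rep_sring F) = Rep_sring (cst c * F)"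
  by (simp add: times_sring.rep_eq cst.rep_eq smul_def sscale_def)

lemma Rep_dx: "sdx (Rep_sring F) = Rep_sring (dd (dd F))"
  by (simp add: dd.rep_eq sD_def sdx_def)

lemma Rep_sum: "finite A \<Longrightarrow> ssum (\<lambda>i. Rep_sring (f i)) A = Rep_sring (sum f A)"
  by (induction A rule: finite_induct)
    (simp_all add: ssum_def zero_sring.rep_eq szero_def plus_sring.rep_eq sadd_def prod_eq_iff fun_eq_iff)

lemma Rep_lden: "Lden l (Rep_sring F) (Rep_sring G) = Rep_sring (lden l F G)"
  by (simp add: Lden_def Xact_def Rep_simps Rep_scale Rep_dx lden_def add.assoc)

lemma Rep_dd_pow: "(sD ^^ k) (Rep_sring F) = Rep_sring ((dd ^^ k) F)"
  by (induction k) (simp_all add: Rep_simps)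

lemma Rep_db_pow: "(sDbar ^^ k) (Rep_sring F) = Rep_sring ((db ^^ k) F)"
  by (induction k) (simp_all add: Rep_simps)

lemma smooth_Rep [simp]: "smooth_sf (Rep_sring F)"
  using Rep_sring by simp

lemma Rep_prod_list: "sprod_list (map Rep_sring Fs) = Rep_sring (prod_list Fs)"
  by (induction Fs) (simp_all add: sprod_list_def Rep_simps)

lemma homog_Rep: "homog (Rep_sring F) \<longleftrightarrow> eps F = F \<or> eps F = - F"
proof -
  have "eps F = F \<longleftrightarrow> snd (Rep_sring F) = (\<lambda>_. 0)" "eps F = - F \<longleftrightarrow> fst (Rep_sring F) = (\<lambda>_. 0)"
    by (transfer, auto simp: fun_eq_iff prod_eq_iff)+
  then show ?thesis by (simp add: homog_def)
qed

lemma eps_homog: "homog (Rep_sring F) \<Longrightarrow> eps F = (-1) ^ spar (Rep_sring F) * F"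
proof -
  assume h: "homog (Rep_sring F)"
  have "eps F = F \<longleftrightarrow> snd (Rep_sring F) = (\<lambda>_. 0)"
    by (transfer, auto simp: fun_eq_iff prod_eq_iff)
  then show ?thesis using h by (auto simp: spar_def homog_Rep)
qed

lemma eps_lden: "eps (lden l F G) = lden l (eps F) (eps G)"
  by (simp add: lden_def dd_eps db_eps)

lemma homog_lden: "homog (Rep_sring F) \<Longrightarrow> homog (Rep_sring G) \<Longrightarrow> homog (Rep_sring (lden l F G))"
  unfolding homog_Rep eps_lden by (auto simp: lden_def)

lemma Rep_opmap:
  assumes "length fs = n" "\<forall>f\<in>set fs. smooth_sf f \<and> homog f"
  shows "opmap n K (\<lambda>i. Rep_sring (a i)) fs = Rep_sring (opm n K a (\<lambda>p. Abs_sring (fs ! p)))"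
proof -
  define g where "g p = Abs_sring (fs ! p)" for p
  have g: "fs ! p = Rep_sring (g p)" "homog (Rep_sring (g p))" if "p < n" for p
    using assms that by (auto simp: g_def Abs_sring_inverse)
  have 1: "cst ((-1) ^ (\<Sum>p<n. spar (fs ! p) * (\<Sum>q\<in>{p<..<n}. i ! q))) * (\<Prod>p<n. (db ^^ (i ! p)) (g p)) = tens n i g" for i
  proof -
    have m: "(db ^^ k) ((-1) ^ m * F) = (-1) ^ m * (db ^^ k) F" for k m F
      by (cases "even m") auto
    \<comment> \<open>On homogeneous arguments the involution is a sign, which recovers the sign
      rule of the original definition.\<close>
    have "(eps ^^ e) (g p) = (-1) ^ (spar (fs ! p) * e) * g p" if "p < n" for e p
      using eps_homog[OF g(2)[OF that]] g(1)[OF that] by (cases "even e") (auto simp: eps_funpow minus_one_power_iff)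
    then have "tens n i g = (\<Prod>p<n. (-1) ^ (spar (fs ! p) * (\<Sum>q\<in>{p<..<n}. i ! q)) * (db ^^ (i ! p)) (g p))"
      by (simp add: tens_def m)
    moreover have "cst ((-1) ^ m) = (-1) ^ m" for m
      by (simp add: cst_power cst_minus)
    ultimately show ?thesis by (simp only: prod.distrib power_sum[symmetric])
  qed
  have 2: "sprod_list (map2 (\<lambda>k f. (sDbar ^^ k) f) i fs) = Rep_sring (\<Prod>p<n. (db ^^ (i ! p)) (g p))"
    if "length i = n" for i
  proof -
    have "map2 (\<lambda>k f. (sDbar ^^ k) f) i fs = map Rep_sring (map (\<lambda>p. (db ^^ (i ! p)) (g p)) [0..<n])"
      by (rule nth_equalityI) (use that assms(1) g(1) in \<open>auto simp: Rep_db_pow\<close>)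
    then have "sprod_list (map2 (\<lambda>k f. (sDbar ^^ k) f) i fs) = Rep_sring (prod_list (map (\<lambda>p. (db ^^ (i ! p)) (g p)) [0..<n]))"
      by (simp only: Rep_prod_list)
    then show ?thesis
      by (simp add: prod.list_conv_set_nth atLeast0LessThan)
  qed
  have "opmap n K (\<lambda>i. Rep_sring (a i)) fs = ssum (\<lambda>i. Rep_sring (a i * tens n i g)) (mi n K)"
    unfolding opmap_def ssum_def
    by (simp add: 2 Rep_simps Rep_scale mi_def mult.left_commute[of "cst _"] 1)
  then show ?thesis by (simp add: Rep_sum opm_def g_def[abs_def])
qed

lemma opm_cong: "(\<And>p. p < n \<Longrightarrow> f p = g p) \<Longrightarrow> opm n K a f = opm n K a g"
  unfolding opm_def using tens_cong[of n f g] by simp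

lemma opm_add_coeff: "opm n K (\<lambda>i. a i + b i) f = opm n K a f + opm n K b f"
  by (simp add: opm_def distrib_right sum.distrib)

lemma opm_diff_coeff: "opm n K (\<lambda>i. a i - b i) f = opm n K a f - opm n K b f"
  by (simp add: opm_def left_diff_distrib sum_subtractf)

lemma opm_cmult_coeff: "opm n K (\<lambda>i. cst c * a i) f = cst c * opm n K a f"
  by (simp add: opm_def sum_distrib_left mult.assoc)

definition optr :: "nat \<Rightarrow> (nat list \<Rightarrow> sring) \<Rightarrow> nat list \<Rightarrow> sring" where
  "optr q b i = (if sum_list i mod 2 = q then cst (1/2) * (b i + eps (b i)) else cst (1/2) * (b i - eps (b i)))"

lemma Rep_opart: "opart q (\<lambda>i. Rep_sring (b i)) = (\<lambda>i. Rep_sring (optr q b i))"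
proof -
  have 1: "(fst (Rep_sring G), \<lambda>_. 0) = Rep_sring (cst (1/2) * (G + eps G))"
    "(\<lambda>_. 0, snd (Rep_sring G)) = Rep_sring (cst (1/2) * (G - eps G))" for G
    by (transfer, auto simp: smul_def sadd_def)+
  show ?thesis by (auto simp: opart_def optr_def 1)
qed

text \<open>Depending on the parity of F, the two parity parts of an operator are recombined with
  coefficients 1, 1 or 1, -1; the second combination is the twist.\<close>

lemma optr_add: "optr 0 b i + optr 1 b i = b i"
  and optr_diff: "optr 0 b i - optr (Suc 0) b i = tw b i"
proof -
  have "cst (1/2) * (G + eps G) + cst (1/2) * (G - eps G) = G"
    "cst (1/2) * (G + eps G) - cst (1/2) * (G - eps G) = eps G" for G
    by (auto intro!: sring_eqI simp: field_simps)
  moreover from this have "cst (1/2) * (G - eps G) + cst (1/2) * (G + eps G) = G"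
    "cst (1/2) * (G - eps G) - cst (1/2) * (G + eps G) = - eps G" for G
    by (metis add.commute, metis minus_diff_eq)
  ultimately show "optr 0 b i + optr 1 b i = b i" "optr 0 b i - optr (Suc 0) b i = tw b i"
    by (auto simp: optr_def tw_def minus_one_power_iff even_iff_mod_2_eq_zero not_mod_2_eq_0_eq_1 simp del: eps_simps)
qed

definition good :: "nat \<Rightarrow> sfun list \<Rightarrow> bool" where
  "good n fs \<longleftrightarrow> length fs = n \<and> (\<forall>f\<in>set fs. smooth_sf f \<and> homog f)"

lemma goodD:
  assumes "good n fs" "p < n"
  shows "Rep_sring (Abs_sring (fs ! p)) = fs ! p" "homog (Rep_sring (Abs_sring (fs ! p)))"
  using assms by (auto simp: good_def Abs_sring_inverse)

lemma Rep_op_after_act: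
  assumes fs: "good (length lam) fs" and F: "homog (Rep_sring F)"
  defines "f \<equiv> \<lambda>p. Abs_sring (fs ! p)"
  shows "op_after_act lam K (Rep_sring F) (\<lambda>i. Rep_sring (b i)) fs =
    Rep_sring (\<Sum>p<length lam. cst ((-1) ^ (spar (Rep_sring F) * (\<Sum>r<p. spar (fs ! r)))) *
      opm (length lam) K b (f(p := lden (lam ! p) F (f p))))"
proof -
  have 1: "opmap (length lam) K (\<lambda>i. Rep_sring (b i)) (fs[p := Lden (lam ! p) (Rep_sring F) (fs ! p)])
      = Rep_sring (opm (length lam) K b (f(p := lden (lam ! p) F (f p))))" if p: "p < length lam" for p
  proof -
    have e: "Lden (lam ! p) (Rep_sring F) (fs ! p) = Rep_sring (lden (lam ! p) F (f p))"
      using goodD(1)[OF fs p] Rep_lden[of "lam ! p" F "f p"] by (simp add: f_def)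
    have h: "homog (Rep_sring (lden (lam ! p) F (f p)))"
      unfolding f_def by (intro homog_lden F goodD(2)[OF fs p])
    have "opmap (length lam) K (\<lambda>i. Rep_sring (b i)) (fs[p := Rep_sring (lden (lam ! p) F (f p))])
      = Rep_sring (opm (length lam) K b (\<lambda>r. Abs_sring (fs[p := Rep_sring (lden (lam ! p) F (f p))] ! r)))"
      using fs h set_update_subset_insert[of fs p "Rep_sring (lden (lam ! p) F (f p))"] by (intro Rep_opmap) (auto simp: good_def)
    also have "opm (length lam) K b (\<lambda>r. Abs_sring (fs[p := Rep_sring (lden (lam ! p) F (f p))] ! r))
       = opm (length lam) K b (f(p := lden (lam ! p) F (f p)))"
      using fs p by (intro opm_cong) (auto simp: f_def good_def nth_list_update Rep_sring_inverse)
    finally show ?thesis by (simp add: e)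
  qed
  have "op_after_act lam K (Rep_sring F) (\<lambda>i. Rep_sring (b i)) fs =
     ssum (\<lambda>p. Rep_sring (cst ((-1) ^ (spar (Rep_sring F) * (\<Sum>r<p. spar (fs ! r)))) *
      opm (length lam) K b (f(p := lden (lam ! p) F (f p))))) {..<length lam}"
    unfolding op_after_act_def ssum_def by (simp add: 1 Rep_scale)
  then show ?thesis by (simp add: Rep_sum)
qed

lemma Rep_Lop:
  assumes fs: "good (length lam) fs" and F: "homog (Rep_sring F)"
  defines "f \<equiv> \<lambda>p. Abs_sring (fs ! p)" and "s \<equiv> spar (Rep_sring F)"
  shows "Lop lam mu K (Rep_sring F) (\<lambda>i. Rep_sring (b i)) fs =
    Rep_sring (lden mu F (opm (length lam) K b f) -
      (\<Sum>p<length lam. cst ((-1) ^ (s * (\<Sum>r<p. spar (fs ! r)))) *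
        opm (length lam) K (\<lambda>i. optr 0 b i + cst ((-1) ^ s) * optr 1 b i) (f(p := lden (lam ! p) F (f p)))))"
proof -
  have 1: "opmap (length lam) K (\<lambda>i. Rep_sring (b i)) fs = Rep_sring (opm (length lam) K b f)"
    unfolding f_def using fs by (intro Rep_opmap) (auto simp: good_def)
  have 2: "ssum (\<lambda>q. Rep_sring (g q)) {0, 1} = Rep_sring (g 0 + g 1)" for g :: "nat \<Rightarrow> sring"
    by (simp add: Rep_sum)
  have 3: "opm n K (\<lambda>i. optr 0 b i + cst c * optr 1 b i) g = opm n K (optr 0 b) g + cst c * opm n K (optr 1 b) g" for n c g
    by (simp add: opm_add_coeff opm_cmult_coeff)
  show ?thesis
    unfolding Lop_def Rep_opart Rep_op_after_act[OF fs F] 1 Rep_lden Rep_scale 2 Rep_simps f_def[symmetric] s_def[symmetric] 3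
    by (simp add: cst_minus distrib_left sum.distrib sum_distrib_left sum_negf f_def
        mult.left_commute[of "cst ((-1) ^ s)"]) (simp add: algebra_simps)
qed

lemma opm_sign_twist:
  assumes fs: "good n fs" and "p < n"
  defines "f \<equiv> \<lambda>p. Abs_sring (fs ! p)"
  shows "cst ((-1) ^ (\<Sum>r<p. spar (fs ! r))) * opm n K b (f(p := L (f p))) = opm n K b (twf L p f)"
proof -
  let ?k = "\<lambda>r. if r < p then spar (fs ! r) else 0"
  define g where "g = f(p := L (f p))"
  have "opm n K b (twf L p f) = opm n K b (\<lambda>r. (-1) ^ ?k r * g r)"
    using goodD[OF fs] assms(2) by (intro opm_cong) (auto simp: g_def twf_def f_def eps_homog)
  also have "\<dots> = (-1) ^ (\<Sum>r<n. ?k r) * opm n K b g"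
    unfolding opm_def tens_sign by (simp add: sum_distrib_left mult.left_commute)
  also have "(\<Sum>r<n. ?k r) = (\<Sum>r<p. spar (fs ! r))"
    using assms(2) by (simp add: sum.If_cases Int_absorb1 subset_eq lessThan_def[symmetric])
  finally show ?thesis unfolding g_def[symmetric] by (simp add: cst_power cst_minus)
qed

lemma Rep_Lop_even:
  assumes fs: "good (length lam) fs" and F: "eps F = F"
  defines "f \<equiv> \<lambda>p. Abs_sring (fs ! p)"
  shows "Lop lam mu K (Rep_sring F) (\<lambda>i. Rep_sring (b i)) fs =
    Rep_sring (lden mu F (opm (length lam) K b f) -
      (\<Sum>p<length lam. opm (length lam) K b (f(p := lden (lam ! p) F (f p)))))"
proof -
  have "snd (Rep_sring F) = (\<lambda>_. 0)" using F by (transfer, auto simp: fun_eq_iff prod_eq_iff)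
  then have "spar (Rep_sring F) = 0" by (simp add: spar_def)
  moreover have "(\<lambda>i. optr 0 b i + cst ((-1) ^ 0) * optr 1 b i) = b"
    using optr_add[of b] by (simp add: fun_eq_iff)
  ultimately show ?thesis
    using Rep_Lop[OF fs, of F mu K b] F unfolding f_def
    by (simp only: homog_Rep) simp
qed

lemma Rep_Lop_odd:
  assumes fs: "good (length lam) fs" and F: "eps F = - F" "F \<noteq> 0"
  defines "f \<equiv> \<lambda>p. Abs_sring (fs ! p)"
  shows "Lop lam mu K (Rep_sring F) (\<lambda>i. Rep_sring (b i)) fs =
    Rep_sring (lden mu F (opm (length lam) K b f) -
      (\<Sum>p<length lam. opm (length lam) K (tw b) (twf (lden (lam ! p) F) p f)))"
proof -
  \<comment> \<open>This uses that F is non-zero: \<open>spar\<close> gives the zero function parity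
    0.\<close>
  have "snd (Rep_sring F) \<noteq> (\<lambda>_. 0)" using F by (transfer, auto simp: fun_eq_iff prod_eq_iff szero_def)
  then have "spar (Rep_sring F) = 1" by (simp add: spar_def)
  moreover have "(\<lambda>i. optr 0 b i + cst ((-1) ^ 1) * optr 1 b i) = tw b"
    using optr_diff[of b] by (simp add: cst_minus fun_eq_iff)
  ultimately have "Lop lam mu K (Rep_sring F) (\<lambda>i. Rep_sring (b i)) fs =
    Rep_sring (lden mu F (opm (length lam) K b f) - (\<Sum>p<length lam. cst ((-1) ^ (\<Sum>r<p. spar (fs ! r))) *
      opm (length lam) K (tw b) (f(p := lden (lam ! p) F (f p)))))"
    using Rep_Lop[OF fs, of F mu K b] F(1) unfolding f_def by (simp only: homog_Rep mult_1) simp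
  also have "(\<Sum>p<length lam. cst ((-1) ^ (\<Sum>r<p. spar (fs ! r))) *
      opm (length lam) K (tw b) (f(p := lden (lam ! p) F (f p)))) =
      (\<Sum>p<length lam. opm (length lam) K (tw b) (twf (lden (lam ! p) F) p f))"
    unfolding f_def by (intro sum.cong[OF refl] opm_sign_twist[OF fs]) simp
  finally show ?thesis .
qed

lemma osp_gens_eq: "osp_gens = Rep_sring ` {1, xx, xx * xx, th, xx * th}"
  by (simp add: osp_gens_def one_sring.rep_eq sone_def xx.rep_eq times_sring.rep_eq th.rep_eq smul_def
      power2_eq_square)

subsection \<open>Injectivity of the coefficient representation\<close>

text \<open>D and Dbar lower j by one, up to a non-zero scalar.\<close>

definition smon :: "sring \<Rightarrow> nat \<Rightarrow> sring" where
  "smon X j = (if even j then 1 else th) * X ^ (j div 2)"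

lemma eps_smon: "eps X = X \<Longrightarrow> eps (smon X j) = (-1) ^ j * smon X j"
proof -
  assume "eps X = X"
  then have "eps (X ^ r) = X ^ r" for r by (induction r) auto
  then show ?thesis by (auto simp: smon_def)
qed

lemma dd_pow_even:
  assumes "eps X = X" "dd X = th"
  shows "dd (X ^ r) = of_nat r * (th * X ^ (r - 1))"
proof (induction r)
  case (Suc r)
  have "of_nat r * (X * (th * X ^ (r - 1))) = of_nat r * (th * X ^ r)"
    by (cases r) (auto simp: ac_simps)
  then show ?case using assms Suc by (simp add: dd_mult algebra_simps)
qed simp

lemma dd_smon_0: "dd (smon X 0) = 0"
  by (simp add: smon_def)

lemma dd_smon_Suc:
  assumes X: "eps X = X" "dd X = th"
  obtains c where "c \<noteq> 0" "dd (smon X (Suc j)) = cst c * smon X j"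
proof (cases "even j")
  case True
  moreover have "th * (of_nat r * (th * F)) = 0" for r F
    by (metis mult.left_commute mult_zero_right th_th')
  ultimately have "dd (smon X (Suc j)) = cst 1 * smon X j"
    by (simp add: smon_def dd_mult dd_pow_even[OF X])
  then show ?thesis using that[of 1] by simp
next
  case False
  then have "Suc j div 2 = Suc (j div 2)" by (auto elim!: oddE)
  then have "dd (smon X (Suc j)) = cst (of_nat (Suc j div 2)) * smon X j"
    using False dd_pow_even[OF X, of "Suc j div 2"] \<open>Suc j div 2 = Suc (j div 2)\<close>
    by (simp add: smon_def cst_of_nat del: power_Suc of_nat_Suc)
  moreover have "of_nat (Suc j div 2) \<noteq> (0 :: complex)"
    using \<open>Suc j div 2 = Suc (j div 2)\<close> by (metis of_nat_neq_0)
  ultimately show ?thesis using that by blast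
qed

lemma db_eq: "db F = eps (dd F)"
  by (simp add: dd_eq)

lemma db_pow_cmult: "(db ^^ i) (cst c * F) = cst c * (db ^^ i) F"
  by (induction i) auto

lemma db_smon_Suc:
  assumes X: "eps X = X" "dd X = th"
  obtains c where "c \<noteq> 0" "db (smon X (Suc j)) = cst c * smon X j"
proof -
  obtain c where c: "c \<noteq> 0" "dd (smon X (Suc j)) = cst c * smon X j"
    using dd_smon_Suc[OF X] .
  have "db (smon X (Suc j)) = cst (c * (-1) ^ j) * smon X j"
    by (simp add: db_eq c eps_smon X cst_mult cst_power cst_minus mult.assoc)
  then show ?thesis using that[of "c * (-1) ^ j"] c by simp
qed

lemma db_pow_smon_less:
  assumes X: "eps X = X" "dd X = th"
  shows "j < i \<Longrightarrow> (db ^^ i) (smon X j) = 0"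
proof (induction i arbitrary: j)
  case (Suc i)
  show ?case
  proof (cases j)
    case 0
    then have "db (smon X j) = 0" by (simp add: db_eq dd_smon_0)
    then show ?thesis by (simp add: funpow_Suc_right del: funpow.simps)
  next
    case (Suc j')
    obtain c where "db (smon X (Suc j')) = cst c * smon X j'" using db_smon_Suc[OF X] .
    then show ?thesis using Suc Suc.IH[of j'] Suc.prems
      by (simp add: funpow_Suc_right db_pow_cmult del: funpow.simps)
  qed
qed simp

lemma db_pow_smon_eq:
  assumes X: "eps X = X" "dd X = th"
  shows "\<exists>c. c \<noteq> 0 \<and> (db ^^ j) (smon X j) = cst c"
proof (induction j)
  case 0
  then show ?case by (auto simp: smon_def intro!: exI[of _ 1])
next
  case (Suc j)
  obtain c where "c \<noteq> 0" "db (smon X (Suc j)) = cst c * smon X j" using db_smon_Suc[OF X] .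
  moreover from Suc obtain d where "d \<noteq> 0" "(db ^^ j) (smon X j) = cst d" by auto
  ultimately have "(db ^^ Suc j) (smon X (Suc j)) = cst (c * d) \<and> c * d \<noteq> 0"
    by (simp add: funpow_Suc_right db_pow_cmult cst_mult del: funpow.simps)
  then show ?case by blast
qed

lemma eps_pow_smon: "eps X = X \<Longrightarrow> (eps ^^ e) (smon X j) = cst ((-1) ^ (e * j)) * smon X j"
  by (cases "even e") (auto simp: eps_funpow eps_smon cst_power cst_minus minus_one_power_iff)

text \<open>Triangularity: if i and j differ and the order of j is not larger, some entry of i
  exceeds that of j, and this power of Dbar kills the corresponding monomial.\<close>

lemma tens_smon_eq_0:
  assumes "length i = n" "length j = n" "i \<noteq> j" "sum_list j \<le> sum_list i"
  shows "tens n i (\<lambda>p. smon xx (j ! p)) = 0"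
proof -
  have "\<exists>p<n. j ! p < i ! p"
  proof (rule ccontr)
    assume "\<not> ?thesis"
    then have le: "\<forall>p<n. i ! p \<le> j ! p" by auto
    then have "(\<Sum>p<n. i ! p) \<le> (\<Sum>p<n. j ! p)" by (intro sum_mono) auto
    then have "(\<Sum>p<n. i ! p) = (\<Sum>p<n. j ! p)"
      using assms(4) by (simp add: sum_list_eq_sum[OF assms(1)] sum_list_eq_sum[OF assms(2)])
    then have "\<forall>p\<in>{..<n}. i ! p = j ! p"
      using le by (intro ballI sum_mono_inv[of "\<lambda>p. i ! p" "{..<n}"]) auto
    then show False using assms by (auto intro: nth_equalityI)
  qed
  then obtain p where p: "p < n" "j ! p < i ! p" by auto
  then have "(db ^^ (i ! p)) (smon xx (j ! p)) = 0" by (intro db_pow_smon_less) auto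
  then show ?thesis
    unfolding tens_def using p by (intro prod_zero) (auto simp: eps_pow_smon db_pow_cmult intro!: bexI[of _ p])
qed

lemma tens_smon_eq: "\<exists>c. c \<noteq> 0 \<and> tens n j (\<lambda>p. smon xx (j ! p)) = cst c"
proof -
  obtain d where d: "\<And>j. d j \<noteq> 0" "\<And>j. (db ^^ j) (smon xx j) = cst (d j)"
    using db_pow_smon_eq[of xx] eps_simps(9) dd_simps(8) by metis
  have pc: "(\<Prod>p<n. cst (g p)) = cst (\<Prod>p<n. g p)" for g
    by (induction n) (auto simp: cst_mult)
  show ?thesis
    by (intro exI[of _ "\<Prod>p<n. (-1) ^ ((\<Sum>q\<in>{p<..<n}. j ! q) * j ! p) * d (j ! p)"])
      (auto simp: tens_def eps_pow_smon db_pow_cmult d pc[symmetric] cst_mult)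
qed

text \<open>Evaluation on monomials is a triangular system for the coefficients, with non-zero
  constants on the diagonal; it is solved by induction on the order.\<close>

lemma opm_inj:
  assumes 0: "\<And>j. j \<in> mi n K \<Longrightarrow> opm n K a (\<lambda>p. smon xx (j ! p)) = 0" and "j \<in> mi n K"
  shows "a j = 0"
  using assms(2)
proof (induction "sum_list j" arbitrary: j rule: less_induct)
  case less
  have "a i * tens n i (\<lambda>p. smon xx (j ! p)) = 0" if "i \<in> mi n K" "i \<noteq> j" for i
  proof (cases "sum_list i < sum_list j")
    case True
    then show ?thesis using less that by simp
  next
    case False
    then show ?thesis using that less.prems tens_smon_eq_0[of i n j] by (auto simp: mi_def)
  qed
  then have "opm n K a (\<lambda>p. smon xx (j ! p)) = a j * tens n j (\<lambda>p. smon xx (j ! p))"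
    unfolding opm_def using less.prems by (subst sum.remove[of _ j]) (auto intro!: sum.neutral)
  moreover obtain c where "c \<noteq> 0" "tens n j (\<lambda>p. smon xx (j ! p)) = cst c"
    using tens_smon_eq by blast
  ultimately have "cst c * a j = cst c * 0" using 0[OF less.prems] by (simp add: mult.commute)
  then show ?case using cst_mult_cancel \<open>c \<noteq> 0\<close> by blast
qed

definition supp :: "nat \<Rightarrow> nat \<Rightarrow> (nat list \<Rightarrow> sring) \<Rightarrow> bool" where
  "supp n K a \<longleftrightarrow> (\<forall>i. i \<notin> mi n K \<longrightarrow> a i = 0)"

lemma Dk_Rep [simp]: "(\<lambda>i. Rep_sring (a i)) \<in> Dk n K \<longleftrightarrow> supp n K a"
  by (auto simp: Dk_def supp_def Rep_simps Rep_sring_inject)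

lemma Dk_obtain:
  assumes "b \<in> Dk n K" obtains a where "b = (\<lambda>i. Rep_sring (a i))" "supp n K a"
proof -
  have "b = (\<lambda>i. Rep_sring (Abs_sring (b i)))"
    using assms by (auto simp: Dk_def Abs_sring_inverse)
  then show ?thesis using that[of "\<lambda>i. Abs_sring (b i)"] assms Dk_Rep by metis
qed

lemma Sk_eq_Dk: "Sk n K = Dk n K"
  by (simp add: Sk_def Dk_def)

lemma op_represents_iff:
  "op_represents n K (\<lambda>i. Rep_sring (b i)) T \<longleftrightarrow>
    (\<forall>fs. good n fs \<longrightarrow> Rep_sring (opm n K b (\<lambda>p. Abs_sring (fs ! p))) = T fs)"
  by (auto simp: op_represents_def good_def Rep_opmap)

text \<open>Equivariance speaks of any coefficients representing the Lie derivative. This lemma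
  identifies them with the ones computed by \<open>La\<close>.\<close>

lemma op_represents_unique:
  assumes "supp n K b" "supp n K b'"
    "op_represents n K (\<lambda>i. Rep_sring (b i)) T" "op_represents n K (\<lambda>i. Rep_sring (b' i)) T"
  shows "b = b'"
proof
  fix j
  show "b j = b' j"
  proof (cases "j \<in> mi n K")
    case True
    have "opm n K (\<lambda>i. b i - b' i) (\<lambda>p. smon xx (j ! p)) = 0" for j
    proof -
      let ?fs = "map (\<lambda>p. Rep_sring (smon xx (j ! p))) [0..<n]"
      have "good n ?fs"
        by (auto simp: good_def homog_Rep eps_smon minus_one_power_iff)
      then have "Rep_sring (opm n K b (\<lambda>p. Abs_sring (?fs ! p))) = Rep_sring (opm n K b' (\<lambda>p. Abs_sring (?fs ! p)))"
        using assms(3,4) unfolding op_represents_iff by metis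
      moreover have "opm n K b (\<lambda>p. Abs_sring (?fs ! p)) = opm n K b (\<lambda>p. smon xx (j ! p))" for b
        by (rule opm_cong) (simp add: Rep_sring_inverse)
      ultimately show ?thesis by (simp add: opm_diff_coeff Rep_sring_inject)
    qed
    then have "b j - b' j = 0" using opm_inj[of n K "\<lambda>i. b i - b' i" j] True by blast
    then show ?thesis by simp
  qed (use assms in \<open>auto simp: supp_def\<close>)
qed

subsection \<open>Lie derivatives of operators along the generators\<close>

text \<open>The factor 2 matches the normalization of the generators: the field of \<theta> is D/2
  with square (1/4) d/dx, and four times this is the field of 1.\<close>

definition anti :: "(sring \<Rightarrow> sring) \<Rightarrow> (sring \<Rightarrow> sring) \<Rightarrow> sring \<Rightarrow> sring" where
  "anti A B G = cst 2 * (A (B G) + B (A G))"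

definition antiLa where
  "antiLa h c h' c' lam \<delta> a = (\<lambda>i. cst 2 * (La h c lam \<delta> (La h' c' lam \<delta> a) i + La h' c' lam \<delta> (La h c lam \<delta> a) i))"

lemma Lo_th: "Lo 0 1 l G = cst (1/2) * dd G"
  and Lo_xth: "Lo 1 0 l G = cst (1/2) * (xx * dd G) + cst l * (th * G)"
  by (simp_all add: Lo_def mult.assoc)

lemma lden_th: "lden l th G = Lo 0 1 l G"
  unfolding Lo_th lden_def by (rule sring_eqI) simp_all

lemma lden_xth: "lden l (xx * th) G = Lo 1 0 l G"
  unfolding Lo_xth lden_def by (rule sring_eqI) (simp_all add: dd_mult)

lemma lden_even:
  "lden l 1 G = anti (Lo 0 1 l) (Lo 0 1 l) G"
  "lden l xx G = anti (Lo 0 1 l) (Lo 1 0 l) G"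
  "lden l (xx * xx) G = anti (Lo 1 0 l) (Lo 1 0 l) G"
  unfolding anti_def Lo_th Lo_xth lden_def dd_simps dd_cmult dd_mult eps_simps
  by (rule sring_eqI; simp add: algebra_simps)+

lemma opm_upd_cmult:
  "p < n \<Longrightarrow> opm n K a (f(p := cst c * u)) = cst c * opm n K a (f(p := u))"
proof -
  assume "p < n"
  moreover have "(eps ^^ e) (cst c * u) = cst c * (eps ^^ e) u" for e
    by (simp add: eps_funpow)
  ultimately show ?thesis
    by (simp add: opm_def tens_upd db_pow_cmult sum_distrib_left ac_simps)
qed

lemma supp_La: "supp (length lam) K a \<Longrightarrow> supp (length lam) K (La h c lam \<delta> a)"
  using La_supported[of lam K a] by (auto simp: supp_def)

lemma La_represents:
  assumes a: "supp (length lam) K a" and F: "eps F = - F" "F \<noteq> 0" "\<And>l G. lden l F G = Lo h c l G"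
  shows "op_represents (length lam) K (\<lambda>i. Rep_sring (La h c lam (mu - sum_list lam) a i))
    (Lop lam mu K (Rep_sring F) (\<lambda>i. Rep_sring (a i)))"
proof -
  have "lden l F = Lo h c l" for l
    using F by (simp add: fun_eq_iff)
  then show ?thesis
    using a by (simp add: op_represents_iff Rep_Lop_odd F(1,2) supp_def opm_twisted_commutator[symmetric])
qed

lemma antiLa_represents:
  assumes a: "supp (length lam) K a" and F: "eps F = F" "\<And>l G. lden l F G = anti (Lo h c l) (Lo h' c' l) G"
  shows "op_represents (length lam) K (\<lambda>i. Rep_sring (antiLa h c h' c' lam (mu - sum_list lam) a i))
    (Lop lam mu K (Rep_sring F) (\<lambda>i. Rep_sring (a i)))"
  using a unfolding op_represents_iff antiLa_def opm_cmult_coeff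
  by (simp add: Rep_Lop_even F supp_def opm_anticommutator anti_def opm_upd_cmult right_diff_distrib sum_distrib_left)

lemma supp_antiLa: "supp (length lam) K a \<Longrightarrow> supp (length lam) K (antiLa h c h' c' lam \<delta> a)"
  using supp_La[OF supp_La] by (simp add: supp_def antiLa_def)

lemma osp_gens_represented:
  assumes "F \<in> osp_gens"
  obtains (odd) h c where "\<And>l G. Lden l F (Rep_sring G) = Rep_sring (Lo h c l G)"
     "\<And>lam mu K a. supp (length lam) K a \<Longrightarrow>
       op_represents (length lam) K (\<lambda>i. Rep_sring (La h c lam (mu - sum_list lam) a i)) (Lop lam mu K F (\<lambda>i. Rep_sring (a i)))"
  | (even) h c h' c' where "\<And>l G. Lden l F (Rep_sring G) = Rep_sring (anti (Lo h c l) (Lo h' c' l) G)"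
     "\<And>lam mu K a. supp (length lam) K a \<Longrightarrow>
       op_represents (length lam) K (\<lambda>i. Rep_sring (antiLa h c h' c' lam (mu - sum_list lam) a i)) (Lop lam mu K F (\<lambda>i. Rep_sring (a i)))"
proof -
  consider "F = Rep_sring 1" | "F = Rep_sring xx" | "F = Rep_sring (xx * xx)" | "F = Rep_sring th" | "F = Rep_sring (xx * th)"
    using assms by (auto simp: osp_gens_eq)
  then show thesis
  proof cases
    case 1
    show ?thesis by (rule even[of 0 1 0 1]) (auto simp: 1 Rep_lden lden_even intro!: antiLa_represents)
  next
    case 2
    show ?thesis by (rule even[of 0 1 1 0]) (auto simp: 2 Rep_lden lden_even intro!: antiLa_represents)
  next
    case 3
    show ?thesis by (rule even[of 1 0 1 0]) (auto simp: 3 Rep_lden lden_even intro!: antiLa_represents)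
  next
    case 4
    show ?thesis by (rule odd[of 0 1]) (auto simp: 4 Rep_lden lden_th th_nonzero intro!: La_represents)
  next
    case 5
    show ?thesis by (rule odd[of 1 0]) (auto simp: 5 Rep_lden lden_xth th_nonzero intro!: La_represents)
  qed
qed

subsection \<open>Equivariance of the symbol map\<close>

definition sig :: "nat \<Rightarrow> nat \<Rightarrow> (nat list \<Rightarrow> nat list \<Rightarrow> complex) \<Rightarrow> (nat list \<Rightarrow> sring) \<Rightarrow> nat list \<Rightarrow> sring" where
  "sig n K w a i = (if i \<in> mi n K then
     \<Sum>s\<in>{s \<in> mi n K. sum_list i \<le> sum_list s}. cst (w s i) * (dd ^^ (sum_list s - sum_list i)) (a s) else 0)"

lemma sigma_w_Rep: "sigma_w n K w (\<lambda>i. Rep_sring (a i)) = (\<lambda>i. Rep_sring (sig n K w a i))"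
  by (simp add: sigma_w_def sig_def fun_eq_iff Rep_dd_pow Rep_scale Rep_sum Rep_simps)

lemma dd_pow_add [simp]: "(dd ^^ i) (F + G) = (dd ^^ i) F + (dd ^^ i) G"
  by (induction i) auto

lemma dd_pow_zero [simp]: "(dd ^^ i) 0 = 0"
  by (induction i) auto

lemma dd_pow_sum: "(dd ^^ i) (sum f A) = (\<Sum>x\<in>A. (dd ^^ i) (f x))"
  by (induction A rule: infinite_finite_induct) simp_all

lemma dd_pow_cmult: "(dd ^^ i) (cst c * F) = cst c * (dd ^^ i) F"
  by (induction i) auto

lemma dd_pow_eps: "(dd ^^ i) (eps F) = cst ((-1) ^ i) * eps ((dd ^^ i) F)"
  by (induction i) (auto simp: dd_eps cst_minus)

lemma sig_add: "sig n K w (\<lambda>i. a i + b i) i = sig n K w a i + sig n K w b i"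
  by (simp add: sig_def distrib_left sum.distrib)

lemma sig_cmult: "sig n K w (\<lambda>i. cst c * a i) i = cst c * sig n K w a i"
  by (simp add: sig_def dd_pow_cmult sum_distrib_left mult.left_commute)

text \<open>The case distinction on a zero entry is absorbed by \<open>kap 0 = 0\<close>, so the
  truncated index \<open>s ! p - 1\<close> may be used throughout.\<close>

lemma induction_formulaD:
  assumes w: "induction_formula lam \<delta> K w" and i: "i \<in> mi (length lam) K" and s: "s \<in> mi (length lam) K"
    and less: "sum_list i < sum_list s"
  shows "(-1) ^ (sum_list s - sum_list i) * kap (sum_list s - sum_list i) (\<delta> - of_nat (sum_list s) / 2) * w s i =
    (\<Sum>p<length lam. (-1) ^ (\<Sum>r<p. s ! r) * kap (s ! p) (lam ! p) * w (s[p := s ! p - 1]) i)"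
proof -
  have "(\<Sum>p<length lam. (-1) ^ (\<Sum>r<p. s ! r) * (of_nat ((s ! p) div 2) + (1 - (-1) ^ (s ! p)) * lam ! p) *
        (if s ! p = 0 then 0 else w (s[p := s ! p - 1]) i)) =
      (\<Sum>p<length lam. (-1) ^ (\<Sum>r<p. s ! r) * kap (s ! p) (lam ! p) * w (s[p := s ! p - 1]) i)"
    by (rule sum.cong) (auto simp: kap_def)
  then show ?thesis
    using w i s less by (simp add: induction_formula_def Let_def kap_def)
qed

text \<open>The obstruction to equivariance is a combination of the terms \<open>eps\<close> of
  D^(d-1)(a_s), with d = |s| - |i|. Such a term comes once from commuting D^d past the density
  action and once, for each p, from an index raised by \<open>La\<close>. The induction formula at
  (s, i) says that its total coefficient vanishes.\<close>

lemma sig_La: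
  assumes w: "induction_formula lam \<delta> K w" and a: "supp (length lam) K a"
  shows "sig (length lam) K w (La h c lam \<delta> a) i =
    Lo h c (\<delta> - of_nat (sum_list i) / 2) (sig (length lam) K w a i)"
proof (cases "i \<in> mi (length lam) K")
  case False
  then show ?thesis by (simp add: sig_def)
next
  case True
  let ?n = "length lam" let ?I = "mi ?n K"
  let ?S = "{s \<in> ?I. sum_list i \<le> sum_list s}"
  let ?d = "\<lambda>s. sum_list s - sum_list i"
  let ?E = "\<lambda>s. eps ((dd ^^ (?d s - 1)) (a s))"
  let ?sg = "\<lambda>p s. (-1) ^ (\<Sum>r<p. s ! r) :: complex"
  \<comment> \<open>The terms in which \<open>La\<close> raises an index, listed by the raised
    multi-index s. One D fewer than \<open>?d s\<close> has passed \<open>eps\<close>, hence the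
    sign. The guard excludes |s| = |i|, which is not reached by raising an index of order at least
    |i|.\<close>
  define F where "F p s = (if sum_list i < sum_list s then
    cst (w (s[p := s ! p - 1]) i * (- ((-1) ^ ?d s)) * (?sg p s * kap (s ! p) (lam ! p))) * ?E s else 0)" for p s
  have up: "sum_list (s[p := Suc (s ! p)]) = Suc (sum_list s)" if "length s = ?n" "p < ?n" for s p
    using that by (simp add: sum_list_update)
  have 1: "cst (w s i) * (dd ^^ ?d s) (La h c lam \<delta> a s) =
      Lo h c (\<delta> - of_nat (sum_list i) / 2) (cst (w s i) * (dd ^^ ?d s) (a s))
      + cst (h/2) * (cst (w s i * kap (?d s) (\<delta> - of_nat (sum_list s) / 2)) * ?E s)
      + cst (h/2) * (\<Sum>p<?n. F p (s[p := Suc (s ! p)]))" if s: "s \<in> ?S" for s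
  proof -
    have wt: "\<delta> - of_nat (sum_list s) / 2 + of_nat (?d s) / 2 = \<delta> - of_nat (sum_list i) / 2"
      using s by (simp add: of_nat_diff field_simps)
    have "F p (s[p := Suc (s ! p)]) = cst (w s i) * (cst (?sg p s * kap (Suc (s ! p)) (lam ! p)) *
        (cst ((-1) ^ ?d s) * eps ((dd ^^ ?d s) (a (s[p := Suc (s ! p)])))))" if "p < ?n" for p
    proof -
      have "length s = ?n" using s by (simp add: mi_def)
      then show ?thesis
        using s that by (simp add: F_def up Suc_diff_le cst_mult cst_minus ac_simps)
    qed
    then have "cst (w s i) * (dd ^^ ?d s) (cst (h / 2) * (\<Sum>p<?n. cst (?sg p s * kap (Suc (s ! p)) (lam ! p)) *
        eps (a (s[p := Suc (s ! p)])))) = cst (h/2) * (\<Sum>p<?n. F p (s[p := Suc (s ! p)]))"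
      by (simp add: dd_pow_cmult dd_pow_sum dd_pow_eps sum_distrib_left mult.left_commute[of "cst (w s i)"])
    moreover have "cst (h * kap (?d s) (\<delta> - of_nat (sum_list s) / 2) / 2) = cst (h/2) * cst (kap (?d s) (\<delta> - of_nat (sum_list s) / 2))"
      by (simp flip: cst_mult)
    ultimately show ?thesis
      unfolding La_def dd_pow_add dd_pow_Lo wt by (simp add: cst_mult distrib_left ac_simps)
  qed
  have 2: "(\<Sum>s\<in>?S. F p (s[p := Suc (s ! p)])) = (\<Sum>s\<in>?I. F p s)" if p: "p < ?n" for p
  proof -
    have "(\<Sum>s\<in>?S. F p (s[p := Suc (s ! p)])) = (\<Sum>s\<in>?I. F p (s[p := Suc (s ! p)]))"
    proof (intro sum.mono_neutral_left ballI)
      fix s assume s: "s \<in> ?I - ?S"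
      then have "length s = ?n" by (simp add: mi_def)
      then show "F p (s[p := Suc (s ! p)]) = 0" using s p by (auto simp: F_def up)
    qed auto
    also have "\<dots> = (\<Sum>s\<in>?I. F p s)"
      using a p by (intro sum_mi_shift[symmetric]) (auto simp: F_def supp_def)
    finally show ?thesis .
  qed
  \<comment> \<open>Above order |i| this is the induction formula; at order |i| both contributions
    are zero.\<close>
  have 3: "cst (w s i * kap (?d s) (\<delta> - of_nat (sum_list s) / 2)) * ?E s + (\<Sum>p<?n. F p s) = 0"
    if s: "s \<in> ?S" for s
  proof (cases "sum_list i < sum_list s")
    case True
    have "(\<Sum>p<?n. F p s) = cst (- ((-1) ^ ?d s) * (\<Sum>p<?n. ?sg p s * kap (s ! p) (lam ! p) * w (s[p := s ! p - 1]) i)) * ?E s"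
    proof -
      have "(\<Sum>p<?n. F p s) = cst (\<Sum>p<?n. w (s[p := s ! p - 1]) i * (- ((-1) ^ ?d s)) * (?sg p s * kap (s ! p) (lam ! p))) * ?E s"
        using True by (simp add: F_def cst_sum sum_distrib_right)
      also have "(\<Sum>p<?n. w (s[p := s ! p - 1]) i * (- ((-1) ^ ?d s)) * (?sg p s * kap (s ! p) (lam ! p)))
         = - ((-1) ^ ?d s) * (\<Sum>p<?n. ?sg p s * kap (s ! p) (lam ! p) * w (s[p := s ! p - 1]) i)"
        unfolding sum_distrib_left by (intro sum.cong) simp_all
      finally show ?thesis .
    qed
    also have "(\<Sum>p<?n. ?sg p s * kap (s ! p) (lam ! p) * w (s[p := s ! p - 1]) i)
      = (-1) ^ ?d s * kap (?d s) (\<delta> - of_nat (sum_list s) / 2) * w s i"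
      using induction_formulaD[OF w \<open>i \<in> ?I\<close> _ True] s by simp
    also have "- ((-1) ^ ?d s) * \<dots> = - (w s i * kap (?d s) (\<delta> - of_nat (sum_list s) / 2))"
      by (cases "even (?d s)") auto
    finally show ?thesis by (simp add: cst_minus)
  next
    case False
    then have "?d s = 0" using s by simp
    then show ?thesis using False by (simp add: F_def)
  qed
  have 4: "(\<Sum>s\<in>?I. F p s) = (\<Sum>s\<in>?S. F p s)" for p
    by (intro sum.mono_neutral_right) (auto simp: F_def)
  have "sig ?n K w (La h c lam \<delta> a) i = (\<Sum>s\<in>?S. cst (w s i) * (dd ^^ ?d s) (La h c lam \<delta> a s))"
    using \<open>i \<in> ?I\<close> by (simp add: sig_def)
  also have "\<dots> = (\<Sum>s\<in>?S. Lo h c (\<delta> - of_nat (sum_list i) / 2) (cst (w s i) * (dd ^^ ?d s) (a s)))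
      + cst (h/2) * ((\<Sum>s\<in>?S. cst (w s i * kap (?d s) (\<delta> - of_nat (sum_list s) / 2)) * ?E s)
      + (\<Sum>s\<in>?S. \<Sum>p<?n. F p (s[p := Suc (s ! p)])))"
    by (subst sum.cong[OF refl 1]) (simp_all only: sum.distrib sum_distrib_left distrib_left add.assoc)
  also have "(\<Sum>s\<in>?S. \<Sum>p<?n. F p (s[p := Suc (s ! p)])) = (\<Sum>s\<in>?S. \<Sum>p<?n. F p s)"
  proof -
    have "(\<Sum>s\<in>?S. \<Sum>p<?n. F p (s[p := Suc (s ! p)])) = (\<Sum>p<?n. \<Sum>s\<in>?S. F p (s[p := Suc (s ! p)]))"
      by (rule sum.swap)
    also have "\<dots> = (\<Sum>p<?n. \<Sum>s\<in>?S. F p s)"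
      by (rule sum.cong[OF refl]) (use 2 4 in auto)
    also have "\<dots> = (\<Sum>s\<in>?S. \<Sum>p<?n. F p s)"
      by (rule sum.swap)
    finally show ?thesis .
  qed
  also have "(\<Sum>s\<in>?S. cst (w s i * kap (?d s) (\<delta> - of_nat (sum_list s) / 2)) * ?E s) + \<dots> = 0"
    unfolding sum.distrib[symmetric] using 3 by (intro sum.neutral) blast
  finally show ?thesis
    using \<open>i \<in> ?I\<close> by (simp add: sig_def Lo_sum)
qed

lemma supp_sig: "supp n K (sig n K w a)"
  by (simp add: supp_def sig_def)

lemma sigma_w_equivariant:
  assumes w: "induction_formula lam (mu - sum_list lam) K w"
  shows "osp_equivariant lam mu K (sigma_w (length lam) K w)"
  unfolding osp_equivariant_def
proof (intro ballI)
  let ?n = "length lam" let ?\<delta> = "mu - sum_list lam"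
  fix F a assume F: "F \<in> osp_gens" and "a \<in> Dk ?n K"
  then obtain a' where a: "a = (\<lambda>i. Rep_sring (a' i))" "supp ?n K a'"
    using Dk_obtain by blast
  have "\<exists>b. supp ?n K b \<and> op_represents ?n K (\<lambda>i. Rep_sring (b i)) (Lop lam mu K F a) \<and>
     (\<forall>i. Rep_sring (sig ?n K w b i) = Lden (?\<delta> - of_nat (sum_list i) / 2) F (Rep_sring (sig ?n K w a' i)))"
    using F
  proof (cases rule: osp_gens_represented)
    case (odd h c)
    then show ?thesis
      using a by (intro exI[of _ "La h c lam ?\<delta> a'"]) (simp add: supp_La sig_La[OF w])
  next
    case (even h c h' c')
    have "sig ?n K w (antiLa h c h' c' lam ?\<delta> a') i =
       anti (Lo h c (?\<delta> - of_nat (sum_list i) / 2)) (Lo h' c' (?\<delta> - of_nat (sum_list i) / 2)) (sig ?n K w a' i)" for i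
      unfolding antiLa_def sig_cmult sig_add using a by (simp add: supp_La sig_La[OF w] anti_def)
    then show ?thesis
      using a even by (intro exI[of _ "antiLa h c h' c' lam ?\<delta> a'"]) (simp add: supp_antiLa)
  qed
  then obtain b where b: "supp ?n K b" "op_represents ?n K (\<lambda>i. Rep_sring (b i)) (Lop lam mu K F a)"
     "\<And>i. Rep_sring (sig ?n K w b i) = Lden (?\<delta> - of_nat (sum_list i) / 2) F (Rep_sring (sig ?n K w a' i))"
    by blast
  have "sigma_w ?n K w b' = LS ?\<delta> F (sigma_w ?n K w a)"
    if b': "b' \<in> Dk ?n K" "op_represents ?n K b' (Lop lam mu K F a)" for b'
  proof -
    obtain b'' where b'': "b' = (\<lambda>i. Rep_sring (b'' i))" "supp ?n K b''"
      using b' Dk_obtain by blast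
    then have "b'' = b" using op_represents_unique[OF b''(2) b(1)] b' b(2) by simp
    then show ?thesis
      unfolding a(1) b''(1) sigma_w_Rep by (simp add: LS_def b(3))
  qed
  then show "(\<exists>b\<in>Dk ?n K. op_represents ?n K b (Lop lam mu K F a)) \<and>
        (\<forall>b\<in>Dk ?n K. op_represents ?n K b (Lop lam mu K F a) \<longrightarrow>
            sigma_w ?n K w b = LS ?\<delta> F (sigma_w ?n K w a))"
    using b Dk_Rep[of b] by blast
qed

subsection \<open>Bijectivity of the symbol map\<close>

lemma lvl_subset_mi: "p \<le> K \<Longrightarrow> lvl n p \<subseteq> mi n K"
  by (auto simp: lvl_def mi_def)

lemma finite_lvl [simp]: "finite (lvl n p)"
  using finite_subset[OF lvl_subset_mi[OF order.refl]] by simp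

text \<open>The symbol map is block triangular by order: a component of order |i| sees only
  coefficients of order at least |i|, and those of equal order enter without derivatives. Inverting
  the diagonal blocks is then enough for bijectivity.\<close>

lemma sig_top:
  assumes "p \<le> K" and 0: "\<forall>s\<in>mi n K. p < sum_list s \<longrightarrow> a s = 0"
  shows "i \<in> mi n K \<Longrightarrow> p < sum_list i \<Longrightarrow> sig n K w a i = 0"
    and "i \<in> lvl n p \<Longrightarrow> sig n K w a i = (\<Sum>s\<in>lvl n p. cst (w s i) * a s)"
proof -
  assume "i \<in> mi n K" "p < sum_list i"
  then show "sig n K w a i = 0" using 0 by (auto simp: sig_def intro!: sum.neutral)
next
  assume i: "i \<in> lvl n p"
  then have "sig n K w a i = (\<Sum>s\<in>{s \<in> mi n K. p \<le> sum_list s}. cst (w s i) * (dd ^^ (sum_list s - p)) (a s))"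
    using lvl_subset_mi[OF assms(1), of n] by (auto simp: sig_def lvl_def)
  also have "\<dots> = (\<Sum>s\<in>lvl n p. cst (w s i) * (dd ^^ (sum_list s - p)) (a s))"
  proof (intro sum.mono_neutral_right ballI)
    show "lvl n p \<subseteq> {s \<in> mi n K. p \<le> sum_list s}"
      using lvl_subset_mi[OF assms(1), of n] by (auto simp: lvl_def)
    fix s assume s: "s \<in> {s \<in> mi n K. p \<le> sum_list s} - lvl n p"
    then have "s \<in> mi n K" "p < sum_list s" by (auto simp: lvl_def mi_def)
    then show "cst (w s i) * (dd ^^ (sum_list s - p)) (a s) = 0" using 0 by simp
  qed simp
  also have "\<dots> = (\<Sum>s\<in>lvl n p. cst (w s i) * a s)"
    by (rule sum.cong) (auto simp: lvl_def)
  finally show "sig n K w a i = (\<Sum>s\<in>lvl n p. cst (w s i) * a s)" .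
qed

lemma diag_nonsingularE:
  assumes "diag_nonsingular n K w" "p \<le> K"
  obtains v where
    "\<And>i i'. i \<in> lvl n p \<Longrightarrow> i' \<in> lvl n p \<Longrightarrow> (\<Sum>s\<in>lvl n p. w s i * v s i') = (if i = i' then 1 else 0)"
    "\<And>s s'. s \<in> lvl n p \<Longrightarrow> s' \<in> lvl n p \<Longrightarrow> (\<Sum>i\<in>lvl n p. v s i * w s' i) = (if s = s' then 1 else 0)"
proof -
  from assms obtain v where
    "\<forall>i\<in>lvl n p. \<forall>i'\<in>lvl n p. (\<Sum>s\<in>lvl n p. w s i * v s i') = (if i = i' then 1 else 0)"
    "\<forall>s\<in>lvl n p. \<forall>s'\<in>lvl n p. (\<Sum>i\<in>lvl n p. v s i * w s' i) = (if s = s' then 1 else 0)"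
    unfolding diag_nonsingular_def by (elim allE[of _ p]) (simp, elim exE conjE, blast)
  then show thesis by (intro that[of v]) simp_all
qed

lemma sum_cst_delta:
  assumes "finite A" "x \<in> A" "\<And>y. y \<in> A \<Longrightarrow> c y = (if x = y then 1 else 0)"
  shows "(\<Sum>y\<in>A. cst (c y) * g y) = g x"
proof -
  have "(\<Sum>y\<in>A. cst (c y) * g y) = (\<Sum>y\<in>A. if x = y then g y else 0)"
    by (rule sum.cong) (auto simp: assms(3))
  then show ?thesis using assms by simp
qed

lemma sig_eq_0_imp:
  assumes w: "diag_nonsingular n K w" and a: "\<And>i. i \<in> mi n K \<Longrightarrow> sig n K w a i = 0" and "s \<in> mi n K"
  shows "a s = 0"
  using assms(3)
proof (induction "K - sum_list s" arbitrary: s rule: less_induct)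
  case less
  define p where "p = sum_list s"
  have p: "p \<le> K" "s \<in> lvl n p" using less.prems by (auto simp: p_def mi_def lvl_def)
  obtain v where v: "\<And>s s'. s \<in> lvl n p \<Longrightarrow> s' \<in> lvl n p \<Longrightarrow> (\<Sum>i\<in>lvl n p. v s i * w s' i) = (if s = s' then 1 else 0)"
    using diag_nonsingularE[OF w p(1)] by metis
  have higher: "\<forall>s'\<in>mi n K. p < sum_list s' \<longrightarrow> a s' = 0"
    by (intro ballI impI less.hyps) (auto simp: p_def mi_def)
  have 0: "(\<Sum>s'\<in>lvl n p. cst (w s' i) * a s') = 0" if "i \<in> lvl n p" for i
    using sig_top(2)[OF p(1) higher that] a lvl_subset_mi[OF p(1)] that by (metis (no_types, lifting) subsetD)
  have "0 = (\<Sum>i\<in>lvl n p. cst (v s i) * (\<Sum>s'\<in>lvl n p. cst (w s' i) * a s'))"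
    using 0 by simp
  also have "\<dots> = (\<Sum>s'\<in>lvl n p. cst (\<Sum>i\<in>lvl n p. v s i * w s' i) * a s')"
    unfolding sum_distrib_left cst_sum sum_distrib_right cst_mult mult.assoc by (rule sum.swap)
  also have "\<dots> = a s"
    using v p(2) by (intro sum_cst_delta) auto
  finally show ?case by simp
qed

lemma sig_surj:
  assumes w: "diag_nonsingular n K w" and b: "supp n K b"
  shows "\<exists>a. supp n K a \<and> sig n K w a = b"
proof -
  \<comment> \<open>Back substitution from the top: m is the number of orders, counted down from K,
    at which the equation already holds.\<close>
  have "\<exists>a. supp n K a \<and> (\<forall>i\<in>mi n K. K < sum_list i + m \<longrightarrow> sig n K w a i = b i)" for m
  proof (induction m)
    case 0
    show ?case by (intro exI[of _ "\<lambda>_. 0"]) (auto simp: supp_def mi_def)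
  next
    case (Suc m)
    then obtain a where a: "supp n K a" "\<And>i. i \<in> mi n K \<Longrightarrow> K < sum_list i + m \<Longrightarrow> sig n K w a i = b i"
      by blast
    show ?case
    proof (cases "m \<le> K")
      case False
      then show ?thesis using a by (intro exI[of _ a]) auto
    next
      case True
      define p where "p = K - m"
      have p: "p \<le> K" by (simp add: p_def)
      obtain v where v: "\<And>i i'. i \<in> lvl n p \<Longrightarrow> i' \<in> lvl n p \<Longrightarrow> (\<Sum>s\<in>lvl n p. w s i * v s i') = (if i = i' then 1 else 0)"
        using diag_nonsingularE[OF w p] by metis
      \<comment> \<open>The defect at order p, transformed by the inverse block. By triangularity
        adding e leaves all higher orders untouched.\<close>
      define e where "e s = (if s \<in> lvl n p then \<Sum>i\<in>lvl n p. cst (v s i) * (b i - sig n K w a i) else 0)" for s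
      have e0: "\<forall>s\<in>mi n K. p < sum_list s \<longrightarrow> e s = 0"
        by (simp add: e_def lvl_def)
      have "sig n K w e i = b i - sig n K w a i" if i: "i \<in> lvl n p" for i
      proof -
        have "sig n K w e i = (\<Sum>s\<in>lvl n p. cst (w s i) * (\<Sum>i'\<in>lvl n p. cst (v s i') * (b i' - sig n K w a i')))"
          unfolding sig_top(2)[OF p e0 i] by (intro sum.cong) (simp_all add: e_def)
        also have "\<dots> = (\<Sum>i'\<in>lvl n p. cst (\<Sum>s\<in>lvl n p. w s i * v s i') * (b i' - sig n K w a i'))"
          unfolding sum_distrib_left cst_sum sum_distrib_right cst_mult mult.assoc by (rule sum.swap)
        also have "\<dots> = b i - sig n K w a i"
          using v i by (intro sum_cst_delta) auto
        finally show ?thesis .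
      qed
      note level = this
      have "sig n K w a i + sig n K w e i = b i" if "i \<in> mi n K" "K < sum_list i + Suc m" for i
      proof (cases "sum_list i = p")
        case True
        then have "i \<in> lvl n p" using that(1) by (simp add: lvl_def mi_def)
        then show ?thesis by (simp add: level)
      next
        case False
        then have "p < sum_list i" "K < sum_list i + m" using that \<open>m \<le> K\<close> by (auto simp: p_def)
        then show ?thesis using sig_top(1)[OF p e0 that(1)] a(2)[OF that(1)] by simp
      qed
      moreover have "supp n K (\<lambda>i. a i + e i)"
        using a(1) lvl_subset_mi[OF p, of n] by (auto simp: supp_def e_def)
      ultimately show ?thesis
        by (intro exI[of _ "\<lambda>i. a i + e i"]) (simp add: sig_add)
    qed
  qed
  from this[of "Suc K"] obtain a where a: "supp n K a" "\<forall>i\<in>mi n K. sig n K w a i = b i" by auto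
  have "sig n K w a i = b i" for i
    using a b by (cases "i \<in> mi n K") (auto simp: supp_def sig_def)
  then show ?thesis using a by blast
qed

lemma fadd_Rep: "fadd (\<lambda>i. Rep_sring (a i)) (\<lambda>i. Rep_sring (b i)) = (\<lambda>i. Rep_sring (a i + b i))"
  by (simp add: fadd_def Rep_simps)

lemma fscale_Rep: "fscale c (\<lambda>i. Rep_sring (a i)) = (\<lambda>i. Rep_sring (cst c * a i))"
  by (simp add: fscale_def Rep_scale)

lemma sigma_w_symbol_map:
  assumes w: "diag_nonsingular n K w"
  shows "is_symbol_map n K w (sigma_w n K w)"
  unfolding is_symbol_map_def
proof (intro conjI ballI allI impI)
  fix a b assume "a \<in> Dk n K" "b \<in> Dk n K"
  then show "sigma_w n K w (fadd a b) = fadd (sigma_w n K w a) (sigma_w n K w b)"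
    by (elim Dk_obtain) (simp add: fadd_Rep sigma_w_Rep sig_add)
next
  fix c a assume "a \<in> Dk n K"
  then show "sigma_w n K w (fscale c a) = fscale c (sigma_w n K w a)"
    by (elim Dk_obtain) (simp add: fscale_Rep sigma_w_Rep sig_cmult)
next
  show "bij_betw (sigma_w n K w) (Dk n K) (Sk n K)"
  proof (rule bij_betw_imageI)
    show "inj_on (sigma_w n K w) (Dk n K)"
    proof (rule inj_onI)
      fix x y assume "x \<in> Dk n K" "y \<in> Dk n K" and eq: "sigma_w n K w x = sigma_w n K w y"
      then obtain a b where ab: "x = (\<lambda>i. Rep_sring (a i))" "supp n K a" "y = (\<lambda>i. Rep_sring (b i))" "supp n K b"
        using Dk_obtain by metis
      have "sig n K w a i = sig n K w b i" for i
        using eq unfolding ab(1,3) sigma_w_Rep by (metis Rep_sring_inject)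
      moreover have "sig n K w (\<lambda>i. a i + cst (-1) * b i) i = sig n K w a i - sig n K w b i" for i
        unfolding sig_add sig_cmult by (simp add: cst_minus)
      ultimately have "a s + cst (-1) * b s = 0" if "s \<in> mi n K" for s
        using sig_eq_0_imp[OF w _ that, of "\<lambda>i. a i + cst (-1) * b i"] by simp
      then have "a s = b s" for s
        using ab(2,4) by (cases "s \<in> mi n K") (auto simp: supp_def cst_minus)
      then show "x = y" by (simp add: ab)
    qed
    show "sigma_w n K w ` Dk n K = Sk n K"
    proof (intro equalityI subsetI)
      fix y assume "y \<in> sigma_w n K w ` Dk n K"
      then obtain x where "x \<in> Dk n K" "y = sigma_w n K w x" by blast
      moreover from this obtain a where "x = (\<lambda>i. Rep_sring (a i))" using Dk_obtain by blast
      ultimately have "y = sigma_w n K w (\<lambda>i. Rep_sring (a i))" by simp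
      then show "y \<in> Sk n K" by (simp add: sigma_w_Rep Sk_eq_Dk supp_sig)
    next
      fix y assume "y \<in> Sk n K"
      then obtain b where b: "y = (\<lambda>i. Rep_sring (b i))" "supp n K b"
        unfolding Sk_eq_Dk using Dk_obtain by blast
      then obtain a where "supp n K a" "sig n K w a = b" using sig_surj[OF w] by blast
      then show "y \<in> sigma_w n K w ` Dk n K"
        using b by (intro image_eqI[of _ _ "\<lambda>i. Rep_sring (a i)"]) (auto simp: sigma_w_Rep)
    qed
  qed
next
  fix p a i assume p: "p \<le> K" and "a \<in> Dk n K" and high: "\<forall>s. p < sum_list s \<longrightarrow> a s = szero"
  then obtain a' where a: "a = (\<lambda>i. Rep_sring (a' i))" "supp n K a'" using Dk_obtain by metis
  have 0: "\<forall>s\<in>mi n K. p < sum_list s \<longrightarrow> a' s = 0"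
    using high by (simp add: a Rep_simps Rep_sring_inject)
  show "sigma_w n K w a i = szero" if "i \<in> mi n K" "p < sum_list i"
    unfolding a(1) sigma_w_Rep using sig_top(1)[OF p 0 that] by (simp add: Rep_simps)
  show "sigma_w n K w a i = ssum (\<lambda>s. sscale (w s i) (a s)) (lvl n p)" if "i \<in> lvl n p"
    unfolding a(1) sigma_w_Rep using sig_top(2)[OF p 0 that] by (simp add: Rep_scale Rep_sum)
qed

subsection \<open>Existence of the constants\<close>

text \<open>For even l - p the factor is (l - p)/2 and free of \<delta>. For l - p = 2r + 1 it is 2
  \<delta> - (p + r + 1) with p + r + 1 between 1 and K, which is where the resonant values come
  from.\<close>

lemma kap_nonresonant:
  assumes nr: "\<forall>j\<in>{1..K}. \<delta> \<noteq> of_nat j / 2" and "p < l" "l \<le> K"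
  shows "kap (l - p) (\<delta> - of_nat l / 2) \<noteq> 0"
proof (cases "even (l - p)")
  case True
  then obtain r where r: "l - p = 2 * r" by (rule evenE)
  then have "r > 0" using assms(2) by simp
  then show ?thesis by (simp add: kap_def r)
next
  case False
  then obtain r where "l - p = 2 * r + 1" by (rule oddE)
  then have r: "l - p = Suc (2 * r)" by simp
  then have l: "l = p + Suc (2 * r)" using assms(2) by simp
  define x :: complex where "x = of_nat (p + r + 1) / 2"
  have "p + r + 1 \<in> {1..K}" using l assms(3) by auto
  then have "\<delta> \<noteq> x" using nr unfolding x_def by blast
  moreover have "kap (l - p) (\<delta> - of_nat l / 2) = 2 * (\<delta> - x)"
    unfolding r by (simp add: kap_def l x_def field_simps)
  ultimately show ?thesis by simp
qed

text \<open>Solves the induction formula for the constant at s by dividing by its coefficient, with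
  P as initial data once the order of s has come down to that of i. The guards on j make the order
  of s decrease in the recursive call.\<close>

function wsol :: "complex list \<Rightarrow> complex \<Rightarrow> (nat list \<Rightarrow> nat list \<Rightarrow> complex) \<Rightarrow> nat list \<Rightarrow> nat list \<Rightarrow> complex" where
  "wsol lam \<delta> P s i = (if sum_list s \<le> sum_list i then P s i else
     (\<Sum>j<length lam. if j < length s \<and> s ! j \<noteq> 0 then (-1) ^ (\<Sum>r<j. s ! r) * kap (s ! j) (lam ! j) *
         wsol lam \<delta> P (s[j := s ! j - 1]) i else 0)
     / ((-1) ^ (sum_list s - sum_list i) * kap (sum_list s - sum_list i) (\<delta> - of_nat (sum_list s) / 2)))"
  by auto
termination
proof (relation "Wellfounded.measure (\<lambda>(lam, \<delta>, P, s, i). sum_list s)", goal_cases)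
  case (2 lam \<delta> P s i j)
  then have "j < length s" "s ! j \<noteq> 0" by auto
  moreover from this have "s ! j \<le> sum_list s" by (meson elem_le_sum_list)
  ultimately show ?case by (simp add: sum_list_update)
qed simp

declare wsol.simps [simp del]

lemma wsol_induction_formula:
  assumes nr: "\<forall>j\<in>{1..K}. \<delta> \<noteq> of_nat j / 2"
  shows "induction_formula lam \<delta> K (wsol lam \<delta> P)"
  unfolding induction_formula_def Let_def kap_def[symmetric]
proof (intro ballI impI)
  fix i s assume i: "i \<in> mi (length lam) K" and s: "s \<in> mi (length lam) K" and l: "sum_list i < sum_list s"
  let ?c = "(-1) ^ (sum_list s - sum_list i) * kap (sum_list s - sum_list i) (\<delta> - of_nat (sum_list s) / 2)"
  have "?c \<noteq> 0"
    using kap_nonresonant[OF nr l] s by (simp add: mi_def)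
  moreover have "wsol lam \<delta> P s i = (\<Sum>j<length lam. (-1) ^ (\<Sum>r<j. s ! r) * kap (s ! j) (lam ! j) *
      (if s ! j = 0 then 0 else wsol lam \<delta> P (s[j := s ! j - 1]) i)) / ?c"
    by (subst wsol.simps) (use l s in \<open>auto simp: mi_def intro!: sum.cong\<close>)
  ultimately show "?c * wsol lam \<delta> P s i - (\<Sum>j<length lam. (-1) ^ (\<Sum>r<j. s ! r) * kap (s ! j) (lam ! j) *
      (if s ! j = 0 then 0 else wsol lam \<delta> P (s[j := s ! j - 1]) i)) = 0"
    by (simp only: times_divide_eq_right nonzero_mult_div_cancel_left) simp
qed

lemma wsol_top: "sum_list s \<le> sum_list i \<Longrightarrow> wsol lam \<delta> P s i = P s i"
  by (simp add: wsol.simps)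

subsection \<open>The explicit constants\<close>

lemma Xi_eq:
  assumes "i \<le> s"
  shows "Xi s i l = of_nat ((s div 2) choose (i div 2)) *
    ((2 * l + of_int ((int s - 1) div 2)) gchoose (if even i then (s - i + 1) div 2 else (s - i) div 2))"
proof -
  have d: "int s - int i = int (s - i)" using assms by simp
  have "nat ((2 * (int s - int i) + 1 + (-1) ^ i) div 4) = (if even i then (s - i + 1) div 2 else (s - i) div 2)"
    unfolding d by (auto simp: minus_one_power_iff)
  then show ?thesis by (simp add: Xi_def)
qed

lemma Xi_self [simp]: "Xi s s l = 1"
  by (simp add: Xi_eq)

text \<open>Raising s affects only one of the two binomials: for even s the generalized one, by
  absorption, and for odd s the ordinary one.\<close>

lemma Xi_rec:
  assumes "i \<le> s"
  shows "of_nat ((s - i + 2) div 2) * Xi (Suc s) i l = kap (Suc s) l * Xi s i l"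
proof -
  have choose: "of_nat (Suc v - b) * of_nat (Suc v choose b) = (of_nat (Suc v) * of_nat (v choose b) :: complex)"
    if "b \<le> v" for v b
  proof -
    have "(Suc v - b) * (Suc v choose b) = Suc v * (v choose b)"
      using binomial_absorb_comp[of "Suc v" b] by simp
    then show ?thesis by (metis of_nat_mult)
  qed
  show ?thesis
  proof (cases "even s")
    case True
    then obtain v where v: "s = 2 * v" by (rule evenE)
    define c where "c = (if even i then (s - i + 1) div 2 else (s - i) div 2)"
    have split: "(if even i then (Suc s - i + 1) div 2 else (Suc s - i) div 2) = Suc c \<and> (s - i + 2) div 2 = Suc c"
    proof (cases "even i")
      case True
      then obtain b where b: "i = 2 * b" by (rule evenE)
      then have "b \<le> v" using assms v by simp
      then obtain k where "v = b + k" unfolding le_iff_add by blast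
      then show ?thesis using b v by (simp add: c_def)
    next
      case False
      then obtain b where b: "i = 2 * b + 1" by (rule oddE)
      then have "Suc b \<le> v" using assms v by simp
      then obtain k where "v = Suc b + k" unfolding le_iff_add by blast
      then show ?thesis using b v by (simp add: c_def)
    qed
    have 1: "(if even i then (Suc s - i + 1) div 2 else (Suc s - i) div 2) = Suc c" "(s - i + 2) div 2 = Suc c"
      using split by auto
    have 2: "(int s - 1) div 2 = int v - 1" "(int (Suc s) - 1) div 2 = int v" "Suc s div 2 = v" "s div 2 = v"
      using v by auto
    have 3: "kap (Suc s) l = 2 * l + of_nat v" using v by (simp add: kap_def)
    have 4: "of_nat (Suc c) * ((2 * l + of_nat v) gchoose Suc c) = (2 * l + of_nat v) * ((2 * l + of_nat v - 1) gchoose c)"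
      by (rule gbinomial_absorption)
    have 5: "2 * l + of_int (int v - 1) = 2 * l + of_nat v - 1" by simp
    show ?thesis
      unfolding Xi_eq[OF assms] Xi_eq[OF le_SucI[OF assms]] 1 2 3 c_def[symmetric]
      unfolding 5 of_int_of_nat_eq mult.left_commute[of "of_nat (Suc c)"] 4 by (rule mult.left_commute)
  next
    case False
    then obtain v where "s = 2 * v + 1" by (rule oddE)
    then have v: "s = Suc (2 * v)" by simp
    define c where "c = (if even i then (s - i + 1) div 2 else (s - i) div 2)"
    have split: "(if even i then (Suc s - i + 1) div 2 else (Suc s - i) div 2) = c \<and> (s - i + 2) div 2 = Suc v - i div 2"
    proof (cases "even i")
      case True
      then obtain b where b: "i = 2 * b" by (rule evenE)
      then have "b \<le> v" using assms v by simp
      then obtain k where "v = b + k" unfolding le_iff_add by blast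
      then show ?thesis using b v by (simp add: c_def)
    next
      case False
      then obtain b where b: "i = 2 * b + 1" by (rule oddE)
      then have "b \<le> v" using assms v by simp
      then obtain k where "v = b + k" unfolding le_iff_add by blast
      then show ?thesis using b v by (simp add: c_def)
    qed
    have 1: "(if even i then (Suc s - i + 1) div 2 else (Suc s - i) div 2) = c" "(s - i + 2) div 2 = Suc v - i div 2"
      using split by auto
    have 2: "(int s - 1) div 2 = int v" "(int (Suc s) - 1) div 2 = int v" "Suc s div 2 = Suc v" "s div 2 = v"
      using v by auto
    have 3: "kap (Suc s) l = of_nat (Suc v)" using v by (simp add: kap_def)
    have "i div 2 \<le> v" using assms v by auto
    then show ?thesis
      unfolding Xi_eq[OF assms] Xi_eq[OF le_SucI[OF assms]] 1 2 3 c_def[symmetric]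
      by (simp only: choose mult.assoc[symmetric])
  qed
qed

text \<open>The weight of the one-variable path from i to s: one factor for each unit step, labelled
  by its end point.\<close>

definition kprod :: "nat \<Rightarrow> nat \<Rightarrow> complex \<Rightarrow> complex" where
  "kprod s i l = (\<Prod>u\<in>{i<..s}. kap u l)"

lemma kprod_self [simp]: "kprod s s l = 1"
  by (simp add: kprod_def)

lemma kprod_Suc: "i \<le> s \<Longrightarrow> kprod (Suc s) i l = kap (Suc s) l * kprod s i l"
proof -
  assume "i \<le> s"
  then have "{i<..Suc s} = insert (Suc s) {i<..s}" by auto
  then show ?thesis by (simp add: kprod_def)
qed

text \<open>The product of (e + 1) div 2 over e = 1, ..., d.\<close>

definition hfact :: "nat \<Rightarrow> complex" where
  "hfact d = fact (d div 2) * fact ((d + 1) div 2)"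

lemma hfact_0 [simp]: "hfact 0 = 1"
  by (simp add: hfact_def)

lemma hfact_nz [simp]: "hfact d \<noteq> 0"
  by (simp add: hfact_def)

lemma hfact_Suc: "hfact (Suc d) = of_nat ((d + 2) div 2) * hfact d"
proof -
  have "(Suc d + 1) div 2 = Suc (d div 2)" "(d + 2) div 2 = Suc (d div 2)" by simp_all
  then show ?thesis unfolding hfact_def by (simp add: fact_Suc del: of_nat_Suc)
qed

text \<open>Splits \<Xi> into a path weight and a denominator that depends on s - i only. The
  denominators of the different variables will be merged by the super binomials.\<close>

lemma Xi_eq_kprod: "i \<le> s \<Longrightarrow> Xi s i l = kprod s i l / hfact (s - i)"
proof (induction s rule: dec_induct)
  case (step t)
  have "of_nat ((t - i + 2) div 2) * Xi (Suc t) i l = kap (Suc t) l * Xi t i l"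
    by (rule Xi_rec[OF step.hyps(1)])
  then have "of_nat ((t - i + 2) div 2) * Xi (Suc t) i l = kprod (Suc t) i l / hfact (t - i)"
    by (simp only: step.IH kprod_Suc[OF step.hyps(1)] times_divide_eq_right)
  moreover have "of_nat ((t - i + 2) div 2) \<noteq> (0::complex)"
    by (simp del: of_nat_Suc)
  moreover have "hfact (Suc t - i) = of_nat ((t - i + 2) div 2) * hfact (t - i)"
    using step.hyps by (simp only: Suc_diff_le hfact_Suc)
  ultimately show ?case by (simp add: nonzero_eq_divide_eq mult.commute mult.left_commute)
qed simp

text \<open>The super binomial coefficient is the Gaussian binomial coefficient at q = -1;
  this is its Pascal rule.\<close>

lemma sbinom_Suc:
  "(of_nat (sbinom (Suc x) m) :: complex) =
    (-1) ^ m * of_nat (sbinom x m) + (if m = 0 then 0 else of_nat (sbinom x (m - 1)))"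
proof (cases "even x"; cases "even m")
  assume "odd x" "even m"
  then obtain a b where ab: "x = 2 * a + 1" "m = 2 * b" by (meson evenE oddE)
  show ?thesis
  proof (cases b)
    case (Suc c)
    then have "(m - 1) div 2 = c" using ab by simp
    then show ?thesis using ab Suc by (simp add: sbinom_def)
  qed (use ab in \<open>simp add: sbinom_def\<close>)
qed (auto simp: sbinom_def elim!: evenE oddE)

lemma sbinom_self [simp]: "sbinom m m = 1"
  by (simp add: sbinom_def)

text \<open>Where the super binomial is non-zero, the integer parts of the halves are additive, so
  the factorials of the two ordinary binomials regroup into \<open>hfact\<close>. In the remaining
  case m is odd, a + m is even, and both sides vanish.\<close>

lemma sbinom_hfact:
  "of_nat (sbinom (a + m) m) / (of_nat (((a + m) div 2) choose (m div 2)) *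
     of_nat (((a + m + 1) div 2) choose ((m + 1) div 2))) / hfact m
   = of_nat (sbinom (a + m) m) * hfact a / hfact (a + m)"
proof (cases "even m \<or> odd (a + m)")
  case True
  have "(a + m) div 2 - m div 2 = a div 2 \<and> (a + m + 1) div 2 - (m + 1) div 2 = (a + 1) div 2 \<or>
        (a + m) div 2 - m div 2 = (a + 1) div 2 \<and> (a + m + 1) div 2 - (m + 1) div 2 = a div 2"
  proof (cases "even m")
    case True
    then obtain b where "m = 2 * b" by (rule evenE)
    moreover have "(a + 2 * b) div 2 = a div 2 + b" "(a + 2 * b + 1) div 2 = (a + 1) div 2 + b" by auto
    ultimately show ?thesis by simp
  next
    case False
    then obtain b where "m = 2 * b + 1" by (rule oddE)
    moreover have "even a" using \<open>even m \<or> odd (a + m)\<close> False by simp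
    then obtain c where "a = 2 * c" by (rule evenE)
    ultimately show ?thesis by simp
  qed
  then have 1: "hfact a = fact ((a + m) div 2 - m div 2) * fact ((a + m + 1) div 2 - (m + 1) div 2)"
    unfolding hfact_def by auto
  have 2: "(of_nat (((a + m) div 2) choose (m div 2)) :: complex) =
      fact ((a + m) div 2) / (fact (m div 2) * fact ((a + m) div 2 - m div 2))"
    by (rule binomial_fact) (simp add: div_le_mono)
  have 3: "(of_nat (((a + m + 1) div 2) choose ((m + 1) div 2)) :: complex) =
      fact ((a + m + 1) div 2) / (fact ((m + 1) div 2) * fact ((a + m + 1) div 2 - (m + 1) div 2))"
    by (rule binomial_fact) (simp add: div_le_mono)
  show ?thesis unfolding 1 2 3 hfact_def[of m] hfact_def[of "a + m"] by simp
qed (simp add: sbinom_def)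

definition qmult :: "nat \<Rightarrow> (nat \<Rightarrow> nat) \<Rightarrow> (nat \<Rightarrow> nat) \<Rightarrow> complex" where
  "qmult n s i = (\<Prod>t<n. (-1) ^ ((\<Sum>j<t. s j) * (s t - i t)) *
     of_nat (sbinom (\<Sum>j\<le>t. s j - i j) (s t - i t)))"

lemma qmult_Suc:
  "qmult (Suc n) s i = qmult n s i * ((-1) ^ ((\<Sum>j<n. s j) * (s n - i n)) *
     of_nat (sbinom ((\<Sum>j<n. s j - i j) + (s n - i n)) (s n - i n)))"
  by (simp add: qmult_def flip: lessThan_Suc_atMost)

lemma qmult_cong: "(\<And>j. j < n \<Longrightarrow> s j = s' j) \<Longrightarrow> qmult n s i = qmult n s' i"
  unfolding qmult_def by (intro prod.cong arg_cong2[of _ _ _ _ "(*)"] arg_cong[of _ _ "\<lambda>x. (-1) ^ x"]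
    arg_cong2[of _ _ _ _ "\<lambda>x y. of_nat (sbinom x y)"] sum.cong refl) auto

text \<open>A q-multinomial coefficient at q = -1: it counts, with signs, the lattice paths from i to s.\<close>

lemma qmult_rec:
  assumes "\<And>j. j < n \<Longrightarrow> i j \<le> s j" "(\<Sum>j<n. s j - i j) > 0"
  shows "qmult n s i = (\<Sum>j<n. if i j < s j then (-1) ^ (\<Sum>r<j. s r) * qmult n (s(j := s j - 1)) i else 0)"
  using assms
proof (induction n)
  case (Suc n)
  define a where "a = (\<Sum>j<n. s j - i j)"
  define S where "S = (\<Sum>j<n. s j)"
  define m where "m = s n - i n"
  define g where "g j = (if i j < s j then (-1) ^ (\<Sum>r<j. s r) * qmult n (s(j := s j - 1)) i else 0)" for j
  have aS: "a \<le> S" unfolding a_def S_def by (intro sum_mono) simp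
  have am: "a + m > 0" using Suc.prems(2) by (simp add: a_def m_def)
  \<comment> \<open>A step in an earlier slot lowers both S and a by one; the change of S produces
    the additional sign (-1)^m.\<close>
  have lower: "(if i j < s j then (-1) ^ (\<Sum>r<j. s r) * qmult (Suc n) (s(j := s j - 1)) i else 0)
     = g j * ((-1) ^ (S * m + m) * of_nat (sbinom (a + m - 1) m))" if j: "j < n" for j
  proof (cases "i j < s j")
    case True
    have split: "(\<Sum>k<n. f k) = f j + (\<Sum>k\<in>{..<n} - {j}. f k)" for f :: "nat \<Rightarrow> nat"
      using j by (subst sum.remove[of _ j]) auto
    have S': "Suc (\<Sum>k<n. (s(j := s j - 1)) k) = S"
      unfolding S_def split using True by simp
    have a': "Suc (\<Sum>k<n. (s(j := s j - 1)) k - i k) = a"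
      unfolding a_def split using True by simp
    have "(-1) ^ ((\<Sum>k<n. (s(j := s j - 1)) k) * m) = ((-1) ^ (S * m + m) :: complex)"
      unfolding S'[symmetric] by (simp add: minus_one_power_iff)
    moreover have "(\<Sum>k<n. (s(j := s j - 1)) k - i k) + m = a + m - 1"
      unfolding a'[symmetric] by simp
    moreover have "(s(j := s j - 1)) n - i n = m" using j by (simp add: m_def)
    ultimately show ?thesis using True by (simp only: qmult_Suc g_def if_True mult.assoc)
  qed (simp add: g_def)
  have top: "(if i n < s n then (-1) ^ (\<Sum>r<n. s r) * qmult (Suc n) (s(n := s n - 1)) i else 0)
     = qmult n s i * ((-1) ^ (S * m) * (if m = 0 then 0 else of_nat (sbinom (a + m - 1) (m - 1))))"
  proof (cases "i n < s n")
    case True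
    then have m: "m = Suc (m - 1)" by (simp add: m_def)
    have 1: "qmult n (s(n := s n - 1)) i = qmult n s i"
      by (rule qmult_cong) simp
    have 2: "(\<Sum>j<n. (s(n := s n - 1)) j) = S" "(\<Sum>j<n. (s(n := s n - 1)) j - i j) = a"
      by (simp_all add: S_def a_def)
    have 3: "(s(n := s n - 1)) n - i n = m - 1" using True by (simp add: m_def)
    have 4: "(-1) ^ S * (-1) ^ (S * (m - 1)) = ((-1) ^ (S * m) :: complex)"
      by (subst (2) m) (simp flip: power_add)
    have 5: "a + (m - 1) = a + m - 1" using m by simp
    show ?thesis
      using True m unfolding qmult_Suc 1 2 3 S_def[symmetric] 5 4[symmetric] by (simp add: ac_simps)
  qed (simp add: m_def)
  have IH: "(\<Sum>j<n. g j) * of_nat (sbinom (a + m - 1) m) = qmult n s i * of_nat (sbinom (a + m - 1) m)"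
  proof (cases "a > 0")
    case True
    then show ?thesis using Suc.IH Suc.prems(1) unfolding a_def g_def by simp
  next
    case False
    then have "sbinom (a + m - 1) m = 0"
      using am by (cases m) (auto simp: sbinom_def elim!: oddE evenE)
    then show ?thesis by simp
  qed
  have "(\<Sum>j<Suc n. if i j < s j then (-1) ^ (\<Sum>r<j. s r) * qmult (Suc n) (s(j := s j - 1)) i else 0)
     = (\<Sum>j<n. g j) * of_nat (sbinom (a + m - 1) m) * (-1) ^ (S * m + m)
       + qmult n s i * ((-1) ^ (S * m) * (if m = 0 then 0 else of_nat (sbinom (a + m - 1) (m - 1))))"
  proof -
    have "(\<Sum>j<n. if i j < s j then (-1) ^ (\<Sum>r<j. s r) * qmult (Suc n) (s(j := s j - 1)) i else 0)
       = (\<Sum>j<n. g j) * ((-1) ^ (S * m + m) * of_nat (sbinom (a + m - 1) m))"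
      by (simp only: sum_distrib_right) (rule sum.cong, simp, rule lower, simp)
    then show ?thesis by (simp only: sum.lessThan_Suc top ac_simps)
  qed
  also have "\<dots> = qmult n s i * ((-1) ^ (S * m) * ((-1) ^ m * of_nat (sbinom (a + m - 1) m) +
       (if m = 0 then 0 else of_nat (sbinom (a + m - 1) (m - 1)))))"
    unfolding IH by (simp add: power_add algebra_simps)
  also have "(-1) ^ m * of_nat (sbinom (a + m - 1) m) + (if m = 0 then 0 else of_nat (sbinom (a + m - 1) (m - 1)))
     = (of_nat (sbinom (a + m) m) :: complex)"
    using sbinom_Suc[of "a + m - 1" m] am by simp
  finally show ?case by (simp add: qmult_Suc a_def S_def m_def)
qed simp

text \<open>The denominators telescope: the first \<Xi> contributes
  \<open>hfact (s 0 - i 0)\<close>, and the factor at t replaces \<open>hfact (phi (t - 1))\<close>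
  by \<open>hfact (phi t)\<close>.\<close>

lemma Xi_prod_eq:
  assumes "n \<ge> 1" "\<And>j. j < n \<Longrightarrow> i j \<le> s j"
  defines "phi \<equiv> \<lambda>t. \<Sum>j\<le>t. s j - i j"
  shows "Xi (s 0) (i 0) (l 0) * (\<Prod>t\<in>{1..<n}. (-1) ^ ((\<Sum>j<t. s j) * (s t - i t)) *
        of_nat (sbinom (phi t) (s t - i t)) * Xi (s t) (i t) (l t)
            / (of_nat ((phi t div 2) choose ((s t - i t) div 2)) *
               of_nat (((phi t + 1) div 2) choose ((s t - i t + 1) div 2))))
    = (\<Prod>t<n. kprod (s t) (i t) (l t)) * qmult n s i / hfact (\<Sum>j<n. s j - i j)"
  using assms(1,2)
proof (induction n rule: dec_induct)
  case base
  then show ?case by (simp add: Xi_eq_kprod qmult_def)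
next
  case (step n)
  let ?m = "s n - i n" let ?a = "\<Sum>j<n. s j - i j"
  have phi: "phi n = ?a + ?m" by (simp add: phi_def flip: lessThan_Suc_atMost)
  have S: "{1..<Suc n} = insert n {1..<n}" using step by auto
  let ?P = "\<Prod>t<n. kprod (s t) (i t) (l t)"
  let ?B = "of_nat ((phi n div 2) choose (?m div 2)) * (of_nat (((phi n + 1) div 2) choose ((?m + 1) div 2)) :: complex)"
  let ?e = "(-1) ^ ((\<Sum>j<n. s j) * ?m) :: complex"
  have "of_nat (sbinom (phi n) ?m) / ?B / hfact ?m = of_nat (sbinom (phi n) ?m) * hfact ?a / hfact (phi n)"
    unfolding phi by (rule sbinom_hfact)
  moreover have "?e * of_nat (sbinom (phi n) ?m) * Xi (s n) (i n) (l n) / ?B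
     = ?e * kprod (s n) (i n) (l n) * (of_nat (sbinom (phi n) ?m) / ?B / hfact ?m)"
    using step.prems[of n] by (simp add: Xi_eq_kprod ac_simps)
  ultimately have t: "?e * of_nat (sbinom (phi n) ?m) * Xi (s n) (i n) (l n) / ?B
     = ?e * kprod (s n) (i n) (l n) * (of_nat (sbinom (phi n) ?m) * hfact ?a / hfact (phi n))"
    by (simp only:)
  have "?P * qmult n s i / hfact ?a * (?e * kprod (s n) (i n) (l n) * (of_nat (sbinom (phi n) ?m) * hfact ?a / hfact (phi n)))
     = (?P * kprod (s n) (i n) (l n)) * (qmult n s i * (?e * of_nat (sbinom (phi n) ?m))) / hfact (phi n)"
    by simp
  also have "\<dots> = (\<Prod>t<Suc n. kprod (s t) (i t) (l t)) * qmult (Suc n) s i / hfact (\<Sum>j<Suc n. s j - i j)"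
    by (simp add: qmult_Suc phi)
  finally have fin: "?P * qmult n s i / hfact ?a * (?e * kprod (s n) (i n) (l n) *
      (of_nat (sbinom (phi n) ?m) * hfact ?a / hfact (phi n))) = \<dots>" .
  define T where "T t = (-1) ^ ((\<Sum>j<t. s j) * (s t - i t)) *
        of_nat (sbinom (phi t) (s t - i t)) * Xi (s t) (i t) (l t)
            / (of_nat ((phi t div 2) choose ((s t - i t) div 2)) *
               of_nat (((phi t + 1) div 2) choose ((s t - i t + 1) div 2)))" for t
  have IH: "Xi (s 0) (i 0) (l 0) * (\<Prod>t\<in>{1..<n}. T t) = ?P * qmult n s i / hfact ?a"
    unfolding T_def using step.prems by (intro step.IH) simp
  have "Xi (s 0) (i 0) (l 0) * (\<Prod>t\<in>{1..<Suc n}. T t) = (Xi (s 0) (i 0) (l 0) * (\<Prod>t\<in>{1..<n}. T t)) * T n"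
    unfolding S by (simp add: ac_simps)
  also have "T n = ?e * kprod (s n) (i n) (l n) * (of_nat (sbinom (phi n) ?m) * hfact ?a / hfact (phi n))"
    unfolding T_def by (rule t)
  finally show ?case
    unfolding IH fin T_def[symmetric] .
qed

text \<open>The part of the constants that contains \<delta>. For non-resonant \<delta> and p + d at
  most K, \<open>gnorm \<delta> p d / hfact d\<close> is the reciprocal of the product of
  \<open>(-1) ^ e * kap e (\<delta> - (p + e) / 2)\<close> over e = 1, ..., d.\<close>

definition gnorm :: "complex \<Rightarrow> nat \<Rightarrow> nat \<Rightarrow> complex" where
  "gnorm \<delta> p d = (-1) ^ ((d + 1) div 2) / ((2 * \<delta> - of_nat p - 1) gchoose ((d + 1) div 2))"

lemma gchoose_nonresonant:
  assumes nr: "\<forall>j\<in>{1..K}. \<delta> \<noteq> of_nat j / 2" and "p + q \<le> K"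
  shows "((2 * \<delta> - of_nat p - 1) gchoose q) \<noteq> 0"
proof -
  have "2 * \<delta> - of_nat p - 1 - of_nat r \<noteq> 0" if "r < q" for r
  proof
    assume "2 * \<delta> - of_nat p - 1 - of_nat r = 0"
    then have "\<delta> = of_nat (p + 1 + r) / 2" by (simp add: field_simps)
    moreover have "p + 1 + r \<in> {1..K}" using that assms(2) by auto
    ultimately show False using nr by blast
  qed
  then show ?thesis by (simp add: gbinomial_prod_rev)
qed

text \<open>For odd d the generalized binomial does not change and \<open>kap\<close> is (d + 1)/2.
  For even d the factor \<open>kap\<close> is the numerator in the ratio of two consecutive
  binomials, and non-resonance keeps these non-zero.\<close>

lemma gnorm_rec:
  assumes nr: "\<forall>j\<in>{1..K}. \<delta> \<noteq> of_nat j / 2" and "p + Suc d \<le> K"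
  shows "(-1) ^ Suc d * kap (Suc d) (\<delta> - of_nat (p + Suc d) / 2) * gnorm \<delta> p (Suc d) =
    of_nat ((d + 2) div 2) * gnorm \<delta> p d"
proof (cases "even d")
  case False
  then obtain e where "d = 2 * e + 1" by (rule oddE)
  then show ?thesis by (simp add: gnorm_def kap_def)
next
  case True
  then obtain e where e: "d = 2 * e" by (rule evenE)
  define a where "a = 2 * \<delta> - of_nat p - 1"
  have nz: "(a gchoose e) \<noteq> 0" "(a gchoose Suc e) \<noteq> 0"
    unfolding a_def by (rule gchoose_nonresonant[OF nr]; use assms e in simp)+
  have k: "kap (Suc d) (\<delta> - of_nat (p + Suc d) / 2) = a - of_nat e"
    by (simp add: kap_def e a_def field_simps)
  have "(a - of_nat e) * (a gchoose e) = of_nat (Suc e) * (a gchoose Suc e)"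
    using gbinomial_mult_1[of a e] by (simp add: algebra_simps)
  moreover define b where "b = a - of_nat e"
  ultimately have "b / (a gchoose Suc e) = of_nat (Suc e) / (a gchoose e)"
    using nz by (simp add: frac_eq_eq)
  moreover have "(d + 2) div 2 = Suc e" "(Suc d + 1) div 2 = Suc e" "(d + 1) div 2 = e" using e by simp_all
  moreover have "(-1) ^ Suc d = (-1 :: complex)" using e by simp
  ultimately show ?thesis
    unfolding k gnorm_def a_def[symmetric] b_def[symmetric]
    by (simp add: e del: of_nat_Suc) (metis times_divide_eq_left)
qed

text \<open>Separates the constant into a part depending on \<delta> and the orders, a path weight
  common to all paths from i to s, and the signed number of paths. Each part obeys its own
  recursion.\<close>

lemma gamma_c_eq:
  assumes n: "length lam \<ge> 1" and "length s = length lam" "length i = length lam"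
    and le: "\<forall>t<length lam. i ! t \<le> s ! t"
  shows "gamma_c lam \<delta> s i = gnorm \<delta> (sum_list i) (sum_list s - sum_list i) / hfact (sum_list s - sum_list i) *
     ((\<Prod>t<length lam. kprod (s ! t) (i ! t) (lam ! t)) * qmult (length lam) ((!) s) ((!) i))"
proof -
  let ?n = "length lam"
  let ?d = "sum_list s - sum_list i"
  have d: "(\<Sum>j<?n. s ! j - i ! j) = ?d"
    unfolding sum_list_eq_sum[OF assms(2)] sum_list_eq_sum[OF assms(3)]
    using le by (intro sum_subtractf_nat) simp
  have "gamma_c lam \<delta> s i = gnorm \<delta> (sum_list i) ?d * (Xi (s ! 0) (i ! 0) (lam ! 0) *
      (\<Prod>t\<in>{1..<?n}. (-1) ^ ((\<Sum>j<t. s ! j) * (s ! t - i ! t)) *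
        of_nat (sbinom (\<Sum>j\<le>t. s ! j - i ! j) (s ! t - i ! t)) * Xi (s ! t) (i ! t) (lam ! t)
            / (of_nat (((\<Sum>j\<le>t. s ! j - i ! j) div 2) choose ((s ! t - i ! t) div 2)) *
               of_nat ((((\<Sum>j\<le>t. s ! j - i ! j) + 1) div 2) choose ((s ! t - i ! t + 1) div 2)))))"
    using assms by (simp add: gamma_c_def Let_def gnorm_def)
  also have "\<dots> = gnorm \<delta> (sum_list i) ?d * ((\<Prod>t<?n. kprod (s ! t) (i ! t) (lam ! t)) *
      qmult ?n ((!) s) ((!) i) / hfact ?d)"
    using Xi_prod_eq[OF n, of "(!) i" "(!) s" "(!) lam"] le unfolding d by simp
  finally show ?thesis by simp
qed

lemma gamma_c_eq_0: "\<not> (\<forall>t<length lam. i ! t \<le> s ! t) \<Longrightarrow> gamma_c lam \<delta> s i = 0"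
  by (auto simp: gamma_c_def Let_def)

text \<open>A last step in slot j carries the factor \<open>kap (s ! j) (lam ! j)\<close>, which
  completes the path weight of the lowered index to that of s. The sum over j is then the recursion
  of the signed path count, and \<open>gnorm_rec\<close> supplies the factor in front of the
  constant at s.\<close>

lemma gamma_c_induction_formula:
  assumes n: "length lam \<ge> 1" and nr: "\<forall>j\<in>{1..K}. \<delta> \<noteq> of_nat j / 2"
  shows "induction_formula lam \<delta> K (gamma_c lam \<delta>)"
  unfolding induction_formula_def Let_def kap_def[symmetric]
proof (intro ballI impI)
  let ?n = "length lam"
  fix i s assume i: "i \<in> mi ?n K" and s: "s \<in> mi ?n K" and l: "sum_list i < sum_list s"
  have len: "length s = ?n" "length i = ?n" using i s by (auto simp: mi_def)
  let ?w = "\<lambda>j. if s ! j = 0 then 0 else gamma_c lam \<delta> (s[j := s ! j - 1]) i"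
  show "(-1) ^ (sum_list s - sum_list i) * kap (sum_list s - sum_list i) (\<delta> - of_nat (sum_list s) / 2) * gamma_c lam \<delta> s i
    - (\<Sum>j<?n. (-1) ^ (\<Sum>r<j. s ! r) * kap (s ! j) (lam ! j) * ?w j) = 0"
  proof (cases "\<forall>t<?n. i ! t \<le> s ! t")
    case False
    then obtain t where t: "t < ?n" "s ! t < i ! t" by auto
    \<comment> \<open>If some entry of s is below that of i, lowering s keeps it there, so every
      constant in the formula is zero.\<close>
    have "gamma_c lam \<delta> (s[j := s ! j - 1]) i = 0" if "j < ?n" for j
    proof (rule gamma_c_eq_0)
      have "s[j := s ! j - 1] ! t \<le> s ! t" using t len by (cases "j = t") auto
      then show "\<not> (\<forall>t<?n. i ! t \<le> s[j := s ! j - 1] ! t)" using t by force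
    qed
    note zero = this
    have "?w j = 0" if "j < ?n" for j
      using zero[OF that] by (cases "s ! j = 0") simp_all
    then have "(\<Sum>j<?n. (-1) ^ (\<Sum>r<j. s ! r) * kap (s ! j) (lam ! j) * ?w j) = 0"
      by (intro sum.neutral) (simp del: mult_eq_0_iff)
    then show ?thesis using gamma_c_eq_0[OF False] by simp
  next
    case True
    define p where "p = sum_list i"
    define d where "d = sum_list s - sum_list i - 1"
    have d: "sum_list s - sum_list i = Suc d" "sum_list s = p + Suc d" using l by (auto simp: d_def p_def)
    let ?sg = "\<lambda>j. (-1) ^ (\<Sum>r<j. s ! r) :: complex"
    let ?KP = "\<Prod>t<?n. kprod (s ! t) (i ! t) (lam ! t)"
    let ?q = "\<lambda>j. if i ! j < s ! j then ?sg j * qmult ?n (((!) s)(j := s ! j - 1)) ((!) i) else 0"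
    have sum_d: "(\<Sum>j<?n. s ! j - i ! j) = Suc d"
      unfolding d(1)[symmetric] sum_list_eq_sum[OF len(1)] sum_list_eq_sum[OF len(2)]
      using True by (intro sum_subtractf_nat) simp
    have q: "qmult ?n ((!) s) ((!) i) = (\<Sum>j<?n. ?q j)"
      using True sum_d by (intro qmult_rec) auto
    have term_eq: "?sg j * kap (s ! j) (lam ! j) * ?w j = gnorm \<delta> p d / hfact d * ?KP * ?q j" if j: "j < ?n" for j
    proof (cases "i ! j < s ! j")
      case lt: True
      let ?s = "s[j := s ! j - 1]"
      have le: "\<forall>t<?n. i ! t \<le> ?s ! t" using True lt len j by (auto simp: nth_list_update)
      have s1: "Suc (sum_list ?s) = sum_list s"
        using j len lt member_le_sum_list[of "s ! j" s] by (auto simp: sum_list_update)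
      have nth: "(!) ?s t = (((!) s)(j := s ! j - 1)) t" if "t < ?n" for t
        using that len j by (simp add: nth_list_update)
      have KP: "?KP = kap (s ! j) (lam ! j) * (\<Prod>t<?n. kprod (?s ! t) (i ! t) (lam ! t))"
      proof -
        have "kprod (s ! j) (i ! j) (lam ! j) = kap (s ! j) (lam ! j) * kprod (s ! j - 1) (i ! j) (lam ! j)"
          using kprod_Suc[of "i ! j" "s ! j - 1" "lam ! j"] lt by simp
        then show ?thesis
          using j len by (simp add: prod.remove[of "{..<?n}" j] nth_list_update mult.assoc)
      qed
      have "gamma_c lam \<delta> ?s i = gnorm \<delta> p d / hfact d *
        ((\<Prod>t<?n. kprod (?s ! t) (i ! t) (lam ! t)) * qmult ?n ((!) ?s) ((!) i))"
        using gamma_c_eq[OF n _ len(2) le, of \<delta>] len s1 d by (simp add: p_def)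
      also have "qmult ?n ((!) ?s) ((!) i) = qmult ?n (((!) s)(j := s ! j - 1)) ((!) i)"
        by (rule qmult_cong) (rule nth)
      finally show ?thesis using lt unfolding KP by simp
    next
      case False
      \<comment> \<open>Lowering s_j here would fall below i_j, where the constants vanish;
        accordingly \<open>qmult_rec\<close> has no step in slot j.\<close>
      then have eq: "i ! j = s ! j" using True j by (simp add: le_antisym)
      have "?w j = 0"
      proof (cases "s ! j = 0")
        case False
        then have "\<not> i ! j \<le> s[j := s ! j - 1] ! j" using eq j len by simp
        then show ?thesis using j gamma_c_eq_0[of lam i "s[j := s ! j - 1]"] by auto
      qed simp
      then show ?thesis using False by simp
    qed
    have "(\<Sum>j<?n. ?sg j * kap (s ! j) (lam ! j) * ?w j) = gnorm \<delta> p d / hfact d * ?KP * (\<Sum>j<?n. ?q j)"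
      unfolding sum_distrib_left by (rule sum.cong) (use term_eq in auto)
    also have "\<dots> = of_nat ((d + 2) div 2) * gnorm \<delta> p d / hfact (Suc d) * ?KP * qmult ?n ((!) s) ((!) i)"
      unfolding q hfact_Suc by (simp del: of_nat_Suc)
    also have "of_nat ((d + 2) div 2) * gnorm \<delta> p d = (-1) ^ Suc d * kap (Suc d) (\<delta> - of_nat (p + Suc d) / 2) * gnorm \<delta> p (Suc d)"
      using s d by (intro gnorm_rec[OF nr, symmetric]) (simp add: mi_def)
    finally show ?thesis
      unfolding gamma_c_eq[OF n len True] d p_def[symmetric] by simp
  qed
qed

lemma gamma_c_diag:
  assumes n: "length lam \<ge> 1" and s: "s \<in> lvl (length lam) p" and i: "i \<in> lvl (length lam) p"
  shows "gamma_c lam \<delta> s i = (if s = i then 1 else 0)"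
proof (cases "\<forall>t<length lam. i ! t \<le> s ! t")
  case False
  then show ?thesis using gamma_c_eq_0[OF False] by auto
next
  case True
  have len: "length s = length lam" "length i = length lam" using s i by (auto simp: lvl_def)
  have "(\<Sum>t<length lam. i ! t) = (\<Sum>t<length lam. s ! t)"
    using s i by (simp add: lvl_def flip: sum_list_eq_sum)
  then have "\<forall>t\<in>{..<length lam}. i ! t = s ! t"
    using True by (intro ballI sum_mono_inv[of "\<lambda>t. i ! t" "{..<length lam}"]) auto
  then have "s = i" using len by (auto intro: nth_equalityI)
  then show ?thesis
    using gamma_c_eq[OF n len True, of \<delta>] by (simp add: gnorm_def qmult_def)
qed

subsection \<open>Division of smooth functions\<close>

text \<open>A weighted average of k over the segment from c to x. Differentiating in x multiplies
  the weight by s, so the class is closed under derivatives. Weight 1 applied to f' gives the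
  difference quotient of f at c; weight s^(w-1) solves the singular equation below.\<close>

definition avg :: "real \<Rightarrow> (real \<Rightarrow> complex) \<Rightarrow> (real \<Rightarrow> complex) \<Rightarrow> real \<Rightarrow> complex" where
  "avg c \<rho> k x = integral {0..1} (\<lambda>s. \<rho> s * k (c + s * (x - c)))"

lemma smooth_chain:
  assumes "smooth_fun k"
  shows "((\<lambda>x. k (c + s * (x - c))) has_vector_derivative of_real s * vderiv k (c + s * (x - c))) (at x)"
    and "((\<lambda>s. k (c + s * (x - c))) has_vector_derivative of_real (x - c) * vderiv k (c + s * (x - c))) (at s)"
proof -
  have 1: "((\<lambda>x. c + s * (x - c)) has_vector_derivative s) (at x)"
    by (auto intro!: derivative_eq_intros)
  have 2: "((\<lambda>s. c + s * (x - c)) has_vector_derivative (x - c)) (at s)"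
    by (auto intro!: derivative_eq_intros)
  show "((\<lambda>x. k (c + s * (x - c))) has_vector_derivative of_real s * vderiv k (c + s * (x - c))) (at x)"
    using vector_diff_chain_at[OF 1 smooth_has_vderiv[OF assms]] by (simp add: o_def scaleR_conv_of_real)
  show "((\<lambda>s. k (c + s * (x - c))) has_vector_derivative of_real (x - c) * vderiv k (c + s * (x - c))) (at s)"
    using vector_diff_chain_at[OF 2 smooth_has_vderiv[OF assms]] by (simp add: o_def scaleR_conv_of_real)
qed

lemma continuous_avg_integrand:
  assumes "continuous_on {0..1} \<rho>" "smooth_fun k"
  shows "continuous_on (UNIV \<times> {0..1}) (\<lambda>(x, s). \<rho> s * k (c + s * (x - c)))"
proof -
  have "continuous_on (UNIV \<times> {0..1}) (\<lambda>z. \<rho> (snd z))"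
    by (rule continuous_on_compose2[OF assms(1)]) (auto intro!: continuous_intros)
  moreover have "continuous_on (UNIV \<times> {0..1}) (\<lambda>z. k (c + snd z * (fst z - c)))"
    by (rule continuous_on_compose2[OF smooth_continuous[OF assms(2), of UNIV]]) (auto intro!: continuous_intros)
  ultimately show ?thesis by (auto simp: case_prod_beta intro!: continuous_intros)
qed

lemma continuous_avg_integrand':
  assumes "continuous_on {0..1} \<rho>" "smooth_fun k"
  shows "continuous_on {0..1} (\<lambda>s. \<rho> s * k (c + s * (x - c)))"
  by (intro continuous_on_mult assms(1) continuous_on_compose2[OF smooth_continuous[OF assms(2), of UNIV]])
    (auto intro!: continuous_intros)

lemma avg_has_derivative:
  assumes "continuous_on {0..1} \<rho>" "smooth_fun k"
  shows "(avg c \<rho> k has_vector_derivative avg c (\<lambda>s. \<rho> s * of_real s) (vderiv k) x) (at x)"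
proof -
  have c': "continuous_on {0..1} (\<lambda>s. \<rho> s * of_real s)"
    by (intro continuous_intros assms)
  have "((\<lambda>x. integral (cbox 0 1) (\<lambda>s. \<rho> s * k (c + s * (x - c)))) has_vector_derivative
      integral (cbox 0 1) (\<lambda>s. \<rho> s * of_real s * vderiv k (c + s * (x - c)))) (at x within UNIV)"
  proof (rule leibniz_rule_vector_derivative)
    show "((\<lambda>x. \<rho> s * k (c + s * (x - c))) has_vector_derivative \<rho> s * of_real s * vderiv k (c + s * (x - c))) (at x within UNIV)" for x s
      using has_vector_derivative_mult_right[OF smooth_chain(1)[OF assms(2)], of "\<rho> s"] by (simp add: mult.assoc)
    show "(\<lambda>s. \<rho> s * k (c + s * (x - c))) integrable_on cbox 0 1" for x
      using integrable_continuous_real[OF continuous_avg_integrand'[OF assms]] by simp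
    show "continuous_on (UNIV \<times> cbox 0 1) (\<lambda>(x, s). \<rho> s * complex_of_real s * vderiv k (c + s * (x - c)))"
      using continuous_avg_integrand[OF c' smooth_vderiv[OF assms(2)]] by simp
  qed auto
  then show ?thesis by (simp add: avg_def[abs_def])
qed

lemma smooth_avg:
  assumes "continuous_on {0..1} \<rho>" "smooth_fun k"
  shows "smooth_fun (avg c \<rho> k)"
proof (rule smooth_funI[where P = "\<lambda>f. \<exists>\<rho> k. continuous_on {0..1} \<rho> \<and> smooth_fun k \<and> f = avg c \<rho> k"])
  show "\<exists>\<rho>' k'. continuous_on {0..1} \<rho>' \<and> smooth_fun k' \<and> avg c \<rho> k = avg c \<rho>' k'"
    using assms by blast
next
  fix f x assume "\<exists>\<rho> k. continuous_on {0..1} \<rho> \<and> smooth_fun k \<and> f = avg c \<rho> k"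
  then show "f differentiable (at x)"
    using avg_has_derivative differentiableI_vd by blast
next
  fix f assume "\<exists>\<rho> k. continuous_on {0..1} \<rho> \<and> smooth_fun k \<and> f = avg c \<rho> k"
  then obtain \<rho> k where r: "continuous_on {0..1} \<rho>" "smooth_fun k" "f = avg c \<rho> k" by blast
  have "vderiv f = avg c (\<lambda>s. \<rho> s * of_real s) (vderiv k)"
    unfolding r(3) by (rule vderivI) (rule avg_has_derivative[OF r(1,2)])
  moreover have "continuous_on {0..1} (\<lambda>s. \<rho> s * of_real s)"
    by (intro continuous_intros r)
  ultimately show "\<exists>\<rho> k. continuous_on {0..1} \<rho> \<and> smooth_fun k \<and> vderiv f = avg c \<rho> k"
    using smooth_vderiv[OF r(2)] by blast
qed

lemma hadamard:
  assumes "smooth_fun f"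
  shows "\<exists>h. smooth_fun h \<and> (\<forall>x. f x = f c + of_real (x - c) * h x)"
proof (intro exI[of _ "avg c (\<lambda>_. 1) (vderiv f)"] conjI allI)
  show "smooth_fun (avg c (\<lambda>_. 1) (vderiv f))"
    by (intro smooth_avg smooth_vderiv assms continuous_intros)
  fix x
  have "((\<lambda>s. of_real (x - c) * vderiv f (c + s * (x - c))) has_integral f (c + 1 * (x - c)) - f (c + 0 * (x - c))) {0..1}"
    by (rule fundamental_theorem_of_calculus) (simp, rule has_vector_derivative_at_within[OF smooth_chain(2)[OF assms]])
  from integral_unique[OF this]
  have "integral {0..1} (\<lambda>s. of_real (x - c) * vderiv f (c + s * (x - c))) = f x - f c"
    by simp
  then show "f x = f c + of_real (x - c) * avg c (\<lambda>_. 1) (vderiv f) x"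
    by (simp add: avg_def)
qed

lemma taylor_division:
  assumes "smooth_fun f"
  shows "\<exists>a k. smooth_fun k \<and> (\<forall>x. f x = (\<Sum>j<N. a j * of_real (x - c) ^ j) + of_real (x - c) ^ N * k x)"
proof (induction N)
  case 0
  then show ?case using assms by auto
next
  case (Suc N)
  then obtain a k where k: "smooth_fun k"
    "\<And>x. f x = (\<Sum>j<N. a j * of_real (x - c) ^ j) + of_real (x - c) ^ N * k x" by blast
  obtain h where h: "smooth_fun h" "\<And>x. k x = k c + of_real (x - c) * h x"
    using hadamard[OF k(1), of c] by blast
  define a' where "a' j = (if j < N then a j else k c)" for j
  have "f x = (\<Sum>j<Suc N. a' j * of_real (x - c) ^ j) + of_real (x - c) ^ Suc N * h x" for x
  proof -
    have "f x = (\<Sum>j<N. a j * of_real (x - c) ^ j) + of_real (x - c) ^ N * (k c + of_real (x - c) * h x)"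
      by (metis k(2) h(2))
    then show ?thesis by (simp add: a'_def algebra_simps)
  qed
  then show ?case using h(1) by blast
qed

text \<open>The left-hand side is the integral over [0, 1] of the s-derivative of s^w k(c + s(x -
  c)), whose boundary values are k(x) and 0. The bound on the real part of w makes the weight
  s^(w-1) continuous at 0.\<close>

lemma avg_powr_ode:
  assumes w: "Re w > 1" and k: "smooth_fun k"
  defines "J \<equiv> \<lambda>c. avg c (\<lambda>s. of_real s powr (w - 1)) k"
  shows "smooth_fun (J c)" "of_real (x - c) * vderiv (J c) x + w * J c x = k x"
proof -
  have cont: "continuous_on {0..1} (\<lambda>s. complex_of_real s powr v)" if "Re v > 0" for v
    using that by (intro continuous_on_powr_complex continuous_intros) auto
  have c1: "continuous_on {0..1} (\<lambda>s. complex_of_real s powr (w - 1))"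
    using w by (intro cont) simp
  show "smooth_fun (J c)" unfolding J_def by (rule smooth_avg[OF c1 k])
  have c2: "continuous_on {0..1} (\<lambda>s. complex_of_real s powr (w - 1) * of_real s)"
    by (intro continuous_intros c1)
  have vJ: "vderiv (J c) = avg c (\<lambda>s. of_real s powr (w - 1) * of_real s) (vderiv k)"
    unfolding J_def by (rule vderivI) (rule avg_has_derivative[OF c1 k])
  let ?f = "\<lambda>s. complex_of_real s powr w * k (c + s * (x - c))"
  let ?f' = "\<lambda>s. of_real (x - c) * (of_real s powr (w - 1) * of_real s * vderiv k (c + s * (x - c))) +
      w * (of_real s powr (w - 1) * k (c + s * (x - c)))"
  \<comment> \<open>The interior form of the fundamental theorem is used because s^w is
    differentiated only for s > 0; at s = 0 continuity suffices.\<close>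
  have "(?f' has_integral ?f 1 - ?f 0) {0..1}"
  proof (rule fundamental_theorem_of_calculus_interior)
    show "continuous_on {0..1} ?f"
      using w by (intro continuous_avg_integrand' cont k) simp
    fix s :: real assume s: "s \<in> {0<..<1}"
    have p: "((\<lambda>s. complex_of_real s powr w) has_vector_derivative w * of_real s powr (w - 1)) (at s)"
      using s by (intro has_vector_derivative_real_field has_field_derivative_powr) auto
    have "complex_of_real s powr w = of_real s powr (w - 1) * of_real s"
      using s by (simp add: powr_diff)
    then show "(?f has_vector_derivative ?f' s) (at s)"
      using has_vector_derivative_mult[OF p smooth_chain(2)[OF k, of c x s]] by (simp add: algebra_simps)
  qed auto
  from integral_unique[OF this] have "integral {0..1} ?f' = k x"
    by simp
  moreover have "integral {0..1} ?f' = of_real (x - c) * vderiv (J c) x + w * J c x"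
  proof -
    have i1: "(\<lambda>s. of_real s powr (w - 1) * of_real s * vderiv k (c + s * (x - c))) integrable_on {0..1}"
      by (intro integrable_continuous_real continuous_avg_integrand' c2 smooth_vderiv k)
    have i2: "(\<lambda>s. of_real s powr (w - 1) * k (c + s * (x - c))) integrable_on {0..1}"
      by (intro integrable_continuous_real continuous_avg_integrand' c1 k)
    show ?thesis
      unfolding vJ unfolding J_def avg_def
      by (subst integral_add) (auto intro!: integrable_on_mult_right i1 i2)
  qed
  ultimately show "of_real (x - c) * vderiv (J c) x + w * J c x = k x" by simp
qed

lemma smooth_shift: "smooth_fun (\<lambda>x. complex_of_real (x - c))"
  using smooth_diff[OF smooth_of_real smooth_const] by simp

lemma vderiv_shift_power:
  "vderiv (\<lambda>x. complex_of_real (x - c) ^ Suc m) = (\<lambda>x. of_nat (Suc m) * of_real (x - c) ^ m)"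
proof (rule vderivI)
  fix x
  have d: "((\<lambda>x. x - c) has_field_derivative 1) (at x)"
    by (auto intro!: derivative_eq_intros)
  have "((\<lambda>x. (x - c) ^ Suc m) has_field_derivative of_nat (Suc m) * (x - c) ^ m) (at x)"
    using DERIV_power[OF d, of "Suc m"] by simp
  from has_vector_derivative_of_real[OF this]
  show "((\<lambda>x. complex_of_real (x - c) ^ Suc m) has_vector_derivative of_nat (Suc m) * of_real (x - c) ^ m) (at x)"
    by simp
qed

lemma euler_ode_mod_polynomials:
  assumes f: "smooth_fun f"
  shows "\<exists>N a g. smooth_fun g \<and> (\<forall>x. f x = (\<Sum>j<N. a j * of_real (x - c) ^ j) +
     of_real (x - c) * (of_real (x - c) * vderiv g x + w * g x))"
proof -
  \<comment> \<open>The choice makes the real part of w + M larger than 1. Taking M as a successor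
    lets \<open>vderiv_shift_power\<close> apply to (x - c)^M.\<close>
  obtain m :: nat where m: "1 - Re w < real m" using reals_Archimedean2 by blast
  define M where "M = Suc m"
  have M: "Re (of_nat M + w) > 1" using m by (simp add: M_def)
  obtain a k where k: "smooth_fun k"
     "\<And>x. f x = (\<Sum>j<Suc M. a j * of_real (x - c) ^ j) + of_real (x - c) ^ Suc M * k x"
    using taylor_division[OF f, where N = "Suc M" and c = c] by blast
  define J where "J = avg c (\<lambda>s. of_real s powr (of_nat M + w - 1)) k"
  have J: "smooth_fun J" "\<And>x. of_real (x - c) * vderiv J x + (of_nat M + w) * J x = k x"
    using avg_powr_ode[OF M k(1), where c = c] by (simp_all add: J_def)
  define g where "g x = of_real (x - c) ^ M * J x" for x
  have p: "smooth_fun (\<lambda>x. complex_of_real (x - c) ^ M)"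
    by (intro smooth_power smooth_shift)
  have g: "smooth_fun g" unfolding g_def[abs_def] by (intro smooth_mult p J)
  have vg: "vderiv g x = of_real (x - c) ^ M * vderiv J x + of_nat M * of_real (x - c) ^ m * J x" for x
    unfolding g_def[abs_def] vderiv_mult[OF p J(1)] unfolding M_def vderiv_shift_power by simp
  have "of_real (x - c) * vderiv g x + w * g x = of_real (x - c) ^ M * k x" for x
  proof -
    have "of_real (x - c) * vderiv g x + w * g x =
       of_real (x - c) ^ M * (of_real (x - c) * vderiv J x + (of_nat M + w) * J x)"
      unfolding vg g_def M_def by (simp add: algebra_simps)
    then show ?thesis by (simp only: J(2))
  qed
  then have "of_real (x - c) * (of_real (x - c) * vderiv g x + w * g x) = of_real (x - c) ^ Suc M * k x" for x
    by simp
  then have "f x = (\<Sum>j<Suc M. a j * of_real (x - c) ^ j) +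
     of_real (x - c) * (of_real (x - c) * vderiv g x + w * g x)" for x
    by (simp only: k(2))
  then show ?thesis using g by blast
qed

subsection \<open>Uniqueness\<close>

lemma sring_of_smooth:
  assumes "smooth_fun f" "smooth_fun g"
  obtains G where "body G = f" "soul G = g"
proof -
  have "(f, g) \<in> {F. smooth_sf F}" using assms by (simp add: smooth_sf_def)
  then have "body (Abs_sring (f, g)) = f" "soul (Abs_sring (f, g)) = g"
    by (simp_all add: body.rep_eq soul.rep_eq Abs_sring_inverse)
  then show ?thesis using that by blast
qed

lemma dd_eq_0_imp_cst:
  assumes "dd F = 0"
  obtains k where "F = cst k"
proof -
  have s: "soul F = (\<lambda>x. 0)" using assms by (metis body_simps(1,12))
  have "vderiv (body F) = (\<lambda>x. 0)" using assms by (metis soul_simps(1,12))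
  then have "(body F has_vector_derivative 0) (at x)" for x
    using smooth_has_vderiv[OF smooth_body[of F], of x] by simp
  then have "(body F has_derivative (\<lambda>h. 0)) (at x)" for x
    by (simp add: has_vector_derivative_def)
  then have "\<exists>k. \<forall>x. body F x = k"
    using has_derivative_zero_unique[of UNIV "body F"] by (metis UNIV_I at_within_open convex_UNIV open_UNIV)
  then obtain k where "\<And>x. body F x = k" by blast
  then have "F = cst k" using s by (intro sring_eqI) simp_all
  then show ?thesis using that by blast
qed

text \<open>Commutation carries no sign, even when T changes parity as odd powers of D do; this
  agrees with the form of equivariance required of symbol maps.\<close>

locale intertwiner =
  fixes a b :: complex and T :: "sring \<Rightarrow> sring"
  assumes T_add: "T (F + G) = T F + T G"
    and T_cmult: "T (cst k * F) = cst k * T F"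
    and T_Lo: "T (Lo 0 1 a F) = Lo 0 1 b (T F)" "T (Lo 1 0 a F) = Lo 1 0 b (T F)"
begin

lemma T_zero [simp]: "T 0 = 0"
  using T_cmult[of 0 0] by simp

lemma T_sum: "T (sum f A) = (\<Sum>x\<in>A. T (f x))"
  by (induction A rule: infinite_finite_induct) (simp_all add: T_add)

lemma T_dd: "T (dd F) = dd (T F)"
proof -
  have "cst (1/2) * T (dd F) = cst (1/2) * dd (T F)"
    using T_Lo(1)[of F] by (simp add: Lo_th T_cmult)
  then show ?thesis by (rule cst_mult_cancel[rotated]) simp
qed

lemma Lo_shift: "Lo 1 c \<nu> F = Lo 1 0 \<nu> F + cst c * Lo 0 1 \<nu> F"
  by (simp add: Lo_def algebra_simps)

lemma T_Lo_shift: "T (Lo 1 c a F) = Lo 1 c b (T F)"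
  unfolding Lo_shift[of c] by (simp add: T_add T_cmult T_Lo)

end

text \<open>As the anticommutator of D with the field of (x + c) \<theta>, this is the density
  action of X_(x+c): the Euler field centred at -c, diagonal on powers of x + c and on their
  multiples by \<theta>.\<close>

definition euler :: "complex \<Rightarrow> complex \<Rightarrow> sring \<Rightarrow> sring" where
  "euler c \<nu> F = dd (Lo 1 c \<nu> F) + Lo 1 c \<nu> (dd F)"

context
  fixes c :: complex and X :: sring
  assumes X: "X = xx + cst c"
begin

lemma dd_X_power: "dd (X ^ r) = of_nat r * (th * X ^ (r - 1))"
  by (rule dd_pow_even) (simp_all add: X)

lemma dd_th_X_power: "dd (th * X ^ r) = X ^ r"
proof -
  have "th * (of_nat r * (th * X ^ (r - 1))) = 0"
    by (metis mult.left_commute mult_zero_right th_th')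
  then show ?thesis by (simp add: dd_mult dd_X_power)
qed

lemma Lo_X_power: "Lo 1 c \<nu> (X ^ r) = cst (of_nat r / 2 + \<nu>) * (th * X ^ r)"
proof -
  have "X * (of_nat r * (th * X ^ (r - 1))) = of_nat r * (th * X ^ r)"
    by (cases r) (simp_all add: ac_simps)
  moreover have "cst (of_nat r / 2) = cst (1/2) * of_nat r"
    by (simp flip: cst_of_nat cst_mult)
  moreover have "Lo 1 c \<nu> (X ^ r) = cst (1/2) * (X * (of_nat r * (th * X ^ (r - 1)))) + cst \<nu> * (th * X ^ r)"
    by (simp add: Lo_def dd_X_power mult.assoc flip: X)
  ultimately show ?thesis
    by (simp only: cst_add distrib_right mult.assoc)
qed

lemma Lo_th_X_power: "Lo 1 c \<nu> (th * X ^ r) = cst (1/2) * X ^ Suc r"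
  by (simp add: Lo_def dd_th_X_power mult.assoc flip: X)

lemma euler_X_power: "euler c \<nu> (X ^ r) = cst (\<nu> + of_nat r) * X ^ r"
proof -
  have "Lo 1 c \<nu> (of_nat r * (th * X ^ (r - 1))) = cst (of_nat r / 2) * X ^ r"
    unfolding cst_of_nat[symmetric] Lo_cmult Lo_th_X_power
    by (cases r) (simp_all add: cst_mult[symmetric] mult.assoc[symmetric] del: mult.assoc of_nat_Suc)
  then show ?thesis
    by (simp add: euler_def Lo_X_power dd_th_X_power dd_X_power flip: distrib_right cst_add)
      (simp add: algebra_simps)
qed

lemma euler_th_X_power: "euler c \<nu> (th * X ^ r) = cst (\<nu> + of_nat r + 1/2) * (th * X ^ r)"
proof -
  have "cst (1/2) * dd (X ^ Suc r) = cst (of_nat (Suc r) / 2) * (th * X ^ r)"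
    unfolding dd_X_power cst_of_nat[symmetric] by (simp add: cst_mult[symmetric] mult.assoc[symmetric] del: of_nat_Suc mult.assoc)
  then show ?thesis
    by (simp add: euler_def Lo_X_power Lo_th_X_power dd_th_X_power flip: distrib_right cst_add del: power_Suc)
      (simp add: add_divide_distrib algebra_simps)
qed

end

lemma euler_cst: "euler c \<nu> (cst k) = cst (\<nu> * k)"
  by (simp add: euler_def Lo_def dd_mult cst_mult mult.assoc)

lemma (in intertwiner) T_euler: "T (euler c a F) = euler c b (T F)"
  by (simp add: euler_def T_add T_dd T_Lo_shift)

text \<open>T F is a constant because D kills it, and on constants of weight b the Euler field acts
  by b. A different eigenvalue of F therefore forces T F = 0.\<close>

lemma (in intertwiner) T_eigenvector:
  assumes "dd (T F) = 0" "euler c a F = cst (a + e) * F" "b \<noteq> a + e"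
  shows "T F = 0"
proof -
  obtain k where k: "T F = cst k" using dd_eq_0_imp_cst[OF assms(1)] .
  have "cst (b * k) = cst (a + e) * cst k"
    using T_euler[of c F] unfolding assms(2) T_cmult k euler_cst by simp
  then have "cst ((b - (a + e)) * k) = 0"
    by (simp add: cst_mult cst_diff left_diff_distrib)
  then have "k = 0" using assms(3) by simp
  then show ?thesis using k by simp
qed

text \<open>Climbs the chain 1, \<theta>, X, \<theta> X, X^2, ... . D sends each element to a
  multiple of its predecessor, so \<open>T_eigenvector\<close> applies unless the Euler eigenvalue
  equals b, which happens at one place determined by m. There the element is instead produced from
  its predecessor by the raising field \<open>Lo 1 c\<close>, with a coefficient that is
  non-zero.\<close>

lemma (in intertwiner) T_X_power:
  fixes m :: nat
  assumes ab: "b = a + of_nat m / 2" and m: "m > 0" "kap m a \<noteq> 0" and X: "X = xx + cst c"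
  shows "T (X ^ r) = 0 \<and> T (th * X ^ r) = 0"
proof (induction r)
  have odd: "T (th * X ^ r) = 0" if 0: "T (X ^ r) = 0" for r
  proof (cases "m = 2 * r + 1")
    case True
    \<comment> \<open>For m = 2r + 1 the value \<open>kap m a\<close> is r + 2a, twice the
      coefficient in \<open>Lo_X_power\<close>.\<close>
    then have "of_nat r / 2 + a \<noteq> 0" using m by (auto simp: kap_def field_simps)
    moreover have "cst (of_nat r / 2 + a) * T (th * X ^ r) = 0"
      using T_Lo_shift[of c "X ^ r"] 0 by (simp add: Lo_X_power[OF X] T_cmult)
    ultimately show ?thesis using cst_mult_cancel[of "of_nat r / 2 + a" "T (th * X ^ r)" 0] by simp
  next
    case False
    show ?thesis
    proof (rule T_eigenvector)
      show "dd (T (th * X ^ r)) = 0" using 0 by (simp add: T_dd[symmetric] dd_th_X_power[OF X])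
      show "euler c a (th * X ^ r) = cst (a + (of_nat r + 1/2)) * (th * X ^ r)"
        using euler_th_X_power[OF X] by (simp add: add.assoc)
      have "of_nat m \<noteq> (of_nat (2 * r + 1) :: complex)" using False of_nat_eq_iff by blast
      then have "of_nat m / 2 \<noteq> (of_nat (2 * r + 1) / 2 :: complex)" by simp
      then show "b \<noteq> a + (of_nat r + 1/2)" by (simp add: ab add_divide_distrib add.commute)
    qed
  qed
  {
    case 0
    have "T (X ^ 0) = 0"
    proof (rule T_eigenvector)
      show "dd (T (X ^ 0)) = 0" by (simp add: T_dd[symmetric])
      show "euler c a (X ^ 0) = cst (a + 0) * X ^ 0" using euler_X_power[OF X, of a 0] by simp
      show "b \<noteq> a + 0" using m by (simp add: ab)
    qed
    then show ?case using odd by blast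
  next
    case (Suc r)
    have "T (X ^ Suc r) = 0"
    proof (cases "m = 2 * Suc r")
      case True
      have "cst (1/2) * T (X ^ Suc r) = 0"
        using T_Lo_shift[of c "th * X ^ r"] Suc unfolding Lo_th_X_power[OF X] T_cmult by simp
      then show ?thesis using cst_mult_cancel[of "1/2" "T (X ^ Suc r)" 0] by simp
    next
      case False
      show ?thesis
      proof (rule T_eigenvector)
        show "dd (T (X ^ Suc r)) = 0"
          using Suc unfolding T_dd[symmetric] dd_X_power[OF X] cst_of_nat[symmetric] T_cmult by simp
        show "euler c a (X ^ Suc r) = cst (a + of_nat (Suc r)) * X ^ Suc r"
          by (rule euler_X_power[OF X])
        have "of_nat m \<noteq> (of_nat (2 * Suc r) :: complex)" using False of_nat_eq_iff by blast
        then have "of_nat m / 2 \<noteq> (of_nat (2 * Suc r) / 2 :: complex)" by simp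
        then show "b \<noteq> a + of_nat (Suc r)" by (simp add: ab add_divide_distrib add.commute)
      qed
    qed
    then show ?case using odd by blast
  }
qed

text \<open>Four times the square of the odd action is the density action of X_((x-x0)^2). On the
  two components it decouples into the operators (x - x0)((x - x0) d/dx + w) with w = 2 \<nu> and w
  = 2 \<nu> + 1, each of which is solved modulo polynomials.\<close>

lemma decomposition_at_point:
  fixes x0 :: real
  defines "X \<equiv> xx + cst (- of_real x0)"
  shows "\<exists>M p q G. F = (\<Sum>j<M. cst (p j) * X ^ j) + (\<Sum>j<M. cst (q j) * (th * X ^ j)) +
     cst 4 * Lo 1 (- of_real x0) \<nu> (Lo 1 (- of_real x0) \<nu> G)"
proof -
  obtain M1 p g0 where g0: "smooth_fun g0" and
    p: "\<And>x. body F x = (\<Sum>j<M1. p j * of_real (x - x0) ^ j) + of_real (x - x0) * (of_real (x - x0) * vderiv g0 x + (2 * \<nu>) * g0 x)"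
    using euler_ode_mod_polynomials[OF smooth_body[of F], of x0 "2 * \<nu>"] by blast
  obtain M2 q g1 where g1: "smooth_fun g1" and
    q: "\<And>x. soul F x = (\<Sum>j<M2. q j * of_real (x - x0) ^ j) + of_real (x - x0) * (of_real (x - x0) * vderiv g1 x + (2 * \<nu> + 1) * g1 x)"
    using euler_ode_mod_polynomials[OF smooth_soul[of F], of x0 "2 * \<nu> + 1"] by blast
  obtain G where G: "body G = g0" "soul G = g1" using sring_of_smooth[OF g0 g1] .
  define M where "M = max M1 M2"
  define p' where "p' j = (if j < M1 then p j else 0)" for j
  define q' where "q' j = (if j < M2 then q j else 0)" for j
  have p': "(\<Sum>j<M1. p j * y ^ j) = (\<Sum>j<M. p' j * y ^ j)" for y
    unfolding p'_def M_def by (intro sum.mono_neutral_cong_left) auto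
  have q': "(\<Sum>j<M2. q j * y ^ j) = (\<Sum>j<M. q' j * y ^ j)" for y
    unfolding q'_def M_def by (intro sum.mono_neutral_cong_left) auto
  have X: "body X = (\<lambda>x. of_real (x - x0))" "soul X = (\<lambda>x. 0)" by (simp_all add: X_def fun_eq_iff)
  have Xp: "body (X ^ j) = (\<lambda>x. of_real (x - x0) ^ j)" "soul (X ^ j) = (\<lambda>x. 0)" for j
    by (induction j) (simp_all add: X fun_eq_iff)
  have bs: "body (sum f A) x = (\<Sum>j\<in>A. body (f j) x)" "soul (sum f A) x = (\<Sum>j\<in>A. soul (f j) x)" for f :: "nat \<Rightarrow> sring" and A x
    by (induction A rule: infinite_finite_induct) simp_all
  let ?c = "- complex_of_real x0"
  have L: "Lo 1 ?c \<nu> H = cst (1/2) * (X * dd H) + cst \<nu> * (th * H)" for H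
    by (simp add: Lo_def X_def mult.assoc)
  have ddX: "dd X = th" "eps X = X" by (simp_all add: X_def)
  have LL: "cst 4 * Lo 1 ?c \<nu> (Lo 1 ?c \<nu> G) = X * (X * dd (dd G)) + X * (th * dd G) + cst (2 * \<nu>) * (X * G)"
    unfolding L dd_simps dd_cmult dd_mult ddX eps_simps
    by (rule sring_eqI) (simp_all add: X algebra_simps)
  have "F = (\<Sum>j<M. cst (p' j) * X ^ j) + (\<Sum>j<M. cst (q' j) * (th * X ^ j)) + cst 4 * Lo 1 ?c \<nu> (Lo 1 ?c \<nu> G)"
    unfolding LL
  proof (rule sring_eqI)
    fix x
    show "body F x = body ((\<Sum>j<M. cst (p' j) * X ^ j) + (\<Sum>j<M. cst (q' j) * (th * X ^ j)) +
       (X * (X * dd (dd G)) + X * (th * dd G) + cst (2 * \<nu>) * (X * G))) x"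
      unfolding p p' by (simp add: bs Xp X G algebra_simps)
    show "soul F x = soul ((\<Sum>j<M. cst (p' j) * X ^ j) + (\<Sum>j<M. cst (q' j) * (th * X ^ j)) +
       (X * (X * dd (dd G)) + X * (th * dd G) + cst (2 * \<nu>) * (X * G))) x"
      unfolding q q' by (simp add: bs Xp X G algebra_simps)
  qed
  then show ?thesis by blast
qed

lemma (in intertwiner) T_eq_0:
  fixes m :: nat
  assumes ab: "b = a + of_nat m / 2" and m: "m > 0" "kap m a \<noteq> 0"
  shows "T F = 0"
proof -
  have "body (T F) x0 = 0 \<and> soul (T F) x0 = 0" for x0
  proof -
    define X where "X = xx + cst (- of_real x0)"
    obtain M p q G where "F = (\<Sum>j<M. cst (p j) * X ^ j) + (\<Sum>j<M. cst (q j) * (th * X ^ j)) +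
     cst 4 * Lo 1 (- of_real x0) a (Lo 1 (- of_real x0) a G)"
      using decomposition_at_point[of F x0 a] unfolding X_def by blast
    then have "T F = cst 4 * Lo 1 (- of_real x0) b (Lo 1 (- of_real x0) b (T G))"
      using T_X_power[OF ab m X_def] by (simp add: T_add T_sum T_cmult T_Lo_shift)
    then show ?thesis by (simp add: Lo_def dd_mult)
  qed
  then show ?thesis by (intro sring_eqI) auto
qed

section \<open>Reduction of the difference of two symbol maps to intertwiners of density
  modules\<close>

definition single :: "nat list \<Rightarrow> sring \<Rightarrow> nat list \<Rightarrow> sring" where
  "single s g i = (if i = s then g else 0)"

lemma supp_single: "s \<in> mi n K \<Longrightarrow> supp n K (single s g)"
  by (auto simp: supp_def single_def)

lemma supp_sum: "(\<And>s. s \<in> A \<Longrightarrow> supp n K (f s)) \<Longrightarrow> supp n K (\<lambda>i. \<Sum>s\<in>A. f s i)"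
  by (auto simp: supp_def intro!: sum.neutral)

lemma sum_single: "supp n K a \<Longrightarrow> (\<lambda>i. \<Sum>s\<in>mi n K. single s (a s) i) = a"
proof
  fix i assume "supp n K a"
  then show "(\<Sum>s\<in>mi n K. single s (a s) i) = a i"
    by (simp add: single_def supp_def sum.delta)
qed

text \<open>The Lie derivative is triangular by order: raising an entry of i can give s only if i
  has lower order, so at s itself only the density action remains.\<close>

lemma La_single:
  assumes "s \<in> mi (length lam) K"
  shows "La h c lam \<delta> (single s g) i = single s (Lo h c (\<delta> - of_nat (sum_list s) / 2) g) i +
    (if sum_list i < sum_list s then La h c lam \<delta> (single s g) i else 0)"
proof (cases "sum_list i < sum_list s")
  case True
  then show ?thesis by (auto simp: single_def)
next
  case False
  have "i[p := Suc (i ! p)] \<noteq> s" if "p < length lam" for p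
  proof (cases "length i = length lam")
    case True
    then have "sum_list (i[p := Suc (i ! p)]) = Suc (sum_list i)"
      using that by (simp add: sum_list_update)
    then show ?thesis using False by auto
  next
    case False
    then show ?thesis using assms by (auto simp: mi_def)
  qed
  then have "(\<Sum>p<length lam. cst ((-1) ^ (\<Sum>r<p. i ! r) * kap (Suc (i ! p)) (lam ! p)) *
        eps (single s g (i[p := Suc (i ! p)]))) = 0"
    by (intro sum.neutral) (simp add: single_def)
  then show ?thesis using False by (simp add: La_def single_def)
qed

text \<open>Abstracts the difference of two symbol maps with the same principal symbol. The
  condition \<open>lower\<close> says that T strictly lowers the order, including the component of
  equal order, where the principal symbols cancel.\<close>

locale symbol_difference =
  fixes lam :: "complex list" and \<delta> :: complex and K :: nat
    and T :: "(nat list \<Rightarrow> sring) \<Rightarrow> nat list \<Rightarrow> sring"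
  assumes nonresonant: "\<forall>j\<in>{1..K}. \<delta> \<noteq> of_nat j / 2"
    and add: "supp (length lam) K a \<Longrightarrow> supp (length lam) K a' \<Longrightarrow> T (\<lambda>i. a i + a' i) i = T a i + T a' i"
    and cmult: "supp (length lam) K a \<Longrightarrow> T (\<lambda>i. cst k * a i) i = cst k * T a i"
    and equivariant: "supp (length lam) K a \<Longrightarrow> (h, c) \<in> {(0, 1), (1, 0)} \<Longrightarrow>
      T (La h c lam \<delta> a) i = Lo h c (\<delta> - of_nat (sum_list i) / 2) (T a i)"
    and lower: "supp (length lam) K a \<Longrightarrow> p \<le> K \<Longrightarrow> (\<And>s. p < sum_list s \<Longrightarrow> a s = 0) \<Longrightarrow>
      i \<in> mi (length lam) K \<Longrightarrow> p \<le> sum_list i \<Longrightarrow> T a i = 0"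
begin

lemma zero: "T (\<lambda>_. 0) i = 0"
  using cmult[of "\<lambda>_. 0" 0 i] by (simp add: supp_def)

lemma sum:
  assumes "finite A" "\<And>s. s \<in> A \<Longrightarrow> supp (length lam) K (f s)"
  shows "T (\<lambda>i. \<Sum>s\<in>A. f s i) i = (\<Sum>s\<in>A. T (f s) i)"
  using assms
proof (induction A rule: finite_induct)
  case empty
  then show ?case by (simp add: zero)
next
  case (insert x A)
  then show ?case using add[of "f x" "\<lambda>i. \<Sum>s\<in>A. f s i" i] supp_sum[of A "length lam" K f] by simp
qed

lemma single_add: "T (single s (F + G)) i = T (single s F) i + T (single s G) i"
  if "s \<in> mi (length lam) K"
proof -
  have "single s (F + G) = (\<lambda>i. single s F i + single s G i)"
    by (auto simp: single_def)
  then show ?thesis using add[OF supp_single[OF that] supp_single[OF that]] by simp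
qed

lemma single_cmult: "T (single s (cst k * F)) i = cst k * T (single s F) i"
  if "s \<in> mi (length lam) K"
proof -
  have "single s (cst k * F) = (\<lambda>i. cst k * single s F i)"
    by (auto simp: single_def)
  then show ?thesis using cmult[OF supp_single[OF that]] by simp
qed

text \<open>Induction on the order of s. The lower-order part of a Lie derivative is already
  annihilated, so g |-> \<open>T (single s g) i\<close> intertwines densities of weights \<delta> -
  |s|/2 and \<delta> - |i|/2. If |s| is at most |i|, the condition \<open>lower\<close> applies
  directly.\<close>

lemma single_eq_0:
  assumes "s \<in> mi (length lam) K" "i \<in> mi (length lam) K"
  shows "T (single s g) i = 0"
  using assms
proof (induction "sum_list s" arbitrary: s i g rule: less_induct)
  case less
  let ?n = "length lam"
  define l where "l = sum_list s"
  define p where "p = sum_list i"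
  have s: "s \<in> mi ?n K" "l \<le> K" using less.prems(1) by (auto simp: mi_def l_def)
  show ?case
  proof (cases "l \<le> p")
    case True
    show ?thesis
    proof (rule lower)
      show "single s g s' = 0" if "l < sum_list s'" for s'
        using that by (auto simp: single_def l_def)
    qed (use s True less.prems supp_single p_def in auto)
  next
    case False
    define a where "a = \<delta> - of_nat l / 2"
    define b where "b = \<delta> - of_nat p / 2"
    have Lo_single: "T (single s (Lo h c a F)) i = Lo h c b (T (single s F) i)"
      if hc: "(h, c) \<in> {(0, 1), (1, 0)}" for h c F
    proof -
      \<comment> \<open>The part of the Lie derivative of order below l. Decomposed into single
        coefficients it falls under the induction hypothesis.\<close>
      define R where "R j = (if sum_list j < l then La h c lam \<delta> (single s F) j else 0)" for j
      have La0: "supp ?n K (La h c lam \<delta> (single s F))"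
        by (intro supp_La supp_single s)
      then have R: "supp ?n K R" by (auto simp: R_def supp_def)
      have "T R i = (\<Sum>s'\<in>mi ?n K. T (single s' (R s')) i)"
        unfolding sum_single[OF R, symmetric, THEN arg_cong[of _ _ "\<lambda>x. T x i"]]
        by (subst sum) (simp_all add: supp_single sum_single[OF R])
      also have "\<dots> = 0"
      proof (intro sum.neutral ballI)
        fix s' assume s': "s' \<in> mi ?n K"
        show "T (single s' (R s')) i = 0"
        proof (cases "sum_list s' < l")
          case True
          then show ?thesis using less.hyps[of s' i] s' less.prems(2) by (simp add: l_def)
        next
          case False
          then have "single s' (R s') = (\<lambda>_. 0)" by (auto simp: R_def single_def)
          then show ?thesis by (simp add: zero)
        qed
      qed
      finally have "T R i = 0" .
      moreover have "La h c lam \<delta> (single s F) = (\<lambda>j. single s (Lo h c a F) j + R j)"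
        using La_single[OF s(1), of h c \<delta> F] by (simp add: fun_eq_iff R_def a_def l_def)
      ultimately have "T (La h c lam \<delta> (single s F)) i = T (single s (Lo h c a F)) i"
        using add[OF supp_single[OF s(1)] R] by simp
      then show ?thesis
        using equivariant[OF supp_single[OF s(1)] hc] by (simp add: b_def p_def)
    qed
    interpret intertwiner a b "\<lambda>F. T (single s F) i"
      by unfold_locales (simp_all add: single_add single_cmult s Lo_single)
    have "p < l" using False by simp
    show ?thesis
    proof (rule T_eq_0[of "l - p"])
      show "b = a + of_nat (l - p) / 2"
        using \<open>p < l\<close> by (simp add: a_def b_def of_nat_diff field_simps)
      show "kap (l - p) a \<noteq> 0"
        unfolding a_def by (rule kap_nonresonant[OF nonresonant \<open>p < l\<close> s(2)])
    qed (use \<open>p < l\<close> in simp)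
  qed
qed

lemma eq_0:
  assumes "supp (length lam) K a" "i \<in> mi (length lam) K"
  shows "T a i = 0"
proof -
  have "T a i = T (\<lambda>i. \<Sum>s\<in>mi (length lam) K. single s (a s) i) i"
    by (simp add: sum_single[OF assms(1)])
  also have "\<dots> = 0"
    by (subst sum) (simp_all add: supp_single single_eq_0 assms(2))
  finally show ?thesis .
qed

end

section \<open>Transport of symbol maps to the ring of superfunctions\<close>

definition ring_map :: "((nat list \<Rightarrow> sfun) \<Rightarrow> nat list \<Rightarrow> sfun) \<Rightarrow> (nat list \<Rightarrow> sring) \<Rightarrow> nat list \<Rightarrow> sring" where
  "ring_map \<sigma> a i = Abs_sring (\<sigma> (\<lambda>i. Rep_sring (a i)) i)"

lemma ring_map_Rep:
  assumes "is_symbol_map n K P \<sigma>" "supp n K a"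
  shows "\<sigma> (\<lambda>i. Rep_sring (a i)) = (\<lambda>i. Rep_sring (ring_map \<sigma> a i))" "supp n K (ring_map \<sigma> a)"
proof -
  have "\<sigma> (\<lambda>i. Rep_sring (a i)) \<in> Dk n K"
    using assms Dk_Rep[of a n K] unfolding is_symbol_map_def bij_betw_def Sk_eq_Dk by blast
  then obtain b where b: "\<sigma> (\<lambda>i. Rep_sring (a i)) = (\<lambda>i. Rep_sring (b i))" "supp n K b"
    using Dk_obtain by blast
  then have "ring_map \<sigma> a = b" by (simp add: ring_map_def fun_eq_iff Rep_sring_inverse)
  then show "\<sigma> (\<lambda>i. Rep_sring (a i)) = (\<lambda>i. Rep_sring (ring_map \<sigma> a i))" "supp n K (ring_map \<sigma> a)"
    using b by simp_all
qed

lemma ring_map_properties: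
  assumes eq: "osp_equivariant lam mu K \<sigma>" and sym: "is_symbol_map (length lam) K P \<sigma>"
  defines "\<tau> \<equiv> ring_map \<sigma>"
  shows "supp (length lam) K a \<Longrightarrow> supp (length lam) K a' \<Longrightarrow> \<tau> (\<lambda>i. a i + a' i) i = \<tau> a i + \<tau> a' i"
    and "supp (length lam) K a \<Longrightarrow> \<tau> (\<lambda>i. cst k * a i) i = cst k * \<tau> a i"
    and "supp (length lam) K a \<Longrightarrow> (h, c) \<in> {(0, 1), (1, 0)} \<Longrightarrow>
      \<tau> (La h c lam (mu - sum_list lam) a) i = Lo h c (mu - sum_list lam - of_nat (sum_list i) / 2) (\<tau> a i)"
    and "supp (length lam) K a \<Longrightarrow> p \<le> K \<Longrightarrow> (\<And>s. p < sum_list s \<Longrightarrow> a s = 0) \<Longrightarrow>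
      i \<in> mi (length lam) K \<Longrightarrow> p \<le> sum_list i \<Longrightarrow>
      \<tau> a i = (if sum_list i = p then \<Sum>s\<in>lvl (length lam) p. cst (P s i) * a s else 0)"
proof -
  let ?n = "length lam" let ?\<delta> = "mu - sum_list lam"
  note R = ring_map_Rep[OF sym, folded \<tau>_def]
  show "\<tau> (\<lambda>i. a i + a' i) i = \<tau> a i + \<tau> a' i" if a: "supp ?n K a" and a': "supp ?n K a'" for a a' i
  proof -
    have s: "supp ?n K (\<lambda>i. a i + a' i)" using a a' by (simp add: supp_def)
    have "\<sigma> (fadd (\<lambda>i. Rep_sring (a i)) (\<lambda>i. Rep_sring (a' i))) = fadd (\<sigma> (\<lambda>i. Rep_sring (a i))) (\<sigma> (\<lambda>i. Rep_sring (a' i)))"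
      using sym a a' unfolding is_symbol_map_def by simp
    then have "(\<lambda>i. Rep_sring (\<tau> (\<lambda>i. a i + a' i) i)) = (\<lambda>i. Rep_sring (\<tau> a i + \<tau> a' i))"
      unfolding fadd_Rep R(1)[OF a] R(1)[OF a'] R(1)[OF s] .
    then show ?thesis by (metis Rep_sring_inject)
  qed
  show "\<tau> (\<lambda>i. cst k * a i) i = cst k * \<tau> a i" if a: "supp ?n K a" for k a i
  proof -
    have s: "supp ?n K (\<lambda>i. cst k * a i)" using a by (simp add: supp_def)
    have "\<sigma> (fscale k (\<lambda>i. Rep_sring (a i))) = fscale k (\<sigma> (\<lambda>i. Rep_sring (a i)))"
      using sym a unfolding is_symbol_map_def by simp
    then have "(\<lambda>i. Rep_sring (\<tau> (\<lambda>i. cst k * a i) i)) = (\<lambda>i. Rep_sring (cst k * \<tau> a i))"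
      unfolding fscale_Rep R(1)[OF a] R(1)[OF s] .
    then show ?thesis by (metis Rep_sring_inject)
  qed
  show "\<tau> (La h c lam ?\<delta> a) i = Lo h c (?\<delta> - of_nat (sum_list i) / 2) (\<tau> a i)"
    if a: "supp ?n K a" and hc: "(h, c) \<in> {(0, 1), (1, 0)}" for h c a i
  proof -
    obtain F where F: "Rep_sring F \<in> osp_gens" "eps F = - F" "F \<noteq> 0" "\<And>l G. lden l F G = Lo h c l G"
    proof -
      from hc consider "h = 0" "c = 1" | "h = 1" "c = 0" by auto
      then show thesis
      proof cases
        case 1
        then show ?thesis using that[of th] by (simp add: osp_gens_eq lden_th th_nonzero)
      next
        case 2
        then show ?thesis using that[of "xx * th"] by (simp add: osp_gens_eq lden_xth th_nonzero)
      qed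
    qed
    have s: "supp ?n K (La h c lam ?\<delta> a)" by (rule supp_La[OF a])
    have "op_represents ?n K (\<lambda>i. Rep_sring (La h c lam ?\<delta> a i)) (Lop lam mu K (Rep_sring F) (\<lambda>i. Rep_sring (a i)))"
      by (rule La_represents[OF a F(2-4)])
    moreover have "(\<lambda>i. Rep_sring (a i)) \<in> Dk ?n K" "(\<lambda>i. Rep_sring (La h c lam ?\<delta> a i)) \<in> Dk ?n K"
      using a s by simp_all
    ultimately have "\<sigma> (\<lambda>i. Rep_sring (La h c lam ?\<delta> a i)) = LS ?\<delta> (Rep_sring F) (\<sigma> (\<lambda>i. Rep_sring (a i)))"
      using eq F(1) unfolding osp_equivariant_def by blast
    then have "(\<lambda>i. Rep_sring (\<tau> (La h c lam ?\<delta> a) i)) =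
       (\<lambda>i. Rep_sring (Lo h c (?\<delta> - of_nat (sum_list i) / 2) (\<tau> a i)))"
      unfolding R(1)[OF a] R(1)[OF s] by (simp add: LS_def Rep_lden F(4))
    then show ?thesis by (metis Rep_sring_inject)
  qed
  show "\<tau> a i = (if sum_list i = p then \<Sum>s\<in>lvl ?n p. cst (P s i) * a s else 0)"
    if a: "supp ?n K a" and p: "p \<le> K" and high: "\<And>s. p < sum_list s \<Longrightarrow> a s = 0"
      and i: "i \<in> mi ?n K" "p \<le> sum_list i" for a p i
  proof -
    have S: "\<forall>x\<in>Dk ?n K. (\<forall>s. p < sum_list s \<longrightarrow> x s = szero) \<longrightarrow>
        (\<forall>i\<in>mi ?n K. p < sum_list i \<longrightarrow> \<sigma> x i = szero) \<and>
        (\<forall>i\<in>lvl ?n p. \<sigma> x i = ssum (\<lambda>s. sscale (P s i) (x s)) (lvl ?n p))"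
      using sym p unfolding is_symbol_map_def by simp
    have mem: "(\<lambda>i. Rep_sring (a i)) \<in> Dk ?n K" using a by simp
    have "\<forall>s. p < sum_list s \<longrightarrow> Rep_sring (a s) = szero" using high by (simp add: Rep_simps)
    note t = mp[OF bspec[OF S mem] this]
    show ?thesis
    proof (cases "sum_list i = p")
      case True
      then have "i \<in> lvl ?n p" using i by (simp add: lvl_def mi_def)
      then have "Rep_sring (\<tau> a i) = Rep_sring (\<Sum>s\<in>lvl ?n p. cst (P s i) * a s)"
        using conjunct2[OF t] unfolding R(1)[OF a] by (simp add: Rep_scale Rep_sum)
      then show ?thesis using True by (simp add: Rep_sring_inject)
    next
      case False
      then have "Rep_sring (\<tau> a i) = Rep_sring 0"
        using conjunct1[OF t] i unfolding R(1)[OF a] by (simp add: Rep_simps)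
      then show ?thesis using False by (simp add: Rep_sring_inject)
    qed
  qed
qed

lemma symbol_map_unique:
  assumes nr: "\<forall>j\<in>{1..K}. mu - sum_list lam \<noteq> of_nat j / 2"
    and eq: "osp_equivariant lam mu K \<sigma>1" "osp_equivariant lam mu K \<sigma>2"
    and sym: "is_symbol_map (length lam) K P \<sigma>1" "is_symbol_map (length lam) K P \<sigma>2"
    and "x \<in> Dk (length lam) K"
  shows "\<sigma>1 x = \<sigma>2 x"
proof -
  note p1 = ring_map_properties[OF eq(1) sym(1)] and p2 = ring_map_properties[OF eq(2) sym(2)]
  \<comment> \<open>Both maps have the same value P at top order by the fourth property in
    \<open>ring_map_properties\<close>, so their difference satisfies \<open>lower\<close>.\<close>
  interpret symbol_difference lam "mu - sum_list lam" K "\<lambda>a i. ring_map \<sigma>1 a i - ring_map \<sigma>2 a i"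
  proof
    show "\<forall>j\<in>{1..K}. mu - sum_list lam \<noteq> of_nat j / 2" by (rule nr)
  qed (simp_all add: p1(1) p2(1) p1(2) p2(2) p1(3) p2(3) p1(4) p2(4) right_diff_distrib)
  obtain a where a: "x = (\<lambda>i. Rep_sring (a i))" "supp (length lam) K a"
    using assms(6) Dk_obtain by blast
  have "ring_map \<sigma>1 a i = ring_map \<sigma>2 a i" for i
    using eq_0[OF a(2), of i] ring_map_Rep(2)[OF sym(1) a(2)] ring_map_Rep(2)[OF sym(2) a(2)]
    by (cases "i \<in> mi (length lam) K") (simp_all add: supp_def)
  then show ?thesis
    unfolding a(1) ring_map_Rep(1)[OF sym(1) a(2)] ring_map_Rep(1)[OF sym(2) a(2)] by simp
qed

theorem theorem3p1:
  fixes lam :: "complex list" and mu :: complex and K :: nat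
  defines "n \<equiv> length lam" and "\<delta> \<equiv> mu - sum_list lam"
  assumes n_pos: "n \<ge> 1"
    and non_resonant: "\<forall>j\<in>{1..K}. \<delta> \<noteq> of_nat j / 2"
  shows
    "(\<forall>w. induction_formula lam \<delta> K w \<and> diag_nonsingular n K w \<longrightarrow>
          osp_equivariant lam mu K (sigma_w n K w) \<and> is_symbol_map n K w (sigma_w n K w))
     \<and> (\<forall>P. diag_nonsingular n K P \<longrightarrow>
          (\<exists>w. induction_formula lam \<delta> K w \<and>
               (\<forall>p\<le>K. \<forall>s\<in>lvl n p. \<forall>i\<in>lvl n p. w s i = P s i)))
     \<and> induction_formula lam \<delta> K (gamma_c lam \<delta>)
     \<and> (\<forall>p\<le>K. \<forall>s\<in>lvl n p. \<forall>i\<in>lvl n p. gamma_c lam \<delta> s i = (if s = i then 1 else 0))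
     \<and> (\<forall>P \<sigma>1 \<sigma>2. osp_equivariant lam mu K \<sigma>1 \<and> is_symbol_map n K P \<sigma>1 \<and>
                  osp_equivariant lam mu K \<sigma>2 \<and> is_symbol_map n K P \<sigma>2 \<longrightarrow>
                  (\<forall>a\<in>Dk n K. \<sigma>1 a = \<sigma>2 a))"
proof (intro conjI allI impI ballI)
  fix w assume "induction_formula lam \<delta> K w \<and> diag_nonsingular n K w"
  then show "osp_equivariant lam mu K (sigma_w n K w)" "is_symbol_map n K w (sigma_w n K w)"
    unfolding n_def \<delta>_def by (auto intro: sigma_w_equivariant sigma_w_symbol_map)
next
  fix P
  show "\<exists>w. induction_formula lam \<delta> K w \<and> (\<forall>p\<le>K. \<forall>s\<in>lvl n p. \<forall>i\<in>lvl n p. w s i = P s i)"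
    using wsol_induction_formula[OF non_resonant, of lam P]
    by (intro exI[of _ "wsol lam \<delta> P"]) (auto simp: lvl_def wsol_top)
next
  show "induction_formula lam \<delta> K (gamma_c lam \<delta>)"
    using n_pos by (intro gamma_c_induction_formula[OF _ non_resonant]) (simp add: n_def)
next
  fix p s i assume "s \<in> lvl n p" "i \<in> lvl n p"
  then show "gamma_c lam \<delta> s i = (if s = i then 1 else 0)"
    using n_pos unfolding n_def by (intro gamma_c_diag)
next
  fix P \<sigma>1 \<sigma>2 a
  assume "osp_equivariant lam mu K \<sigma>1 \<and> is_symbol_map n K P \<sigma>1 \<and>
      osp_equivariant lam mu K \<sigma>2 \<and> is_symbol_map n K P \<sigma>2" "a \<in> Dk n K"
  then show "\<sigma>1 a = \<sigma>2 a"
    using non_resonant unfolding n_def \<delta>_def by (intro symbol_map_unique) auto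
qed

end
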